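(* Let $d\ge 1$, $K\ge 1$, $m\ge 1$, $n\ge 2$ and $\nu_K$ be integers with $1\le \nu_K\le n-1$, and put $N=(dn-1)+(K-1)(n-1)+\nu_K$ and $\tau=(dn-1,(n-1)^{K-1},\nu_K)$, a partition of $N$. Let $g=\gcd(m,n)$, let $\omega=\exp(2\pi \mathrm{i}k/m)$ with $k\in\mathbb{Z}$, $\gcd(k,g)=1$, let $u\in\mathbb{C}$, $u\ne 0$, not a root of unity, and let $\varpi=(\omega u^{-n/g},u^{m/g})$. For each reverse standard Young tableau $\mathbb{S}$ of shape $\tau$ let $\alpha(\mathbb{S})\in\mathbb{Z}_{\ge0}^N$ be defined by $\alpha(\mathbb{S})_i=(d+\mathrm{row}_{\mathbb{S}}[i]-2)m$ if $\mathrm{row}_{\mathbb{S}}[i]>1$ and $\alpha(\mathbb{S})_i=0$ if $\mathrm{row}_{\mathbb{S}}[i]=1$. Then the nonsymmetric Macdonald polynomials $\{M_{\alpha(\mathbb{S})}:\mathbb{S}\in\mathrm{Tab}_\tau\}$ in $N$ variables, specialized to $(q,t)=\varpi$, are a basis of isotype $\tau$ and are singular.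
   Context: **Tableaux.** The Ferrers diagram of a partition $\tau$ of $N$ has $\tau_r$ boxes in row $r$; rows are counted from bottom to top and columns from left to right (French notation). A reverse standard Young tableau (RSYT) of shape $\tau$ is a bijective filling of the boxes with $1,\dots,N$ whose entries decrease along rows (left to right) and along columns (bottom to top); $\mathrm{Tab}_\tau$ is the set of these. $\mathrm{row}_{\mathbb S}[i]$, $\mathrm{col}_{\mathbb S}[i]$ are the row and column of entry $i$, $\mathrm{CT}_{\mathbb S}[i]=\mathrm{col}_{\mathbb S}[i]-\mathrm{row}_{\mathbb S}[i]$, and $d[i]=\mathrm{CT}_{\mathbb S}[i]-\mathrm{CT}_{\mathbb S}[i+1]$. $\mathbb S^{(i)}$ is $\mathbb S$ with $i$ and $i+1$ interchanged. **Operators** (all acting on the right, on polynomials in $x_1,\dots,x_N$). With $s_i$ exchanging $x_i,x_{i+1}$ (and, on compositions, exchanging $\alpha_i,\alpha_{i+1}$), for $1\le i<N$: $$p(x)T_i=(1-t)x_{i+1}\frac{p(x)-p(xs_i)}{x_i-x_{i+1}}+t\,p(xs_i).$$ These satisfy the Hecke relations $(T_i+1)(T_i-t)=0$ and the braid relations. $p\pi(x)=p(qx_N,x_1,\dots,x_{N-1})$. Cherednik operators: $\xi_i=t^{i-1}T_{i-1}^{-1}\cdots T_1^{-1}\pi T_{N-1}T_{N-2}\cdots T_i$ (written in order of application from left to right). Dunkl operators: $p\mathcal D_N=(p-p\xi_N)/x_N$ and $\mathcal D_i=\frac1t T_i\mathcal D_{i+1}T_i$ for $1\le i<N$. **Nonsymmetric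 Macdonald polynomials.** For $\alpha\in\mathbb{Z}_{\ge0}^N$ let $\alpha^+$ be its nonincreasing rearrangement and $r_\alpha(i)=\#\{k:\alpha_k>\alpha_i\}+\#\{k\le i:\alpha_k=\alpha_i\}$. Write $\alpha\succ\beta$ if $\alpha\ne\beta$ and $\sum_{i\le j}\alpha_i\ge\sum_{i\le j}\beta_i$ for all $j$; write $\alpha\vartriangleright\beta$ if $|\alpha|=|\beta|$, $\alpha\neq\beta$ and either $\alpha^+\succ\beta^+$, or $\alpha^+=\beta^+$ and $\alpha\succ\beta$. For $q,t$ indeterminates, $M_\alpha$ is the simultaneous eigenfunction $M_\alpha\xi_i=\zeta_\alpha(i)M_\alpha$, $\zeta_\alpha(i)=q^{\alpha_i}t^{N-r_\alpha(i)}$ ($1\le i\le N$), of the form $M_\alpha=c_\alpha x^\alpha+\sum_{\beta\vartriangleleft\alpha}A_{\alpha,\beta}(q,t)x^\beta$ with $A_{\alpha,\beta}\in\mathbb{Q}(q,t)$ and $c_\alpha=q^{a}t^{b}$ ($a,b\in\mathbb Z$). The normalization is chosen so that, whenever $\alpha_i<\alpha_{i+1}$, $M_{\alpha s_i}=M_\alpha T_i+\frac{1-t}{1-\rho_i}M_\alpha$ with $\rho_i=\zeta_\alpha(i+1)/\zeta_\alpha(i)$ (equivalently $c_{\alpha s_i}=t\,c_\alpha$). **Singular.** $M_\alpha$ is singular at $(q,t)=\varpi$ if its coefficients $A_{\alpha,\beta}(q,t)$ have no pole at $\varpi$ (each can be written as a quotient of polynomials with denominator nonvanishing at $\varpi$),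 and the specialized polynomial satisfies $M_\alpha\mathcal D_i=0$ for $1\le i\le N$ (operators taken at $(q,t)=\varpi$). **Basis of isotype $\tau$.** A basis $\{p_{\mathbb S}:\mathbb S\in\mathrm{Tab}_\tau\}$ of a subspace of homogeneous polynomials of some fixed degree, invariant under all $T_i$, such that for all $\mathbb S$ and $1\le i<N$: (I) if $\mathrm{row}_{\mathbb S}[i]=\mathrm{row}_{\mathbb S}[i+1]$ then $p_{\mathbb S}T_i=t\,p_{\mathbb S}$; (II) if $\mathrm{col}_{\mathbb S}[i]=\mathrm{col}_{\mathbb S}[i+1]$ then $p_{\mathbb S}T_i=-p_{\mathbb S}$; (III) if $\mathrm{row}_{\mathbb S}[i]<\mathrm{row}_{\mathbb S}[i+1]$ and $\mathrm{col}_{\mathbb S}[i]>\mathrm{col}_{\mathbb S}[i+1]$ then $p_{\mathbb S}T_i=p_{\mathbb S^{(i)}}+\frac{t-1}{1-t^{-d[i]}}p_{\mathbb S}$; (IV) if $d[i]\le-2$ then $p_{\mathbb S}T_i=\frac{t(t^{d[i]+1}-1)(t^{d[i]-1}-1)}{(t^{d[i]}-1)^2}p_{\mathbb S^{(i)}}+\frac{t^{d[i]}(t-1)}{t^{d[i]}-1}p_{\mathbb S}$. *)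

theory Defs
  imports
    Complex_Main
    "HOL-Library.FuncSet"
    "HOL-Library.Poly_Mapping"
    "HOL-Combinatorics.Transposition"
    "HOL-Computational_Algebra.Polynomial"
    "HOL-Computational_Algebra.Fraction_Field"
begin

section \<open>Polynomials in the variables \<open>x\<^sub>1, x\<^sub>2, \<dots>\<close>\<close>

text \<open>An exponent vector, and likewise a composition \<open>\<alpha>\<close>, is a finitely supported map
  \<^typ>\<open>nat \<Rightarrow>\<^sub>0 nat\<close>; variables and parts are indexed from 1.\<close>

type_synonym 'a mpoly = "(nat \<Rightarrow>\<^sub>0 nat) \<Rightarrow>\<^sub>0 'a"

definition comps :: "nat \<Rightarrow> (nat \<Rightarrow>\<^sub>0 nat) set" where
  "comps N = {\<alpha>. Poly_Mapping.keys \<alpha> \<subseteq> {1..N}}"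

definition size_comp :: "nat \<Rightarrow> (nat \<Rightarrow>\<^sub>0 nat) \<Rightarrow> nat" where
  "size_comp N \<alpha> = (\<Sum>i\<in>{1..N}. Poly_Mapping.lookup \<alpha> i)"

definition homogeneous_polys :: "nat \<Rightarrow> nat \<Rightarrow> 'a::zero mpoly set" where
  "homogeneous_polys N D =
     {p. \<forall>\<alpha>\<in>Poly_Mapping.keys p. \<alpha> \<in> comps N \<and> size_comp N \<alpha> = D}"

definition Cst :: "'a::field \<Rightarrow> 'a mpoly" where
  "Cst c = Poly_Mapping.single 0 c"

definition Var :: "nat \<Rightarrow> 'a::field mpoly" where
  "Var i = Poly_Mapping.single (Poly_Mapping.single i 1) 1"

definition scale :: "'a::field \<Rightarrow> 'a mpoly \<Rightarrow> 'a mpoly" where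
  "scale c p = Cst c * p"

global_interpretation mpoly: vector_space "scale :: 'a::field \<Rightarrow> 'a mpoly \<Rightarrow> 'a mpoly"
  by unfold_locales
    (simp_all add: scale_def Cst_def distrib_left distrib_right single_add mult_single
      flip: mult.assoc)

definition psubst :: "(nat \<Rightarrow> 'a::field mpoly) \<Rightarrow> 'a mpoly \<Rightarrow> 'a mpoly" where
  "psubst \<sigma> p = (\<Sum>\<alpha>\<in>Poly_Mapping.keys p.
     scale (Poly_Mapping.lookup p \<alpha>)
       (\<Prod>j\<in>Poly_Mapping.keys \<alpha>. \<sigma> j ^ Poly_Mapping.lookup \<alpha> j))"

text \<open>Polynomials over a field form an integral domain, so the quotient is unique when it
  exists; it does exist in the uses below.\<close>

definition exact_quot :: "'a::field mpoly \<Rightarrow> 'a mpoly \<Rightarrow> 'a mpoly" where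
  "exact_quot p r = (THE h. h * r = p)"

section \<open>Hecke, Cherednik and Dunkl operators\<close>

text \<open>The operators act on the right: a product of operators is applied from left to right,
  and \<open>p T\<^sub>i\<close> is written \<open>hecke t i p\<close>.\<close>

definition swap_vars :: "nat \<Rightarrow> 'a::field mpoly \<Rightarrow> 'a mpoly" where
  "swap_vars i = psubst (\<lambda>j. Var (Transposition.transpose i (i + 1) j))"

definition hecke :: "'a::field \<Rightarrow> nat \<Rightarrow> 'a mpoly \<Rightarrow> 'a mpoly" where
  "hecke t i p =
     scale (1 - t) (Var (i + 1) * exact_quot (p - swap_vars i p) (Var i - Var (i + 1)))
     + scale t (swap_vars i p)"

definition affine_pi :: "nat \<Rightarrow> 'a::field \<Rightarrow> 'a mpoly \<Rightarrow> 'a mpoly" where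
  "affine_pi N q = psubst (\<lambda>j. if j = 1 then scale q (Var N) else Var (j - 1))"

text \<open>For \<open>t \<noteq> 0\<close> the Hecke operator is a bijection, by \<open>(T\<^sub>i + 1)(T\<^sub>i - t) = 0\<close>, so that
  \<^term>\<open>inv (hecke t i)\<close> is its genuine inverse.\<close>

definition cherednik :: "nat \<Rightarrow> 'a::field \<Rightarrow> 'a \<Rightarrow> nat \<Rightarrow> 'a mpoly \<Rightarrow> 'a mpoly" where
  "cherednik N q t i p =
     scale (t ^ (i - 1))
       (fold (hecke t) (rev [i..<N])
         (affine_pi N q
           (fold (\<lambda>j. inv (hecke t j)) (rev [1..<i]) p)))"

function dunkl :: "nat \<Rightarrow> 'a::field \<Rightarrow> 'a \<Rightarrow> nat \<Rightarrow> 'a mpoly \<Rightarrow> 'a mpoly" where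
  "dunkl N q t i p =
     (if i < N then scale (1 / t) (hecke t i (dunkl N q t (i + 1) (hecke t i p)))
      else exact_quot (p - cherednik N q t N p) (Var N))"
  by pat_completeness auto
termination by (relation "measure (\<lambda>(N, q, t, i, p). N - i)") auto

declare dunkl.simps [simp del]

section \<open>The field of rational functions in \<open>q\<close> and \<open>t\<close>\<close>

text \<open>The outer polynomial variable is \<open>q\<close>, the inner one is \<open>t\<close>.
  A point \<open>pt\<close> is the pair of values for \<open>(q, t)\<close>.\<close>

type_synonym ratfun = "rat poly poly fract"

definition qvar :: ratfun where "qvar = Fract [:0, 1:] 1"

definition tvar :: ratfun where "tvar = Fract [:[:0, 1:]:] 1"

definition eval2 :: "complex \<times> complex \<Rightarrow> rat poly poly \<Rightarrow> complex" where
  "eval2 pt f = poly (map_poly (\<lambda>c. poly (map_poly of_rat c) (snd pt)) f) (fst pt)"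

definition no_pole_at :: "complex \<times> complex \<Rightarrow> ratfun \<Rightarrow> bool" where
  "no_pole_at pt f \<longleftrightarrow> (\<exists>a b. f = Fract a b \<and> eval2 pt b \<noteq> 0)"

definition spec :: "complex \<times> complex \<Rightarrow> ratfun \<Rightarrow> complex" where
  "spec pt f =
     (THE v. \<exists>a b. f = Fract a b \<and> eval2 pt b \<noteq> 0 \<and> v = eval2 pt a / eval2 pt b)"

definition spec_poly :: "complex \<times> complex \<Rightarrow> ratfun mpoly \<Rightarrow> complex mpoly" where
  "spec_poly pt p = Poly_Mapping.map (spec pt) p"

section \<open>Nonsymmetric Macdonald polynomials\<close>

definition comp_rank :: "nat \<Rightarrow> (nat \<Rightarrow>\<^sub>0 nat) \<Rightarrow> nat \<Rightarrow> nat" where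
  "comp_rank N \<alpha> i =
     card {k\<in>{1..N}. Poly_Mapping.lookup \<alpha> k > Poly_Mapping.lookup \<alpha> i}
     + card {k\<in>{1..N}. k \<le> i \<and> Poly_Mapping.lookup \<alpha> k = Poly_Mapping.lookup \<alpha> i}"

definition zeta :: "nat \<Rightarrow> (nat \<Rightarrow>\<^sub>0 nat) \<Rightarrow> nat \<Rightarrow> ratfun" where
  "zeta N \<alpha> i = qvar ^ Poly_Mapping.lookup \<alpha> i * tvar ^ (N - comp_rank N \<alpha> i)"

definition parts :: "nat \<Rightarrow> (nat \<Rightarrow>\<^sub>0 nat) \<Rightarrow> nat list" where
  "parts N \<alpha> = map (Poly_Mapping.lookup \<alpha>) [1..<N + 1]"

definition sorted_parts :: "nat \<Rightarrow> (nat \<Rightarrow>\<^sub>0 nat) \<Rightarrow> nat list" where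
  "sorted_parts N \<alpha> = rev (sort (parts N \<alpha>))"

definition dominates :: "nat list \<Rightarrow> nat list \<Rightarrow> bool" where
  "dominates a b \<longleftrightarrow> a \<noteq> b \<and> (\<forall>j\<le>length a. sum_list (take j b) \<le> sum_list (take j a))"

definition above :: "nat \<Rightarrow> (nat \<Rightarrow>\<^sub>0 nat) \<Rightarrow> (nat \<Rightarrow>\<^sub>0 nat) \<Rightarrow> bool" where
  "above N \<alpha> \<beta> \<longleftrightarrow> size_comp N \<alpha> = size_comp N \<beta> \<and> \<alpha> \<noteq> \<beta> \<and>
     (dominates (sorted_parts N \<alpha>) (sorted_parts N \<beta>) \<or>
      sorted_parts N \<alpha> = sorted_parts N \<beta> \<and> dominates (parts N \<alpha>) (parts N \<beta>))"

definition swap_comp :: "nat \<Rightarrow> (nat \<Rightarrow>\<^sub>0 nat) \<Rightarrow> (nat \<Rightarrow>\<^sub>0 nat)" where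
  "swap_comp i \<alpha> = Poly_Mapping.map_key (Transposition.transpose i (i + 1)) \<alpha>"

text \<open>The normalization fixes \<open>M\<^sub>\<alpha>\<close> only up to a factor \<open>q\<^sup>a t\<^sup>b\<close> common to all rearrangements
  of \<open>\<alpha>\<close>; the predicate below holds of every family normalized in this way.\<close>

definition macdonald_family :: "nat \<Rightarrow> ((nat \<Rightarrow>\<^sub>0 nat) \<Rightarrow> ratfun mpoly) \<Rightarrow> bool" where
  "macdonald_family N M \<longleftrightarrow>
     (\<forall>\<alpha>\<in>comps N.
        (\<forall>i\<in>{1..N}. cherednik N qvar tvar i (M \<alpha>) = scale (zeta N \<alpha> i) (M \<alpha>)) \<and>
        (\<exists>(a::int) (b::int) A.
           M \<alpha> = Poly_Mapping.single \<alpha> (qvar powi a * tvar powi b)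
                 + (\<Sum>\<beta>\<in>{\<beta>\<in>comps N. above N \<alpha> \<beta>}. Poly_Mapping.single \<beta> (A \<beta>))) \<and>
        (\<forall>i\<in>{1..<N}. Poly_Mapping.lookup \<alpha> i < Poly_Mapping.lookup \<alpha> (i + 1) \<longrightarrow>
           M (swap_comp i \<alpha>) =
             hecke tvar i (M \<alpha>)
             + scale ((1 - tvar) / (1 - zeta N \<alpha> (i + 1) / zeta N \<alpha> i)) (M \<alpha>)))"

definition singular_at :: "nat \<Rightarrow> complex \<times> complex \<Rightarrow> ratfun mpoly \<Rightarrow> bool" where
  "singular_at N pt p \<longleftrightarrow>
     (\<forall>\<beta>. no_pole_at pt (Poly_Mapping.lookup p \<beta>)) \<and>
     (\<forall>i\<in>{1..N}. dunkl N (fst pt) (snd pt) i (spec_poly pt p) = 0)"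

section \<open>Reverse standard Young tableaux\<close>

text \<open>A partition is the list of its parts. A box is a pair (row, column), both counted from 1,
  and row 1 is the bottom row, of length \<^term>\<open>\<tau> ! 0\<close>.\<close>

definition diagram :: "nat list \<Rightarrow> (nat \<times> nat) set" where
  "diagram \<tau> = {(r, c). 1 \<le> r \<and> r \<le> length \<tau> \<and> 1 \<le> c \<and> c \<le> \<tau> ! (r - 1)}"

text \<open>Fillings are extensional (\<^const>\<open>undefined\<close> off the diagram), so that distinct elements
  of \<open>Tab \<tau>\<close> are distinct tableaux.\<close>

definition Tab :: "nat list \<Rightarrow> (nat \<times> nat \<Rightarrow> nat) set" where
  "Tab \<tau> = {S \<in> extensional (diagram \<tau>).
     bij_betw S (diagram \<tau>) {1..sum_list \<tau>} \<and>
     (\<forall>r c. (r, c) \<in> diagram \<tau> \<and> (r, c + 1) \<in> diagram \<tau> \<longrightarrow> S (r, c + 1) < S (r, c)) \<and>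
     (\<forall>r c. (r, c) \<in> diagram \<tau> \<and> (r + 1, c) \<in> diagram \<tau> \<longrightarrow> S (r + 1, c) < S (r, c))}"

definition row :: "nat list \<Rightarrow> (nat \<times> nat \<Rightarrow> nat) \<Rightarrow> nat \<Rightarrow> nat" where
  "row \<tau> S i = fst (inv_into (diagram \<tau>) S i)"

definition col :: "nat list \<Rightarrow> (nat \<times> nat \<Rightarrow> nat) \<Rightarrow> nat \<Rightarrow> nat" where
  "col \<tau> S i = snd (inv_into (diagram \<tau>) S i)"

definition ctab :: "nat list \<Rightarrow> (nat \<times> nat \<Rightarrow> nat) \<Rightarrow> nat \<Rightarrow> int" where
  "ctab \<tau> S i = int (col \<tau> S i) - int (row \<tau> S i)"

definition content_diff :: "nat list \<Rightarrow> (nat \<times> nat \<Rightarrow> nat) \<Rightarrow> nat \<Rightarrow> int" where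
  "content_diff \<tau> S i = ctab \<tau> S i - ctab \<tau> S (i + 1)"

definition swap_entries ::
  "nat list \<Rightarrow> nat \<Rightarrow> (nat \<times> nat \<Rightarrow> nat) \<Rightarrow> (nat \<times> nat \<Rightarrow> nat)" where
  "swap_entries \<tau> i S = restrict (Transposition.transpose i (i + 1) \<circ> S) (diagram \<tau>)"

definition isotype_basis ::
  "nat list \<Rightarrow> 'a::field \<Rightarrow> ((nat \<times> nat \<Rightarrow> nat) \<Rightarrow> 'a mpoly) \<Rightarrow> bool" where
  "isotype_basis \<tau> t p \<longleftrightarrow>
     (\<exists>V D. mpoly.subspace V \<and> V \<subseteq> homogeneous_polys (sum_list \<tau>) D \<and>
        (\<forall>i\<in>{1..<sum_list \<tau>}. \<forall>f\<in>V. hecke t i f \<in> V) \<and>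
        inj_on p (Tab \<tau>) \<and> mpoly.independent (p ` Tab \<tau>) \<and> mpoly.span (p ` Tab \<tau>) = V) \<and>
     (\<forall>S\<in>Tab \<tau>. \<forall>i\<in>{1..<sum_list \<tau>}.
        (let d = content_diff \<tau> S i; S' = swap_entries \<tau> i S in
          (row \<tau> S i = row \<tau> S (i + 1) \<longrightarrow> hecke t i (p S) = scale t (p S)) \<and>
          (col \<tau> S i = col \<tau> S (i + 1) \<longrightarrow> hecke t i (p S) = - p S) \<and>
          (row \<tau> S i < row \<tau> S (i + 1) \<and> col \<tau> S i > col \<tau> S (i + 1) \<longrightarrow>
             hecke t i (p S) = p S' + scale ((t - 1) / (1 - t powi (- d))) (p S)) \<and>
          (d \<le> -2 \<longrightarrow>
             hecke t i (p S) =
               scale (t * (t powi (d + 1) - 1) * (t powi (d - 1) - 1) / (t powi d - 1)\<^sup>2) (p S')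
               + scale (t powi d * (t - 1) / (t powi d - 1)) (p S))))"

definition tableau_comp ::
  "nat \<Rightarrow> nat \<Rightarrow> nat list \<Rightarrow> (nat \<times> nat \<Rightarrow> nat) \<Rightarrow> (nat \<Rightarrow>\<^sub>0 nat)" where
  "tableau_comp d m \<tau> S =
     (\<Sum>i\<in>{1..sum_list \<tau>}. Poly_Mapping.single i
        (if row \<tau> S i > 1 then (d + row \<tau> S i - 2) * m else 0))"

end

theory Submission
  imports Defs
begin

text \<open>At \<open>\<varpi>\<close> one has \<open>q\<^sup>a t\<^sup>b = 1\<close> exactly for the integer multiples \<open>(a, b)\<close> of \<open>(m, n)\<close>, so
  the weight \<open>\<zeta>\<^sub>\<alpha>\<close> of \<open>\<alpha> = \<alpha>(S)\<close> specializes to \<open>t\<close> raised to the contents of \<open>S\<close>. These contents,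
  together with the order of the entries, determine \<open>\<alpha>\<close> among all compositions \<open>\<gamma>\<close>. Up to a scalar,
  \<open>M\<^sub>\<alpha>\<close> is the image of \<open>x\<^sup>\<alpha>\<close> under a product of operators \<open>\<xi>\<^sub>j - \<zeta>\<^sub>\<gamma>(j)\<close>, and this scalar, a product
  of differences \<open>\<zeta>\<^sub>\<alpha>(j) - \<zeta>\<^sub>\<gamma>(j)\<close>, is nonzero at \<open>\<varpi>\<close>; hence \<open>M\<^sub>\<alpha>\<close> has no pole there.
  The triangularity that this needs is read off from the family of all \<open>M\<^sub>\<gamma>\<close>.

  The same works for \<open>\<beta> = \<alpha> s\<^sub>i\<close> when \<open>i\<close> lies on top of \<open>i + 1\<close> in \<open>S\<close>. There the normalization
  becomes \<open>M\<^sub>\<alpha> = M\<^sub>\<beta> (T\<^sub>i - t)\<close>, whence \<open>M\<^sub>\<alpha> T\<^sub>i = - M\<^sub>\<alpha>\<close>. If \<open>i\<close> and \<open>i + 1\<close> are in one row then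
  \<open>M\<^sub>\<alpha> (T\<^sub>i - t)\<close> would have, for generic parameters, a weight that no \<open>M\<^sub>\<gamma>\<close> has, so it vanishes. The two
  remaining relations are the normalization and its inverse. Finally \<open>N\<close> has content \<open>0\<close>, so \<open>\<xi>\<^sub>N\<close> fixes
  every \<open>M\<^sub>\<alpha>\<close>; therefore \<open>D\<^sub>N\<close>, and with it every \<open>D\<^sub>i\<close>, vanishes on their \<open>T\<close>-invariant span.\<close>

section \<open>Polynomials and divided differences\<close>

text \<open>That the contents of \<open>S\<close> determine \<alpha> is the combinatorial core. If
  \<gamma> has the same specialized weight, then the part of \<gamma> at the entry of a box
  \<open>b\<close> is \<open>m\<close> times a level \<open>\<kappa> b\<close>, and its position in
  the sorted \<gamma> is the content of \<open>b\<close> plus \<open>n * \<kappa> b\<close>. The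
  positions are 0, ..., N - 1, each taken once. Rows are treated from the top. The first box of the
  highest open row has the least content left, and the boxes in the next at most \<open>n\<close>
  positions share its level and have consecutive contents, as a jump to a higher level costs at
  least \<open>n\<close> in content. As long as row 1 is out of reach, a level that is too low would
  begin a run of \<open>n + 1\<close> contents, too long for the rows available; row 1 is settled
  from its last box. The obstacle is \<beta> = \<alpha> s_i. There one vertically adjacent pair of
  entries is in the wrong order, so a run may fall from row \<open>r\<^sub>0 + 1\<close> into row
  \<open>r\<^sub>0\<close>. These two rows are resolved together: a deviation in the upper row
  forces equal levels one above the other in two columns, while only one such column is
  allowed.\<close>

abbreviation lookup :: "('a \<Rightarrow>\<^sub>0 'b::zero) \<Rightarrow> 'a \<Rightarrow> 'b" where "lookup \<equiv> Poly_Mapping.lookup"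
abbreviation keys :: "('a \<Rightarrow>\<^sub>0 'b::zero) \<Rightarrow> 'a set" where "keys \<equiv> Poly_Mapping.keys"

section \<open>Constants, variables and monomials\<close>

lemma Cst_0 [simp]: "Cst 0 = 0"
  and Cst_1 [simp]: "Cst 1 = 1"
  and Cst_diff: "Cst (a - b) = Cst a - Cst b"
  and Cst_uminus: "Cst (- a) = - Cst a"
  and Cst_mult: "Cst (a * b) = Cst a * Cst b"
  by (simp_all add: Cst_def single_add single_diff single_uminus mult_single)

lemma poly_mapping_sum_single:
  fixes p :: "'b \<Rightarrow>\<^sub>0 'a::comm_monoid_add"
  shows "(\<Sum>\<alpha>\<in>keys p. Poly_Mapping.single \<alpha> (lookup p \<alpha>)) = p"
proof (rule poly_mapping_eqI)
  fix k
  show "lookup (\<Sum>\<alpha>\<in>keys p. Poly_Mapping.single \<alpha> (lookup p \<alpha>)) k = lookup p k"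
    by (simp add: lookup_sum lookup_single when_def in_keys_iff)
qed

lemma mult_eq_sum_single:
  fixes p p' :: "'a::field mpoly"
  assumes "finite X" "keys p \<subseteq> X" "finite Y" "keys p' \<subseteq> Y"
  shows "p * p' = (\<Sum>\<alpha>\<in>X. \<Sum>\<beta>\<in>Y. Poly_Mapping.single (\<alpha> + \<beta>) (lookup p \<alpha> * lookup p' \<beta>))"
proof -
  have e: "r = (\<Sum>\<alpha>\<in>Z. Poly_Mapping.single \<alpha> (lookup r \<alpha>))" if "finite Z" "keys r \<subseteq> Z" for r :: "'a mpoly" and Z
    by (subst poly_mapping_sum_single[symmetric]) (rule sum.mono_neutral_left[OF that], auto simp: in_keys_iff)
  show ?thesis
    by (subst (1) e[OF assms(1,2)], subst (1) e[OF assms(3,4)]) (simp add: sum_product mult_single)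
qed

lemma prod_single_one:
  "finite A \<Longrightarrow> (\<Prod>a\<in>A. Poly_Mapping.single (f a) 1) = (Poly_Mapping.single (sum f A) 1 :: 'a::field mpoly)"
  by (induction A rule: finite_induct) (simp_all add: mult_single)

lemma Var_power: "Var j ^ k = (Poly_Mapping.single (Poly_Mapping.single j k) 1 :: 'a::field mpoly)"
  by (induction k) (simp_all add: Var_def mult_single flip: single_add)

lemma prod_Var: "(\<Prod>j\<in>keys \<alpha>. Var j ^ lookup \<alpha> j) = (Poly_Mapping.single \<alpha> 1 :: 'a::field mpoly)"
  by (simp add: Var_power prod_single_one poly_mapping_sum_single)

lemma single_eq_Cst_prod:
  "Poly_Mapping.single \<alpha> c = Cst c * (\<Prod>j\<in>keys \<alpha>. Var j ^ lookup \<alpha> j)"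
  by (simp add: prod_Var Cst_def mult_single)

lemma Var_eq_iff [simp]: "(Var i :: 'a::field mpoly) = Var j \<longleftrightarrow> i = j"
proof
  assume "Var i = (Var j :: 'a mpoly)"
  then have "lookup (Var i :: 'a mpoly) (Poly_Mapping.single i 1) = lookup (Var j) (Poly_Mapping.single i 1)"
    by simp
  then have "Poly_Mapping.single i (1::nat) = Poly_Mapping.single j 1"
    by (simp add: Var_def lookup_single when_def split: if_splits)
  then show "i = j"
    by (metis lookup_single_eq lookup_single_not_eq zero_neq_one)
qed simp

section \<open>Polynomials with restricted coefficients and variables\<close>

definition subring :: "'a::field set \<Rightarrow> bool" where
  "subring A \<longleftrightarrow> 1 \<in> A \<and> (\<forall>a\<in>A. \<forall>b\<in>A. a - b \<in> A \<and> a * b \<in> A)"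

lemma
  assumes "subring A"
  shows subring_0: "0 \<in> A" and subring_1: "1 \<in> A"
    and subring_add: "a \<in> A \<Longrightarrow> b \<in> A \<Longrightarrow> a + b \<in> A"
    and subring_diff: "a \<in> A \<Longrightarrow> b \<in> A \<Longrightarrow> a - b \<in> A"
    and subring_uminus: "a \<in> A \<Longrightarrow> - a \<in> A"
    and subring_mult: "a \<in> A \<Longrightarrow> b \<in> A \<Longrightarrow> a * b \<in> A"
proof -
  show z: "0 \<in> A" and "1 \<in> A" using assms unfolding subring_def by (metis diff_self)+
  show d: "a - b \<in> A" and "a * b \<in> A" if "a \<in> A" "b \<in> A" for a b
    using assms that unfolding subring_def by blast+
  show m: "- a \<in> A" if "a \<in> A" for a using d[OF z that] by simp
  show "a + b \<in> A" if "a \<in> A" "b \<in> A" for a b using d[OF that(1) m[OF that(2)]] by simp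
qed

lemma subring_UNIV: "subring UNIV" by (simp add: subring_def)

text \<open>One notion for two purposes: \<open>J = {1..N}\<close> bounds the variables that occur,
  and \<open>A = regular pt\<close> excludes poles at \<open>pt\<close>. Each operator is shown once
  to preserve such a set.\<close>

definition polys_over :: "'a::field set \<Rightarrow> nat set \<Rightarrow> 'a mpoly set" where
  "polys_over A J = {p. \<forall>\<alpha>\<in>keys p. lookup p \<alpha> \<in> A \<and> keys \<alpha> \<subseteq> J}"

lemma polys_overI:
  "(\<And>\<alpha>. \<alpha> \<in> keys p \<Longrightarrow> lookup p \<alpha> \<in> A) \<Longrightarrow> (\<And>\<alpha>. \<alpha> \<in> keys p \<Longrightarrow> keys \<alpha> \<subseteq> J) \<Longrightarrow> p \<in> polys_over A J"
  by (simp add: polys_over_def)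

lemma polys_over_lookup:
  "subring A \<Longrightarrow> p \<in> polys_over A J \<Longrightarrow> lookup p \<alpha> \<in> A"
  by (cases "\<alpha> \<in> keys p") (auto simp: polys_over_def in_keys_iff subring_0)

lemma polys_over_UNIV [simp]: "p \<in> polys_over UNIV UNIV"
  by (simp add: polys_over_def)

context
  fixes A :: "'a::field set" and J :: "nat set"
  assumes A: "subring A"
begin

lemma polys_over_single: "c \<in> A \<Longrightarrow> keys \<alpha> \<subseteq> J \<Longrightarrow> Poly_Mapping.single \<alpha> c \<in> polys_over A J"
  by (simp add: polys_over_def)

lemma polys_over_0: "0 \<in> polys_over A J"
  by (simp add: polys_over_def)

lemma polys_over_Cst: "c \<in> A \<Longrightarrow> Cst c \<in> polys_over A J"
  by (simp add: Cst_def polys_over_single)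

lemma polys_over_Var: "i \<in> J \<Longrightarrow> Var i \<in> polys_over A J"
  by (simp add: Var_def polys_over_single subring_1[OF A])

lemma polys_over_add:
  assumes p: "p \<in> polys_over A J" and q: "q \<in> polys_over A J"
  shows "p + q \<in> polys_over A J"
proof (rule polys_overI)
  fix \<alpha> assume k: "\<alpha> \<in> keys (p + q)"
  show "lookup (p + q) \<alpha> \<in> A"
    by (simp add: lookup_add subring_add[OF A] polys_over_lookup[OF A p] polys_over_lookup[OF A q])
  show "keys \<alpha> \<subseteq> J"
    using k keys_add[of p q] p q by (fastforce simp: polys_over_def)
qed

lemma polys_over_sum: "(\<And>x. x \<in> X \<Longrightarrow> f x \<in> polys_over A J) \<Longrightarrow> sum f X \<in> polys_over A J"
  by (induction X rule: infinite_finite_induct) (auto simp: polys_over_0 polys_over_add)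

lemma polys_over_mult:
  assumes p: "p \<in> polys_over A J" and q: "q \<in> polys_over A J"
  shows "p * q \<in> polys_over A J"
proof -
  have "p * q = (\<Sum>\<alpha>\<in>keys p. \<Sum>\<beta>\<in>keys q. Poly_Mapping.single (\<alpha> + \<beta>) (lookup p \<alpha> * lookup q \<beta>))"
    by (rule mult_eq_sum_single) simp_all
  also have "\<dots> \<in> polys_over A J"
  proof (intro polys_over_sum polys_over_single)
    fix \<alpha> \<beta> assume "\<alpha> \<in> keys p" "\<beta> \<in> keys q"
    then show "lookup p \<alpha> * lookup q \<beta> \<in> A" "keys (\<alpha> + \<beta>) \<subseteq> J"
      using p q keys_add[of \<alpha> \<beta>] by (auto simp: polys_over_def intro!: subring_mult[OF A] dest!: subsetD)
  qed
  finally show ?thesis .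
qed

lemma polys_over_uminus: "p \<in> polys_over A J \<Longrightarrow> - p \<in> polys_over A J"
  by (simp add: polys_over_def subring_uminus[OF A] in_keys_iff)

lemma polys_over_diff: "p \<in> polys_over A J \<Longrightarrow> q \<in> polys_over A J \<Longrightarrow> p - q \<in> polys_over A J"
  using polys_over_add[OF _ polys_over_uminus, of p q] by simp

lemma polys_over_scale: "c \<in> A \<Longrightarrow> p \<in> polys_over A J \<Longrightarrow> scale c p \<in> polys_over A J"
  by (simp add: scale_def polys_over_mult polys_over_Cst)

end

text \<open>Constants from \<open>A\<close> and variables from \<open>J\<close> generate these
  polynomials as a ring. Claims that obey a product rule, such as the existence of divided
  differences, then need no computation with monomials.\<close>

lemma polys_over_induct [consumes 2, case_names Cst Var add mult]:
  assumes A: "subring A" and p: "p \<in> polys_over A J"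
    and C: "\<And>c. c \<in> A \<Longrightarrow> P (Cst c)" and V: "\<And>j. j \<in> J \<Longrightarrow> P (Var j)"
    and add: "\<And>p q. p \<in> polys_over A J \<Longrightarrow> q \<in> polys_over A J \<Longrightarrow> P p \<Longrightarrow> P q \<Longrightarrow> P (p + q)"
    and mult: "\<And>p q. p \<in> polys_over A J \<Longrightarrow> q \<in> polys_over A J \<Longrightarrow> P p \<Longrightarrow> P q \<Longrightarrow> P (p * q)"
  shows "P p"
proof -
  let ?Q = "\<lambda>p. p \<in> polys_over A J \<and> P p"
  have one: "?Q 1" using C[OF subring_1[OF A]] polys_over_Cst[OF A subring_1[OF A]] by simp
  have pow: "?Q (Var j ^ k)" if "j \<in> J" for j k
    using one that by (induction k) (auto simp: polys_over_mult[OF A] polys_over_Var[OF A] V mult)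
  have prod: "?Q (\<Prod>j\<in>X. Var j ^ f j)" if "X \<subseteq> J" for X and f :: "nat \<Rightarrow> nat"
    using that
  proof (induction X rule: infinite_finite_induct)
    case (insert x X)
    then have "?Q (Var x ^ f x)" "?Q (\<Prod>j\<in>X. Var j ^ f j)" using pow[of x "f x"] by auto
    with insert show ?case by (simp add: polys_over_mult[OF A] mult)
  qed (use one in auto)
  have "?Q (\<Sum>\<alpha>\<in>X. Poly_Mapping.single \<alpha> (lookup p \<alpha>))" if "X \<subseteq> keys p" for X
    using that
  proof (induction X rule: infinite_finite_induct)
    case (insert \<alpha> X)
    then have a: "lookup p \<alpha> \<in> A" "keys \<alpha> \<subseteq> J" using p by (auto simp: polys_over_def)
    have "?Q (Poly_Mapping.single \<alpha> (lookup p \<alpha>))"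
      unfolding single_eq_Cst_prod using prod[OF a(2)] a(1)
      by (simp add: polys_over_mult[OF A] polys_over_Cst[OF A] mult C)
    with insert show ?case by (simp add: polys_over_add[OF A] add)
  qed (use C[OF subring_0[OF A]] polys_over_0[OF A] in auto)
  from this[of "keys p"] show ?thesis by (simp add: poly_mapping_sum_single)
qed

lemmas mpoly_induct [case_names Cst Var add mult] =
  polys_over_induct[OF subring_UNIV polys_over_UNIV, simplified]

section \<open>Substitution for the variables\<close>

definition mon :: "(nat \<Rightarrow> 'a::field mpoly) \<Rightarrow> (nat \<Rightarrow>\<^sub>0 nat) \<Rightarrow> 'a mpoly" where
  "mon \<sigma> \<alpha> = (\<Prod>j\<in>keys \<alpha>. \<sigma> j ^ lookup \<alpha> j)"

lemma mon_superset:
  "finite X \<Longrightarrow> keys \<alpha> \<subseteq> X \<Longrightarrow> mon \<sigma> \<alpha> = (\<Prod>j\<in>X. \<sigma> j ^ lookup \<alpha> j)"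
  unfolding mon_def by (rule prod.mono_neutral_left) (auto simp: in_keys_iff)

lemma mon_add: "mon \<sigma> (\<alpha> + \<beta>) = mon \<sigma> \<alpha> * mon \<sigma> \<beta>"
proof -
  let ?X = "keys \<alpha> \<union> keys \<beta>"
  have "mon \<sigma> (\<alpha> + \<beta>) = (\<Prod>j\<in>?X. \<sigma> j ^ lookup (\<alpha> + \<beta>) j)"
    by (rule mon_superset) (auto simp: keys_add)
  also have "\<dots> = mon \<sigma> \<alpha> * mon \<sigma> \<beta>"
    by (simp add: mon_superset[of ?X] lookup_add power_add prod.distrib)
  finally show ?thesis .
qed

lemma psubst_superset:
  "finite X \<Longrightarrow> keys p \<subseteq> X \<Longrightarrow> psubst \<sigma> p = (\<Sum>\<alpha>\<in>X. scale (lookup p \<alpha>) (mon \<sigma> \<alpha>))"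
  unfolding psubst_def mon_def by (rule sum.mono_neutral_left) (auto simp: in_keys_iff)

lemma psubst_add: "psubst \<sigma> (p + q) = psubst \<sigma> p + psubst \<sigma> q"
proof -
  let ?X = "keys p \<union> keys q"
  have "psubst \<sigma> (p + q) = (\<Sum>\<alpha>\<in>?X. scale (lookup (p + q) \<alpha>) (mon \<sigma> \<alpha>))"
    by (rule psubst_superset) (auto simp: keys_add)
  also have "\<dots> = psubst \<sigma> p + psubst \<sigma> q"
    by (simp add: psubst_superset[of ?X] lookup_add mpoly.scale_left_distrib sum.distrib)
  finally show ?thesis .
qed

lemma psubst_single: "psubst \<sigma> (Poly_Mapping.single \<alpha> c) = Cst c * mon \<sigma> \<alpha>"
  by (simp add: psubst_superset[of "{\<alpha>}"] scale_def)

lemma psubst_0 [simp]: "psubst \<sigma> 0 = 0" by (simp add: psubst_def)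

lemma psubst_sum: "psubst \<sigma> (sum f X) = (\<Sum>x\<in>X. psubst \<sigma> (f x))"
  by (induction X rule: infinite_finite_induct) (simp_all add: psubst_add)

lemma psubst_mult: "psubst \<sigma> (p * q) = psubst \<sigma> p * psubst \<sigma> q"
proof -
  note e = mult_eq_sum_single[OF finite_keys order_refl finite_keys order_refl]
  show ?thesis
    unfolding e[of p q] psubst_sum psubst_single Cst_mult mon_add
    by (simp add: psubst_superset[OF _ order_refl] scale_def sum_product mult_ac)
qed

lemma psubst_Cst [simp]: "psubst \<sigma> (Cst c) = Cst c"
  unfolding Cst_def by (simp add: psubst_single mon_def Cst_def)

lemma psubst_Var [simp]: "psubst \<sigma> (Var i) = \<sigma> i"
  unfolding Var_def by (simp add: psubst_single mon_def)

lemma psubst_1 [simp]: "psubst \<sigma> 1 = 1"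
  using psubst_Cst[of \<sigma> 1] by simp

lemma psubst_uminus: "psubst \<sigma> (- p) = - psubst \<sigma> p"
  using psubst_add[of \<sigma> p "- p"] by (simp add: eq_neg_iff_add_eq_0 add.commute)

lemma psubst_diff: "psubst \<sigma> (p - q) = psubst \<sigma> p - psubst \<sigma> q"
  using psubst_add[of \<sigma> p "- q"] by (simp add: psubst_uminus)

lemma psubst_scale: "psubst \<sigma> (scale c p) = scale c (psubst \<sigma> p)"
  by (simp add: scale_def psubst_mult)

lemmas psubst_simps = psubst_add psubst_diff psubst_uminus psubst_mult psubst_scale

lemma psubst_psubst: "psubst \<sigma> (psubst \<tau> p) = psubst (\<lambda>j. psubst \<sigma> (\<tau> j)) p"
  by (induction p rule: mpoly_induct) (simp_all add: psubst_simps)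

lemma psubst_id: "(\<And>j. \<sigma> j = Var j) \<Longrightarrow> psubst \<sigma> p = p"
  by (induction p rule: mpoly_induct) (simp_all add: psubst_simps)

lemma psubst_closed:
  assumes "subring A" "p \<in> polys_over A J" "\<And>j. j \<in> J \<Longrightarrow> \<sigma> j \<in> polys_over A J'"
  shows "psubst \<sigma> p \<in> polys_over A J'"
  using assms(1,2)
proof (induction rule: polys_over_induct)
qed (simp_all add: psubst_simps assms polys_over_Cst polys_over_add polys_over_mult)

section \<open>Exchange of variables and divided differences\<close>

lemma swap_vars_Var: "swap_vars i (Var j) = Var (Transposition.transpose i (i + 1) j)"
  by (simp add: swap_vars_def)

lemma swap_vars_Cst [simp]: "swap_vars i (Cst c) = Cst c"
  by (simp add: swap_vars_def)

lemma swap_vars_simps: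
  "swap_vars i (p + q) = swap_vars i p + swap_vars i q"
  "swap_vars i (p - q) = swap_vars i p - swap_vars i q"
  "swap_vars i (- p) = - swap_vars i p"
  "swap_vars i (p * q) = swap_vars i p * swap_vars i q"
  "swap_vars i (scale c p) = scale c (swap_vars i p)"
  "swap_vars i 1 = 1"
  by (simp_all add: swap_vars_def psubst_simps)

lemma swap_vars_swap_vars [simp]: "swap_vars i (swap_vars i p) = p"
  unfolding swap_vars_def psubst_psubst by (rule psubst_id) simp

lemma swap_vars_closed:
  assumes "subring A" "p \<in> polys_over A J" "i \<in> J" "i + 1 \<in> J"
  shows "swap_vars i p \<in> polys_over A J"
  unfolding swap_vars_def
  by (rule psubst_closed[OF assms(1,2)])
    (use assms in \<open>auto intro!: polys_over_Var simp: Transposition.transpose_def\<close>)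

text \<open>The twisted Leibniz rule p q - s(p q) = (p - s p) q + s p (q - s q) reduces the claim to
  variables. Locating the quotient in \<open>polys_over A J\<close> is what later shows that T_i
  creates no poles.\<close>

lemma divided_difference_exists:
  assumes A: "subring A" and "p \<in> polys_over A J" and i: "i \<in> J" "i + 1 \<in> J"
  shows "\<exists>h\<in>polys_over A J. h * (Var i - Var (i + 1)) = p - swap_vars i p"
  using A assms(2)
proof (induction rule: polys_over_induct)
  case (Cst c)
  show ?case by (intro bexI[of _ 0] polys_over_0[OF A]) simp
next
  case (Var j)
  consider "j = i" | "j = i + 1" | "j \<noteq> i" "j \<noteq> i + 1" by blast
  then show ?case
  proof cases
    case 1
    have "1 \<in> polys_over A J" using polys_over_Cst[OF A subring_1[OF A]] by simp
    then show ?thesis using 1 by (intro bexI[of _ 1]) (simp_all add: swap_vars_Var)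
  next
    case 2
    have "- 1 \<in> polys_over A J"
      using polys_over_uminus[OF A polys_over_Cst[OF A subring_1[OF A]]] by simp
    then show ?thesis using 2 by (intro bexI[of _ "- 1"]) (simp_all add: swap_vars_Var)
  next
    case 3
    then show ?thesis by (intro bexI[of _ 0] polys_over_0[OF A]) (simp add: swap_vars_Var)
  qed
next
  case (add p q)
  then obtain h k where "h \<in> polys_over A J" "k \<in> polys_over A J"
    "h * (Var i - Var (i + 1)) = p - swap_vars i p" "k * (Var i - Var (i + 1)) = q - swap_vars i q" by blast
  then show ?case
    by (intro bexI[of _ "h + k"]) (simp_all add: polys_over_add[OF A] swap_vars_simps algebra_simps)
next
  case (mult p q)
  then obtain h k where hk: "h \<in> polys_over A J" "k \<in> polys_over A J"
    "h * (Var i - Var (i + 1)) = p - swap_vars i p" "k * (Var i - Var (i + 1)) = q - swap_vars i q" by blast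
  have "(h * q + swap_vars i p * k) * (Var i - Var (i + 1))
      = (h * (Var i - Var (i + 1))) * q + swap_vars i p * (k * (Var i - Var (i + 1)))"
    by (simp add: algebra_simps)
  also have "\<dots> = p * q - swap_vars i (p * q)"
    by (simp only: hk swap_vars_simps) (simp add: algebra_simps)
  finally show ?case using mult.hyps hk
    by (intro bexI[of _ "h * q + swap_vars i p * k"])
      (auto intro!: polys_over_add[OF A] polys_over_mult[OF A] swap_vars_closed[OF A] i)
qed

lemma exact_quot_eqI: "r \<noteq> 0 \<Longrightarrow> h * r = p \<Longrightarrow> exact_quot p r = h"
  unfolding exact_quot_def by (rule the_equality) auto

text \<open>With the denominator cleared, the exact quotient disappears. Polynomials form an
  integral domain, so this identity characterizes T_i; with its converse \<open>hecke_eqI\<close> it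
  is the source of the operator identities below.\<close>

lemma hecke_eq:
  "(Var i - Var (i + 1)) * hecke t i p =
     (1 - Cst t) * Var (i + 1) * p + (Cst t * Var i - Var (i + 1)) * swap_vars i p"
proof -
  obtain h where h: "h * (Var i - Var (i + 1)) = p - swap_vars i p"
    using divided_difference_exists[OF subring_UNIV polys_over_UNIV, of i p] by auto
  then have q: "exact_quot (p - swap_vars i p) (Var i - Var (i + 1)) = h"
    by (intro exact_quot_eqI) simp_all
  have "(Var i - Var (i + 1)) * hecke t i p
      = (1 - Cst t) * Var (i + 1) * (h * (Var i - Var (i + 1))) + (Var i - Var (i + 1)) * Cst t * swap_vars i p"
    unfolding hecke_def q by (simp add: scale_def Cst_diff algebra_simps)
  then show ?thesis unfolding h by (simp add: algebra_simps)
qed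

lemma hecke_eqI:
  assumes "(Var i - Var (i + 1)) * h =
     (1 - Cst t) * Var (i + 1) * p + (Cst t * Var i - Var (i + 1)) * swap_vars i p"
  shows "hecke t i p = h"
proof -
  have "(Var i - Var (i + 1)) * hecke t i p = (Var i - Var (i + 1)) * h"
    by (simp only: hecke_eq assms)
  then show ?thesis by simp
qed

lemma hecke_closed:
  assumes A: "subring A" and p: "p \<in> polys_over A J" and i: "i \<in> J" "i + 1 \<in> J" and t: "t \<in> A"
  shows "hecke t i p \<in> polys_over A J"
proof -
  obtain h where h: "h \<in> polys_over A J" "h * (Var i - Var (i + 1)) = p - swap_vars i p"
    using divided_difference_exists[OF A p i] by auto
  then have q: "exact_quot (p - swap_vars i p) (Var i - Var (i + 1)) = h"
    by (intro exact_quot_eqI) simp_all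
  show ?thesis unfolding hecke_def q
    using assms h by (auto intro!: polys_over_add[OF A] polys_over_scale[OF A] polys_over_mult[OF A]
        polys_over_Var[OF A] swap_vars_closed[OF A] subring_diff[OF A] subring_1[OF A])
qed

section \<open>Hecke and Cherednik operators\<close>

lemma hecke_add: "hecke t i (p + q) = hecke t i p + hecke t i q"
  by (rule hecke_eqI) (simp only: distrib_left hecke_eq swap_vars_simps, simp add: algebra_simps)

lemma hecke_Cst_mult: "hecke t i (Cst c * p) = Cst c * hecke t i p"
proof (rule hecke_eqI)
  have "(Var i - Var (i + 1)) * (Cst c * hecke t i p) = Cst c * ((Var i - Var (i + 1)) * hecke t i p)"
    by (simp add: algebra_simps)
  then show "(Var i - Var (i + 1)) * (Cst c * hecke t i p) =
    (1 - Cst t) * Var (i + 1) * (Cst c * p) + (Cst t * Var i - Var (i + 1)) * swap_vars i (Cst c * p)"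
    by (simp only: hecke_eq swap_vars_simps swap_vars_Cst) (simp add: algebra_simps)
qed

lemma hecke_scale: "hecke t i (scale c p) = scale c (hecke t i p)"
  by (simp add: scale_def hecke_Cst_mult)

lemma hecke_0 [simp]: "hecke t i 0 = 0"
  using hecke_Cst_mult[of t i 0 0] by simp

lemma hecke_uminus: "hecke t i (- p) = - hecke t i p"
  using hecke_Cst_mult[of t i "-1" p] by (simp add: Cst_uminus)

lemma hecke_diff: "hecke t i (p - q) = hecke t i p - hecke t i q"
  using hecke_add[of t i p "- q"] by (simp add: hecke_uminus)

text \<open>In the application \<open>x\<close>, \<open>y\<close> are the two adjacent variables,
  \<open>q\<close> is \<open>p\<close> with them exchanged, \<open>A\<close> is the image of
  \<open>p\<close> under T_i, and \<open>A'\<close> is \<open>A\<close> with the variables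
  exchanged.\<close>

lemma hecke_quadratic_aux:
  fixes x y t p q A A' :: "'a::idom"
  assumes "x \<noteq> y"
    and A: "(x - y) * A = (1 - t) * y * p + (t * x - y) * q"
    and A': "(y - x) * A' = (1 - t) * x * q + (t * y - x) * p"
  shows "(x - y) * ((t - 1) * A + t * p) = (1 - t) * y * A + (t * x - y) * A'"
proof -
  have "(x - y) * ((x - y) * ((t - 1) * A + t * p))
      = (x - y) * (t - 1) * ((x - y) * A) + (x - y) * (x - y) * t * p"
    by (simp add: algebra_simps)
  also have "\<dots> = (1 - t) * y * ((x - y) * A) - (t * x - y) * ((y - x) * A')"
    unfolding A A' by (simp add: algebra_simps)
  also have "\<dots> = (x - y) * ((1 - t) * y * A + (t * x - y) * A')"
    by (simp add: algebra_simps)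
  finally show ?thesis using assms(1) by simp
qed

lemma swap_hecke:
  "(swap_vars j (Var i) - swap_vars j (Var (i + 1))) * swap_vars j (hecke t i p) =
     (1 - Cst t) * swap_vars j (Var (i + 1)) * swap_vars j p
     + (Cst t * swap_vars j (Var i) - swap_vars j (Var (i + 1))) * swap_vars j (swap_vars i p)"
  using arg_cong[OF hecke_eq[of i t p], of "swap_vars j"]
  by (simp only: swap_vars_simps swap_vars_Cst)

lemma hecke_quadratic: "hecke t i (hecke t i p) = scale (t - 1) (hecke t i p) + scale t p"
proof (rule hecke_eqI, unfold scale_def Cst_diff Cst_1, rule hecke_quadratic_aux)
  show "(Var (i + 1) - Var i) * swap_vars i (hecke t i p)
      = (1 - Cst t) * Var i * swap_vars i p + (Cst t * Var (i + 1) - Var i) * p"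
    using swap_hecke[of i i t p] by (simp add: swap_vars_Var)
qed (use hecke_eq[of i t p] in simp_all)

text \<open>The formula comes from solving T^2 = (t - 1) T + t for the inverse of T.\<close>

definition hecke_inv :: "'a::field \<Rightarrow> nat \<Rightarrow> 'a mpoly \<Rightarrow> 'a mpoly" where
  "hecke_inv t i p = scale (1 / t) (hecke t i p + scale (1 - t) p)"

context
  fixes t :: "'a::field"
  assumes t: "t \<noteq> 0"
begin

lemma hecke_hecke_inv [simp]: "hecke t i (hecke_inv t i p) = p"
proof -
  have "hecke t i (hecke_inv t i p) = scale (1 / t) (scale (t - 1) (hecke t i p) + scale t p + scale (1 - t) (hecke t i p))"
    by (simp add: hecke_inv_def hecke_scale hecke_add hecke_quadratic)
  also have "\<dots> = scale (1 / t) (scale t p)"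
    by (simp add: mpoly.scale_left_diff_distrib)
  finally show ?thesis using t by simp
qed

lemma hecke_inv_hecke [simp]: "hecke_inv t i (hecke t i p) = p"
proof -
  have "hecke_inv t i (hecke t i p) = scale (1 / t) (scale (t - 1) (hecke t i p) + scale t p + scale (1 - t) (hecke t i p))"
    by (simp add: hecke_inv_def hecke_quadratic)
  also have "\<dots> = scale (1 / t) (scale t p)"
    by (simp add: mpoly.scale_left_diff_distrib)
  finally show ?thesis using t by simp
qed

lemma inv_hecke: "inv (hecke t i) = hecke_inv t i"
  by (rule inv_unique_comp) auto

end

section \<open>Commutation and braid relations\<close>

lemma hecke_commute_aux:
  fixes x y z w t :: "'a::idom"
  assumes "x \<noteq> y" "z \<noteq> w"
    and A: "(z - w) * A = (1 - t) * w * p + (t * z - w) * p2"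
    and Ai: "(z - w) * Ai = (1 - t) * w * p1 + (t * z - w) * p12"
    and C: "(x - y) * C = (1 - t) * y * A + (t * x - y) * Ai"
    and B: "(x - y) * B = (1 - t) * y * p + (t * x - y) * p1"
    and Bj: "(x - y) * Bj = (1 - t) * y * p2 + (t * x - y) * p12"
    and D: "(z - w) * D = (1 - t) * w * B + (t * z - w) * Bj"
  shows "C = D"
proof -
  have "(x - y) * (z - w) * C = (z - w) * ((x - y) * C)" by (simp add: algebra_simps)
  also have "\<dots> = (1 - t) * y * ((z - w) * A) + (t * x - y) * ((z - w) * Ai)"
    unfolding C by (simp add: algebra_simps)
  also have "\<dots> = (1 - t) * w * ((x - y) * B) + (t * z - w) * ((x - y) * Bj)"
    unfolding A Ai B Bj by (simp add: algebra_simps)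
  also have "\<dots> = (x - y) * ((z - w) * D)"
    unfolding D by (simp add: algebra_simps)
  finally show ?thesis using assms(1,2) by simp
qed

lemma swap_vars_commute:
  assumes "i + 1 < j \<or> j + 1 < i"
  shows "swap_vars i (swap_vars j p) = swap_vars j (swap_vars i p)"
  unfolding swap_vars_def psubst_psubst
  by (rule arg_cong[where f = "\<lambda>\<sigma>. psubst \<sigma> p"]) (use assms in \<open>auto simp: fun_eq_iff Transposition.transpose_def\<close>)

text \<open>In \<open>hecke_commute_aux\<close>, \<open>p1\<close>, \<open>p2\<close> and
  \<open>p12\<close> are the copies of \<open>p\<close> under the exchange at \<open>i\<close>, at
  \<open>j\<close> and at both. After clearing denominators, the two composites are the same
  combination of these copies and \<open>p\<close>.\<close>

lemma hecke_commute:
  assumes ij: "i + 1 < j \<or> j + 1 < i"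
  shows "hecke t i (hecke t j p) = hecke t j (hecke t i p)"
proof (rule hecke_commute_aux)
  have e: "Transposition.transpose i (Suc i) j = j" "Transposition.transpose i (Suc i) (Suc j) = Suc j"
    "Transposition.transpose j (Suc j) i = i" "Transposition.transpose j (Suc j) (Suc i) = Suc i"
    using ij by (auto simp: Transposition.transpose_def)
  show "(Var j - Var (j + 1)) * hecke t j p = (1 - Cst t) * Var (j + 1) * p + (Cst t * Var j - Var (j + 1)) * swap_vars j p"
    "(Var i - Var (i + 1)) * hecke t i p = (1 - Cst t) * Var (i + 1) * p + (Cst t * Var i - Var (i + 1)) * swap_vars i p"
    "(Var i - Var (i + 1)) * hecke t i (hecke t j p) = (1 - Cst t) * Var (i + 1) * hecke t j p + (Cst t * Var i - Var (i + 1)) * swap_vars i (hecke t j p)"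
    "(Var j - Var (j + 1)) * hecke t j (hecke t i p) = (1 - Cst t) * Var (j + 1) * hecke t i p + (Cst t * Var j - Var (j + 1)) * swap_vars j (hecke t i p)"
    by (fact hecke_eq)+
  show "(Var j - Var (j + 1)) * swap_vars i (hecke t j p) = (1 - Cst t) * Var (j + 1) * swap_vars i p + (Cst t * Var j - Var (j + 1)) * swap_vars i (swap_vars j p)"
    using swap_hecke[of i j t p] by (simp add: swap_vars_Var e)
  show "(Var i - Var (i + 1)) * swap_vars j (hecke t i p) = (1 - Cst t) * Var (i + 1) * swap_vars j p + (Cst t * Var i - Var (i + 1)) * swap_vars i (swap_vars j p)"
    using swap_hecke[of j i t p] by (simp add: swap_vars_Var e swap_vars_commute[OF ij])
qed simp_all

lemma swap_vars_braid:
  "swap_vars i (swap_vars (i + 1) (swap_vars i p)) = swap_vars (i + 1) (swap_vars i (swap_vars (i + 1) p))"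
  unfolding swap_vars_def psubst_psubst
  by (rule arg_cong[where f = "\<lambda>\<sigma>. psubst \<sigma> p"]) (auto simp: fun_eq_iff Transposition.transpose_def)

text \<open>Both sides of the braid relation are expanded in the six permuted copies of \<open>p\<close> after
  clearing the denominators \<open>x - y\<close>, \<open>x - z\<close>, \<open>y - z\<close>.\<close>

lemma hecke_braid_aux:
  fixes x y z t :: "'a::idom"
  assumes ne: "x \<noteq> y" "x \<noteq> z" "y \<noteq> z"
    and A: "(x - y) * A = (1 - t) * y * p + (t * x - y) * p1"
    and A1: "(y - x) * A1 = (1 - t) * x * p1 + (t * y - x) * p"
    and A2: "(x - z) * A2 = (1 - t) * z * p2 + (t * x - z) * p21"
    and A12: "(y - z) * A12 = (1 - t) * z * p12 + (t * y - z) * p121"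
    and B: "(y - z) * B = (1 - t) * z * A + (t * y - z) * A2"
    and B1: "(x - z) * B1 = (1 - t) * z * A1 + (t * x - z) * A12"
    and C: "(x - y) * C = (1 - t) * y * B + (t * x - y) * B1"
    and E: "(y - z) * E = (1 - t) * z * p + (t * y - z) * p2"
    and E2: "(z - y) * E2 = (1 - t) * y * p2 + (t * z - y) * p"
    and E1: "(x - z) * E1 = (1 - t) * z * p1 + (t * x - z) * p12"
    and E21: "(x - y) * E21 = (1 - t) * y * p21 + (t * x - y) * p121"
    and F: "(x - y) * F = (1 - t) * y * E + (t * x - y) * E1"
    and F2: "(x - z) * F2 = (1 - t) * z * E2 + (t * x - z) * E21"
    and G: "(y - z) * G = (1 - t) * z * F + (t * y - z) * F2"
  shows "C = G"
proof -
  let ?D = "(x - y) * (x - z) * (y - z)"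
  have "(x - y) * (?D * C) = ?D * ((x - y) * C)" by (simp only: mult_ac)
  also have "\<dots> = (1 - t) * y * (x - y) * (x - z) * ((y - z) * B) + (t * x - y) * (x - y) * (y - z) * ((x - z) * B1)"
    unfolding C by (simp only: distrib_left mult_ac)
  also have "\<dots> = (1 - t) * (1 - t) * y * z * (x - z) * ((x - y) * A) + (1 - t) * y * (t * y - z) * (x - y) * ((x - z) * A2)
     + ((t * x - y) * (1 - t) * z * (y - z) * ((x - y) * A1) + (t * x - y) * (t * x - z) * (x - y) * ((y - z) * A12))"
    unfolding B B1 by (simp only: distrib_left mult_ac)
  finally have L: "(x - y) * (?D * C) = (1 - t) * (1 - t) * y * z * (x - z) * ((x - y) * A)
     + (1 - t) * y * (t * y - z) * (x - y) * ((x - z) * A2)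
     + ((t * x - y) * (1 - t) * z * (y - z) * ((x - y) * A1) + (t * x - y) * (t * x - z) * (x - y) * ((y - z) * A12))" .
  have A1': "(x - y) * A1 = - ((1 - t) * x * p1 + (t * y - x) * p)"
    unfolding A1[symmetric] by (simp add: algebra_simps)
  have "(y - z) * (?D * G) = ?D * ((y - z) * G)" by (simp only: mult_ac)
  also have "\<dots> = (1 - t) * z * (y - z) * (x - z) * ((x - y) * F) + (t * y - z) * (x - y) * (y - z) * ((x - z) * F2)"
    unfolding G by (simp only: distrib_left mult_ac)
  also have "\<dots> = (1 - t) * (1 - t) * y * z * (x - z) * ((y - z) * E) + (1 - t) * z * (t * x - y) * (y - z) * ((x - z) * E1)
     + ((t * y - z) * (1 - t) * z * (x - y) * ((y - z) * E2) + (t * y - z) * (t * x - z) * (y - z) * ((x - y) * E21))"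
    unfolding F F2 by (simp only: distrib_left mult_ac)
  finally have R: "(y - z) * (?D * G) = (1 - t) * (1 - t) * y * z * (x - z) * ((y - z) * E)
     + (1 - t) * z * (t * x - y) * (y - z) * ((x - z) * E1)
     + ((t * y - z) * (1 - t) * z * (x - y) * ((y - z) * E2) + (t * y - z) * (t * x - z) * (y - z) * ((x - y) * E21))" .
  have E2': "(y - z) * E2 = - ((1 - t) * y * p2 + (t * z - y) * p)"
    unfolding E2[symmetric] by (simp add: algebra_simps)
  have "(x - y) * (y - z) * ?D * C = (y - z) * ((x - y) * (?D * C))" by (simp only: mult_ac)
  also have "\<dots> = (x - y) * ((y - z) * (?D * G))"
    unfolding L R A A1' A2 A12 E E1 E2' E21 by algebra
  also have "\<dots> = (x - y) * (y - z) * ?D * G" by (simp only: mult_ac)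
  finally show ?thesis using ne by simp
qed

text \<open>In \<open>hecke_braid_aux\<close> a digit 1 or 2 records an exchange at \<open>i\<close>
  or \<open>i + 1\<close>, the leftmost one applied last. The letters \<open>A\<close>,
  \<open>B\<close>, \<open>C\<close> are the successive stages of the left side and
  \<open>E\<close>, \<open>F\<close>, \<open>G\<close> those of the right side.\<close>

lemma hecke_braid:
  "hecke t i (hecke t (i + 1) (hecke t i p)) = hecke t (i + 1) (hecke t i (hecke t (i + 1) p))"
proof (rule hecke_braid_aux)
  let ?x = "Var i :: 'a mpoly" and ?y = "Var (i + 1) :: 'a mpoly" and ?z = "Var (i + 2) :: 'a mpoly" and ?t = "Cst t"
  let ?T = "hecke t i" and ?U = "hecke t (i + 1)" and ?s = "swap_vars i" and ?r = "swap_vars (i + 1)"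
  have s: "?s ?x = ?y" "?s ?y = ?x" "?s ?z = ?z" and r: "?r ?x = ?x" "?r ?y = ?z" "?r ?z = ?y"
    by (auto simp: swap_vars_Var Transposition.transpose_def)
  note T = hecke_eq[of i t]
  have U: "(?y - ?z) * ?U f = (1 - ?t) * ?z * f + (?t * ?y - ?z) * ?r f" for f
    using hecke_eq[of "i + 1" t f] by (simp add: numeral_2_eq_2)
  note H = swap_vars_simps swap_vars_Cst s r swap_vars_swap_vars
  have Ts: "(?y - ?x) * ?s (?T f) = (1 - ?t) * ?x * ?s f + (?t * ?y - ?x) * f" for f
    using arg_cong[OF T[of f], of ?s] by (simp only: H)
  have Tr: "(?x - ?z) * ?r (?T f) = (1 - ?t) * ?z * ?r f + (?t * ?x - ?z) * ?r (?s f)" for f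
    using arg_cong[OF T[of f], of ?r] by (simp only: H)
  have Tsr: "(?y - ?z) * ?s (?r (?T f)) = (1 - ?t) * ?z * ?s (?r f) + (?t * ?y - ?z) * ?s (?r (?s f))" for f
    using arg_cong[OF Tr[of f], of ?s] by (simp only: H)
  have Us: "(?x - ?z) * ?s (?U f) = (1 - ?t) * ?z * ?s f + (?t * ?x - ?z) * ?s (?r f)" for f
    using arg_cong[OF U[of f], of ?s] by (simp only: H)
  have Ur: "(?z - ?y) * ?r (?U f) = (1 - ?t) * ?y * ?r f + (?t * ?z - ?y) * f" for f
    using arg_cong[OF U[of f], of ?r] by (simp only: H)
  have Urs: "(?x - ?y) * ?r (?s (?U f)) = (1 - ?t) * ?y * ?r (?s f) + (?t * ?x - ?y) * ?s (?r (?s f))" for f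
    using arg_cong[OF Us[of f], of ?r] by (simp only: H swap_vars_braid)
  show "(?x - ?y) * ?T p = (1 - ?t) * ?y * p + (?t * ?x - ?y) * ?s p" by (fact T)
  show "(?y - ?x) * ?s (?T p) = (1 - ?t) * ?x * ?s p + (?t * ?y - ?x) * p" by (fact Ts)
  show "(?x - ?z) * ?r (?T p) = (1 - ?t) * ?z * ?r p + (?t * ?x - ?z) * ?r (?s p)" by (fact Tr)
  show "(?y - ?z) * ?s (?r (?T p)) = (1 - ?t) * ?z * ?s (?r p) + (?t * ?y - ?z) * ?s (?r (?s p))" by (fact Tsr)
  show "(?y - ?z) * ?U (?T p) = (1 - ?t) * ?z * ?T p + (?t * ?y - ?z) * ?r (?T p)" by (fact U)
  show "(?x - ?z) * ?s (?U (?T p)) = (1 - ?t) * ?z * ?s (?T p) + (?t * ?x - ?z) * ?s (?r (?T p))" by (fact Us)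
  show "(?x - ?y) * ?T (?U (?T p)) = (1 - ?t) * ?y * ?U (?T p) + (?t * ?x - ?y) * ?s (?U (?T p))" by (fact T)
  show "(?y - ?z) * ?U p = (1 - ?t) * ?z * p + (?t * ?y - ?z) * ?r p" by (fact U)
  show "(?z - ?y) * ?r (?U p) = (1 - ?t) * ?y * ?r p + (?t * ?z - ?y) * p" by (fact Ur)
  show "(?x - ?z) * ?s (?U p) = (1 - ?t) * ?z * ?s p + (?t * ?x - ?z) * ?s (?r p)" by (fact Us)
  show "(?x - ?y) * ?r (?s (?U p)) = (1 - ?t) * ?y * ?r (?s p) + (?t * ?x - ?y) * ?s (?r (?s p))" by (fact Urs)
  show "(?x - ?y) * ?T (?U p) = (1 - ?t) * ?y * ?U p + (?t * ?x - ?y) * ?s (?U p)" by (fact T)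
  show "(?x - ?z) * ?r (?T (?U p)) = (1 - ?t) * ?z * ?r (?U p) + (?t * ?x - ?z) * ?r (?s (?U p))" by (fact Tr)
  show "(?y - ?z) * ?U (?T (?U p)) = (1 - ?t) * ?z * ?T (?U p) + (?t * ?y - ?z) * ?r (?T (?U p))" by (fact U)
qed simp_all

section \<open>The operator pi and the Cherednik operators\<close>

lemma affine_pi_simps:
  "affine_pi N q (p + p') = affine_pi N q p + affine_pi N q p'"
  "affine_pi N q (p - p') = affine_pi N q p - affine_pi N q p'"
  "affine_pi N q (p * p') = affine_pi N q p * affine_pi N q p'"
  "affine_pi N q (scale c p) = scale c (affine_pi N q p)"
  "affine_pi N q (Cst c) = Cst c"
  "affine_pi N q 1 = 1"
  by (simp_all add: affine_pi_def psubst_simps)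

lemma affine_pi_Var: "affine_pi N q (Var j) = (if j = 1 then scale q (Var N) else Var (j - 1))"
  by (simp add: affine_pi_def)

text \<open>The operator pi lowers the indices of the two variables by one. The bound
  \<open>1 \<le> i\<close> keeps x_1 out of the pair, and \<open>i + 1 < N\<close> keeps the lowered
  pair away from x_N, where the factor \<open>q\<close> appears.\<close>

lemma affine_pi_hecke:
  assumes "1 \<le> i" "i + 1 < N"
  shows "affine_pi N q (hecke t (i + 1) p) = hecke t i (affine_pi N q p)"
proof (rule hecke_eqI[symmetric])
  have s: "affine_pi N q (swap_vars (i + 1) p) = swap_vars i (affine_pi N q p)"
    unfolding swap_vars_def affine_pi_def psubst_psubst
    by (rule arg_cong[where f = "\<lambda>\<sigma>. psubst \<sigma> p"])
      (use assms in \<open>auto simp: fun_eq_iff Transposition.transpose_def psubst_scale\<close>)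
  show "(Var i - Var (i + 1)) * affine_pi N q (hecke t (i + 1) p) =
    (1 - Cst t) * Var (i + 1) * affine_pi N q p + (Cst t * Var i - Var (i + 1)) * swap_vars i (affine_pi N q p)"
    using arg_cong[OF hecke_eq[of "i + 1" t p], of "affine_pi N q"] assms
    by (simp add: affine_pi_simps affine_pi_Var s[unfolded Suc_eq_plus1[symmetric]])
qed

lemma fold_hecke_add: "fold (hecke t) ks (p + q) = fold (hecke t) ks p + fold (hecke t) ks q"
  by (induction ks arbitrary: p q) (simp_all add: hecke_add)

lemma fold_hecke_scale: "fold (hecke t) ks (scale c p) = scale c (fold (hecke t) ks p)"
  by (induction ks arbitrary: p) (simp_all add: hecke_scale)

lemma hecke_inv_add: "hecke_inv t i (p + q) = hecke_inv t i p + hecke_inv t i q"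
  by (simp add: hecke_inv_def hecke_add mpoly.scale_right_distrib)

lemma hecke_inv_scale: "hecke_inv t i (scale c p) = scale c (hecke_inv t i p)"
  by (simp add: hecke_inv_def hecke_scale mpoly.scale_right_distrib mult.commute)

lemma fold_hecke_inv_add: "fold (hecke_inv t) ks (p + q) = fold (hecke_inv t) ks p + fold (hecke_inv t) ks q"
  by (induction ks arbitrary: p q) (simp_all add: hecke_inv_add)

lemma fold_hecke_inv_scale: "fold (hecke_inv t) ks (scale c p) = scale c (fold (hecke_inv t) ks p)"
  by (induction ks arbitrary: p) (simp_all add: hecke_inv_scale)

context
  fixes t :: "'a::field"
  assumes t: "t \<noteq> 0"
begin

lemma cherednik_eq:
  "cherednik N q t i p = scale (t ^ (i - 1)) (fold (hecke t) (rev [i..<N])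
     (affine_pi N q (fold (hecke_inv t) (rev [1..<i]) p)))"
  by (simp add: cherednik_def inv_hecke[OF t])

lemma cherednik_add: "cherednik N q t i (p + p') = cherednik N q t i p + cherednik N q t i p'"
  by (simp add: cherednik_eq fold_hecke_add fold_hecke_inv_add affine_pi_simps mpoly.scale_right_distrib)

lemma cherednik_scale: "cherednik N q t i (scale c p) = scale c (cherednik N q t i p)"
  by (simp add: cherednik_eq fold_hecke_scale fold_hecke_inv_scale affine_pi_simps mult.commute)

lemma cherednik_diff: "cherednik N q t i (p - p') = cherednik N q t i p - cherednik N q t i p'"
proof -
  have "p - p' = p + scale (-1) p'" by simp
  then show ?thesis by (simp only: cherednik_add cherednik_scale) simp
qed

text \<open>A first T_i cancels the leading inverse factor of \<xi>_(i+1), and a last T_i supplies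
  the factor that \<xi>_i has in addition. The recursion has the form of the one that defines the
  Dunkl operators.\<close>

lemma cherednik_step:
  assumes "1 \<le> i" "i < N"
  shows "cherednik N q t i p = scale (1 / t) (hecke t i (cherednik N q t (i + 1) (hecke t i p)))"
proof -
  have "rev [1..<Suc i] = i # rev [1..<i]" "rev [i..<N] = rev [Suc i..<N] @ [i]"
    using assms by (simp_all add: upt_conv_Cons)
  moreover have "1 / t * t ^ i = t ^ (i - 1)"
    using assms t by (cases i) auto
  ultimately show ?thesis
    by (simp add: cherednik_eq hecke_scale hecke_inv_hecke[OF t] del: upt_Suc)
qed

lemma hecke_hecke_inv_commute:
  assumes "i + 1 < k \<or> k + 1 < i"
  shows "hecke_inv t k (hecke t i p) = hecke t i (hecke_inv t k p)"
  by (simp add: hecke_inv_def hecke_scale hecke_add hecke_commute[OF assms])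

lemma fold_hecke_inv_commute:
  assumes "\<And>k. k \<in> set ks \<Longrightarrow> i + 1 < k \<or> k + 1 < i"
  shows "fold (hecke_inv t) ks (hecke t i p) = hecke t i (fold (hecke_inv t) ks p)"
  using assms by (induction ks arbitrary: p) (simp_all add: hecke_hecke_inv_commute)

lemma fold_hecke_commute:
  assumes "\<And>k. k \<in> set ks \<Longrightarrow> i + 1 < k \<or> k + 1 < i"
  shows "fold (hecke t) ks (hecke t i p) = hecke t i (fold (hecke t) ks p)"
  using assms
proof (induction ks arbitrary: p)
  case (Cons k ks)
  have "hecke t k (hecke t i p) = hecke t i (hecke t k p)"
    using Cons.prems[of k] by (intro hecke_commute) auto
  with Cons show ?case by simp
qed simp

text \<open>All inverse factors but those with index \<open>i + 1\<close> and \<open>i\<close> are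
  passed by commutation; at these two the braid relation raises the index of T_i by one.\<close>

lemma fold_hecke_inv_shift:
  assumes i: "1 \<le> i" "i + 1 < j"
  shows "fold (hecke_inv t) (rev [1..<j]) (hecke t i p) = hecke t (i + 1) (fold (hecke_inv t) (rev [1..<j]) p)"
proof -
  have "[1..<j] = [1..<i] @ [i..<j]" using i by (metis le_add2 le_add_same_cancel2 upt_add_eq_append less_imp_le_nat add_lessD1 le_iff_add)
  also have "[i..<j] = i # (i + 1) # [i + 2..<j]"
    using i by (simp add: upt_conv_Cons)
  finally have r: "rev [1..<j] = rev [i + 2..<j] @ [i + 1, i] @ rev [1..<i]" by simp
  have b: "hecke_inv t i (hecke_inv t (i + 1) (hecke t i f)) = hecke t (i + 1) (hecke_inv t i (hecke_inv t (i + 1) f))" for f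
  proof -
    define w where "w = hecke_inv t i (hecke_inv t (i + 1) f)"
    have "f = hecke t (i + 1) (hecke t i w)" by (simp add: w_def hecke_hecke_inv[OF t])
    then have "hecke_inv t i (hecke_inv t (i + 1) (hecke t i f)) = hecke t (i + 1) w"
      using hecke_braid[of t i w] by (simp add: hecke_inv_hecke[OF t])
    then show ?thesis by (simp add: w_def)
  qed
  have c1: "fold (hecke_inv t) (rev [i + 2..<j]) (hecke t i f) = hecke t i (fold (hecke_inv t) (rev [i + 2..<j]) f)" for f
    by (rule fold_hecke_inv_commute) auto
  have c2: "fold (hecke_inv t) (rev [1..<i]) (hecke t (i + 1) f) = hecke t (i + 1) (fold (hecke_inv t) (rev [1..<i]) f)" for f
    by (rule fold_hecke_inv_commute) auto
  show ?thesis unfolding r fold_append o_apply c1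
    by (simp add: b[simplified] c2[simplified])
qed

lemma fold_hecke_shift:
  assumes i: "j \<le> i" "i + 1 < N"
  shows "fold (hecke t) (rev [j..<N]) (hecke t i p) = hecke t (i + 1) (fold (hecke t) (rev [j..<N]) p)"
proof -
  have "[j..<N] = [j..<i] @ [i..<N]" using i by (metis less_imp_le_nat add_lessD1 le_iff_add upt_add_eq_append)
  also have "[i..<N] = i # (i + 1) # [i + 2..<N]"
    using i by (simp add: upt_conv_Cons)
  finally have r: "rev [j..<N] = rev [i + 2..<N] @ [i + 1, i] @ rev [j..<i]" by simp
  have c1: "fold (hecke t) (rev [i + 2..<N]) (hecke t i f) = hecke t i (fold (hecke t) (rev [i + 2..<N]) f)" for f
    by (rule fold_hecke_commute) auto
  have c2: "fold (hecke t) (rev [j..<i]) (hecke t (i + 1) f) = hecke t (i + 1) (fold (hecke t) (rev [j..<i]) f)" for f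
    by (rule fold_hecke_commute) auto
  show ?thesis unfolding r fold_append o_apply c1
    by (simp add: hecke_braid[simplified] c2[simplified])
qed

text \<open>The index of T_i is raised once by a block of Hecke factors and lowered once by pi. For
  \<open>i + 1 < j\<close> the raising occurs in the inverse block before pi, for
  \<open>j < i\<close> in the block after it.\<close>

lemma hecke_cherednik_commute:
  assumes i: "1 \<le> i" "i < N" and j: "1 \<le> j" "j \<le> N" and ne: "j \<noteq> i" "j \<noteq> i + 1"
  shows "cherednik N q t j (hecke t i p) = hecke t i (cherednik N q t j p)"
proof (cases "i + 1 < j")
  case True
  have c: "fold (hecke t) (rev [j..<N]) (hecke t i f) = hecke t i (fold (hecke t) (rev [j..<N]) f)" for f
    by (rule fold_hecke_commute) (use True in auto)
  show ?thesis
    unfolding cherednik_eq fold_hecke_inv_shift[OF i(1) True]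
    by (subst affine_pi_hecke) (use i j True in \<open>auto simp: c hecke_scale\<close>)
next
  case False
  then have ij: "j < i" using ne by simp
  then obtain i' where i': "i = i' + 1" "j \<le> i'" using less_imp_Suc_add by (metis Suc_eq_plus1 le_add1 add_Suc_right)
  have c: "fold (hecke_inv t) (rev [1..<j]) (hecke t i f) = hecke t i (fold (hecke_inv t) (rev [1..<j]) f)" for f
    by (rule fold_hecke_inv_commute) (use ij in auto)
  show ?thesis
    unfolding cherednik_eq c
    unfolding i'(1)
    by (subst affine_pi_hecke) (use i j i' in \<open>auto simp: fold_hecke_shift hecke_scale\<close>)
qed

text \<open>When the weight at \<open>i + 1\<close> is 1/t times the weight at \<open>i\<close>, the
  coefficient (1 - t)/(1 - \<rho>) in the normalization equals -t. So T_i - t is the intertwiner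
  that exchanges the two weights.\<close>

lemma hecke_minus_eigen:
  assumes i: "1 \<le> i" "i < N"
    and a: "cherednik N q t i p = scale a p" and b: "cherednik N q t (i + 1) p = scale (a / t) p"
  shows "cherednik N q t i (hecke t i p - scale t p) = scale (a / t) (hecke t i p - scale t p)"
    and "cherednik N q t (i + 1) (hecke t i p - scale t p) = scale a (hecke t i p - scale t p)"
proof -
  let ?T = "hecke t i" and ?X = "cherednik N q t (i + 1)" and ?Y = "cherednik N q t i"
  have "?T (?X (?T p)) = scale (t * a) p"
    using cherednik_step[OF i, of q p] t by (simp add: a) (metis (no_types, lifting) mpoly.scale_scale mpoly.scale_one nonzero_mult_div_cancel_left times_divide_eq_right mult.right_neutral)
  then have "?X (?T p) = hecke_inv t i (scale (t * a) p)"
    by (metis hecke_inv_hecke[OF t])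
  then have X: "?X (?T p) = scale a (?T p) + scale (a * (1 - t)) p"
    using t by (simp add: hecke_inv_scale) (simp add: hecke_inv_def mpoly.scale_right_distrib)
  have e: "scale (a - a * t) p = scale a p - scale (a * t) p" by (rule mpoly.scale_left_diff_distrib)
  show "?X (?T p - scale t p) = scale a (?T p - scale t p)"
    using t by (simp add: cherednik_diff cherednik_scale X[simplified] b[simplified] mpoly.scale_right_diff_distrib right_diff_distrib e)
  have "?Y (?T p) = scale (1 / t) (?T (?X (scale (t - 1) (?T p) + scale t p)))"
    by (simp add: cherednik_step[OF i] hecke_quadratic)
  also have "\<dots> = scale (t - 1) (?Y p) + scale (a / t) (?T p)"
    using t by (simp add: cherednik_add cherednik_scale hecke_add hecke_scale b[simplified] mpoly.scale_right_distrib
        cherednik_step[OF i, of q p])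
  also have "\<dots> = scale (a / t) (?T p) + (scale (t * a) p - scale a p)"
    by (simp add: a left_diff_distrib mpoly.scale_left_diff_distrib)
  finally show "?Y (?T p - scale t p) = scale (a / t) (?T p - scale t p)"
    using t by (simp add: cherednik_diff cherednik_scale a mpoly.scale_right_diff_distrib)
qed

lemma hecke_inv_closed:
  assumes A: "subring A" and p: "p \<in> polys_over A J" and i: "i \<in> J" "i + 1 \<in> J" and tA: "t \<in> A" "1 / t \<in> A"
  shows "hecke_inv t i p \<in> polys_over A J"
  unfolding hecke_inv_def using assms
  by (intro polys_over_scale[OF A] polys_over_add[OF A] hecke_closed[OF A] subring_diff[OF A] subring_1[OF A])

lemma cherednik_closed:
  assumes A: "subring A" and p: "p \<in> polys_over A {1..N}" and i: "1 \<le> i" "i \<le> N"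
    and tA: "t \<in> A" "1 / t \<in> A" "q \<in> A"
  shows "cherednik N q t i p \<in> polys_over A {1..N}"
proof -
  have f: "fold (hecke t) ks f \<in> polys_over A {1..N}" if "f \<in> polys_over A {1..N}" "set ks \<subseteq> {1..<N}" for ks f
    using that
  proof (induction ks arbitrary: f)
    case (Cons k ks)
    then have "hecke t k f \<in> polys_over A {1..N}" by (intro hecke_closed[OF A] tA) auto
    with Cons show ?case by simp
  qed simp
  have g: "fold (hecke_inv t) ks f \<in> polys_over A {1..N}" if "f \<in> polys_over A {1..N}" "set ks \<subseteq> {1..<N}" for ks f
    using that
  proof (induction ks arbitrary: f)
    case (Cons k ks)
    then have "hecke_inv t k f \<in> polys_over A {1..N}" by (intro hecke_inv_closed[OF A] tA) auto
    with Cons show ?case by simp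
  qed simp
  have h: "affine_pi N q f \<in> polys_over A {1..N}" if "f \<in> polys_over A {1..N}" for f
    unfolding affine_pi_def
    by (rule psubst_closed[OF A that]) (use i in \<open>auto intro!: polys_over_scale[OF A] polys_over_Var[OF A] tA\<close>)
  have "t ^ k \<in> A" for k by (induction k) (auto intro: subring_1[OF A] subring_mult[OF A] tA)
  then show ?thesis unfolding cherednik_eq
    using i by (intro polys_over_scale[OF A] f h g p) auto
qed

end

section \<open>Specialization of rational functions\<close>

lemma poly_map_poly_add:
  fixes h :: "'a::comm_ring_1 \<Rightarrow> 'b::comm_ring_1"
  assumes "\<And>a b. h (a + b) = h a + h b"
  shows "poly (map_poly h (p + q)) x = poly (map_poly h p) x + poly (map_poly h q) x"
proof -
  have 0: "h 0 = 0" using assms[of 0 0] by simp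
  have "map_poly h (p + q) = map_poly h p + map_poly h q"
    by (rule poly_eqI) (simp add: coeff_map_poly 0 assms)
  then show ?thesis by simp
qed

lemma poly_map_poly_mult:
  fixes h :: "'a::comm_ring_1 \<Rightarrow> 'b::comm_ring_1"
  assumes add: "\<And>a b. h (a + b) = h a + h b" and mult: "\<And>a b. h (a * b) = h a * h b"
  shows "poly (map_poly h (p * q)) x = poly (map_poly h p) x * poly (map_poly h q) x"
proof -
  have 0: "h 0 = 0" using add[of 0 0] by simp
  have smult: "map_poly h (smult a q) = smult (h a) (map_poly h q)" for a
    by (rule poly_eqI) (simp add: coeff_map_poly 0 mult)
  show ?thesis
    by (induction p) (simp_all add: map_poly_pCons 0 poly_map_poly_add[OF add] smult algebra_simps)
qed

lemma eval2_add: "eval2 pt (f + g) = eval2 pt f + eval2 pt g"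
  unfolding eval2_def by (intro poly_map_poly_add) (simp_all add: of_rat_add)

lemma eval2_mult: "eval2 pt (f * g) = eval2 pt f * eval2 pt g"
  unfolding eval2_def
  by (intro poly_map_poly_mult) (simp_all add: of_rat_add of_rat_mult poly_map_poly_add poly_map_poly_mult)

lemma eval2_0 [simp]: "eval2 pt 0 = 0" and eval2_1 [simp]: "eval2 pt 1 = 1"
  by (simp_all add: eval2_def map_poly_1)

lemma eval2_uminus: "eval2 pt (- f) = - eval2 pt f"
  using eval2_add[of pt f "- f"] by (simp add: eq_neg_iff_add_eq_0 add.commute)

lemma eval2_nonzero: "eval2 pt b \<noteq> 0 \<Longrightarrow> b \<noteq> 0"
  by auto

lemma spec_Fract: "eval2 pt b \<noteq> 0 \<Longrightarrow> spec pt (Fract a b) = eval2 pt a / eval2 pt b"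
  unfolding spec_def
proof (rule the_equality)
  assume b: "eval2 pt b \<noteq> 0"
  then show "\<exists>a' b'. Fract a b = Fract a' b' \<and> eval2 pt b' \<noteq> 0 \<and> eval2 pt a / eval2 pt b = eval2 pt a' / eval2 pt b'"
    by blast
  fix v assume "\<exists>a' b'. Fract a b = Fract a' b' \<and> eval2 pt b' \<noteq> 0 \<and> v = eval2 pt a' / eval2 pt b'"
  then obtain a' b' where f: "Fract a b = Fract a' b'" and b': "eval2 pt b' \<noteq> 0" and v: "v = eval2 pt a' / eval2 pt b'"
    by blast
  have "a * b' = a' * b"
    using f eval2_nonzero[OF b] eval2_nonzero[OF b'] by (simp add: eq_fract)
  then have "eval2 pt a * eval2 pt b' = eval2 pt a' * eval2 pt b"
    by (metis eval2_mult)
  then show "v = eval2 pt a / eval2 pt b" using b b' by (simp add: v field_simps)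
qed

text \<open>The local ring of the point \<open>pt\<close>, on which \<open>spec pt\<close> is a ring
  homomorphism.\<close>

definition regular :: "complex \<times> complex \<Rightarrow> ratfun set" where
  "regular pt = {f. no_pole_at pt f}"

lemma regular_cases:
  assumes "f \<in> regular pt"
  obtains a b where "f = Fract a b" "eval2 pt b \<noteq> 0" "b \<noteq> 0" "spec pt f = eval2 pt a / eval2 pt b"
proof -
  from assms obtain a b where "f = Fract a b" "eval2 pt b \<noteq> 0"
    by (auto simp: regular_def no_pole_at_def)
  with that[of a b] show ?thesis by (simp add: spec_Fract eval2_nonzero)
qed

lemma Fract_regular: "eval2 pt b \<noteq> 0 \<Longrightarrow> Fract a b \<in> regular pt"
  by (auto simp: regular_def no_pole_at_def)

lemma spec_add: "f \<in> regular pt \<Longrightarrow> g \<in> regular pt \<Longrightarrow> spec pt (f + g) = spec pt f + spec pt g"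
  by (elim regular_cases) (simp add: add_fract spec_Fract eval2_mult eval2_add field_simps)

lemma spec_mult: "f \<in> regular pt \<Longrightarrow> g \<in> regular pt \<Longrightarrow> spec pt (f * g) = spec pt f * spec pt g"
  by (elim regular_cases) (simp add: mult_fract spec_Fract eval2_mult)

lemma spec_uminus: "f \<in> regular pt \<Longrightarrow> spec pt (- f) = - spec pt f"
  by (elim regular_cases) (simp add: minus_fract spec_Fract eval2_uminus)

lemma spec_0 [simp]: "spec pt 0 = 0" and spec_1 [simp]: "spec pt 1 = 1"
  by (simp_all add: Zero_fract_def One_fract_def spec_Fract)

lemma regular_add: "f \<in> regular pt \<Longrightarrow> g \<in> regular pt \<Longrightarrow> f + g \<in> regular pt"
  by (elim regular_cases) (simp add: add_fract Fract_regular eval2_mult)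

lemma regular_mult: "f \<in> regular pt \<Longrightarrow> g \<in> regular pt \<Longrightarrow> f * g \<in> regular pt"
  by (elim regular_cases) (simp add: mult_fract Fract_regular eval2_mult)

lemma regular_uminus: "f \<in> regular pt \<Longrightarrow> - f \<in> regular pt"
  by (elim regular_cases) (simp add: minus_fract Fract_regular)

lemma regular_1 [simp]: "1 \<in> regular pt"
  by (simp add: One_fract_def Fract_regular)

lemma subring_regular: "subring (regular pt)"
  unfolding subring_def
  using regular_add[OF _ regular_uminus, of _ pt] by (auto intro: regular_mult)

lemma spec_diff: "f \<in> regular pt \<Longrightarrow> g \<in> regular pt \<Longrightarrow> spec pt (f - g) = spec pt f - spec pt g"
  using spec_add[of f pt "- g"] by (simp add: spec_uminus regular_uminus)

lemma regular_inverse: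
  assumes "f \<in> regular pt" "spec pt f \<noteq> 0"
  shows "inverse f \<in> regular pt" "spec pt (inverse f) = inverse (spec pt f)"
proof -
  from assms(1) obtain a b where f: "f = Fract a b" "eval2 pt b \<noteq> 0" "b \<noteq> 0" "spec pt f = eval2 pt a / eval2 pt b"
    by (rule regular_cases)
  with assms(2) have a: "eval2 pt a \<noteq> 0" by auto
  show "inverse f \<in> regular pt" "spec pt (inverse f) = inverse (spec pt f)"
    using a by (simp_all add: f inverse_fract Fract_regular spec_Fract)
qed

lemma regular_divide:
  assumes "f \<in> regular pt" "g \<in> regular pt" "spec pt g \<noteq> 0"
  shows "f / g \<in> regular pt" "spec pt (f / g) = spec pt f / spec pt g"
  using assms by (simp_all add: field_class.field_divide_inverse regular_mult spec_mult regular_inverse)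

lemma regular_qvar [simp]: "qvar \<in> regular pt" and spec_qvar [simp]: "spec pt qvar = fst pt"
  and regular_tvar [simp]: "tvar \<in> regular pt" and spec_tvar [simp]: "spec pt tvar = snd pt"
  unfolding qvar_def tvar_def by (simp_all add: Fract_regular spec_Fract) (simp_all add: eval2_def map_poly_pCons)

lemma regular_power: "f \<in> regular pt \<Longrightarrow> f ^ k \<in> regular pt"
  and spec_power: "f \<in> regular pt \<Longrightarrow> spec pt (f ^ k) = spec pt f ^ k"
proof -
  have "f ^ k \<in> regular pt \<and> spec pt (f ^ k) = spec pt f ^ k" if "f \<in> regular pt" for k
    using that by (induction k) (simp_all add: regular_mult spec_mult)
  then show "f \<in> regular pt \<Longrightarrow> f ^ k \<in> regular pt" "f \<in> regular pt \<Longrightarrow> spec pt (f ^ k) = spec pt f ^ k"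
    by blast+
qed

lemma regular_powi:
  assumes "f \<in> regular pt" "spec pt f \<noteq> 0"
  shows "f powi k \<in> regular pt" "spec pt (f powi k) = spec pt f powi k"
  using assms by (auto simp: power_int_def regular_power spec_power regular_inverse)

section \<open>Specialization of polynomials and operators\<close>

lemma lookup_spec_poly: "lookup (spec_poly pt p) \<alpha> = spec pt (lookup p \<alpha>)"
  by (simp add: spec_poly_def Poly_Mapping.map.rep_eq when_def)

abbreviation regular_polys :: "complex \<times> complex \<Rightarrow> ratfun mpoly set" where
  "regular_polys pt \<equiv> polys_over (regular pt) UNIV"

lemma regular_polysD: "p \<in> regular_polys pt \<Longrightarrow> lookup p \<alpha> \<in> regular pt"
  by (rule polys_over_lookup[OF subring_regular])

lemma polys_over_mono': "p \<in> polys_over A J \<Longrightarrow> p \<in> polys_over A UNIV"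
  by (auto simp: polys_over_def)

lemma spec_poly_0 [simp]: "spec_poly pt 0 = 0"
  by (rule poly_mapping_eqI) (simp add: lookup_spec_poly)

lemma spec_poly_add:
  "p \<in> regular_polys pt \<Longrightarrow> p' \<in> regular_polys pt \<Longrightarrow> spec_poly pt (p + p') = spec_poly pt p + spec_poly pt p'"
  by (rule poly_mapping_eqI) (simp add: lookup_spec_poly lookup_add spec_add regular_polysD)

lemma spec_poly_diff:
  "p \<in> regular_polys pt \<Longrightarrow> p' \<in> regular_polys pt \<Longrightarrow> spec_poly pt (p - p') = spec_poly pt p - spec_poly pt p'"
  by (rule poly_mapping_eqI) (simp add: lookup_spec_poly lookup_minus spec_diff regular_polysD)

lemma spec_poly_single: "spec_poly pt (Poly_Mapping.single \<alpha> c) = Poly_Mapping.single \<alpha> (spec pt c)"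
  by (rule poly_mapping_eqI) (simp add: lookup_spec_poly lookup_single when_def)

lemma spec_poly_sum:
  "(\<And>x. x \<in> X \<Longrightarrow> f x \<in> regular_polys pt) \<Longrightarrow> spec_poly pt (sum f X) = (\<Sum>x\<in>X. spec_poly pt (f x))"
  by (induction X rule: infinite_finite_induct)
    (auto simp: spec_poly_add polys_over_sum[OF subring_regular])

lemma spec_poly_mult:
  assumes "p \<in> regular_polys pt" "p' \<in> regular_polys pt"
  shows "spec_poly pt (p * p') = spec_poly pt p * spec_poly pt p'"
proof -
  have s: "keys (spec_poly pt r) \<subseteq> keys r" for r
    by (auto simp: in_keys_iff lookup_spec_poly)
  have m: "Poly_Mapping.single (\<alpha> + \<beta>) (lookup p \<alpha> * lookup p' \<beta>) \<in> regular_polys pt" for \<alpha> \<beta>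
    using assms by (intro polys_over_single[OF subring_regular] regular_mult regular_polysD) auto
  show ?thesis
    unfolding mult_eq_sum_single[OF finite_keys order_refl finite_keys order_refl, of p p']
      mult_eq_sum_single[OF finite_keys s finite_keys s, of p p']
    by (simp add: spec_poly_sum polys_over_sum[OF subring_regular] m spec_poly_single lookup_spec_poly
        spec_mult regular_polysD assms)
qed

lemma spec_poly_Cst: "spec_poly pt (Cst c) = Cst (spec pt c)"
  by (simp add: Cst_def spec_poly_single)

lemma spec_poly_Var: "spec_poly pt (Var i) = Var i"
  by (simp add: Var_def spec_poly_single)

lemma spec_poly_scale:
  "c \<in> regular pt \<Longrightarrow> p \<in> regular_polys pt \<Longrightarrow> spec_poly pt (scale c p) = scale (spec pt c) (spec_poly pt p)"
  by (simp add: scale_def spec_poly_mult polys_over_Cst[OF subring_regular] spec_poly_Cst)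

lemma spec_poly_psubst:
  assumes p: "p \<in> regular_polys pt" and \<sigma>: "\<And>j. \<sigma> j \<in> regular_polys pt"
  shows "spec_poly pt (psubst \<sigma> p) = psubst (\<lambda>j. spec_poly pt (\<sigma> j)) (spec_poly pt p)"
  using subring_regular p
proof (induction rule: polys_over_induct)
  case (add p q)
  then show ?case
    by (simp add: psubst_simps spec_poly_add psubst_closed[OF subring_regular] \<sigma>)
next
  case (mult p q)
  then show ?case
    by (simp add: psubst_simps spec_poly_mult psubst_closed[OF subring_regular] \<sigma>)
qed (simp_all add: spec_poly_Cst spec_poly_Var)

lemma spec_poly_swap_vars:
  "p \<in> regular_polys pt \<Longrightarrow> spec_poly pt (swap_vars i p) = swap_vars i (spec_poly pt p)"
  unfolding swap_vars_def
  by (subst spec_poly_psubst) (simp_all add: spec_poly_Var polys_over_Var[OF subring_regular])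

lemma spec_poly_affine_pi:
  "p \<in> regular_polys pt \<Longrightarrow> spec_poly pt (affine_pi N qvar p) = affine_pi N (fst pt) (spec_poly pt p)"
  unfolding affine_pi_def
  by (subst spec_poly_psubst)
    (auto simp: spec_poly_Var spec_poly_scale polys_over_Var[OF subring_regular]
       polys_over_scale[OF subring_regular] intro!: arg_cong[where f = "\<lambda>\<sigma>. psubst \<sigma> _"])

lemma regular_hecke: "p \<in> regular_polys pt \<Longrightarrow> hecke tvar i p \<in> regular_polys pt"
  by (rule hecke_closed[OF subring_regular]) simp_all

text \<open>Specializing \<open>hecke_eq\<close>, which has no quotient, gives the identity that
  characterizes T_i at the point.\<close>

lemma spec_poly_hecke:
  assumes p: "p \<in> regular_polys pt"
  shows "spec_poly pt (hecke tvar i p) = hecke (snd pt) i (spec_poly pt p)"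
proof (rule hecke_eqI[symmetric])
  note A = subring_regular
  note c = polys_over_mult[OF A] polys_over_diff[OF A] polys_over_add[OF A] polys_over_Cst[OF A]
    polys_over_Var[OF A] swap_vars_closed[OF A p] regular_hecke[OF p] p
    polys_over_Cst[OF A regular_1, simplified]
  show "(Var i - Var (i + 1)) * spec_poly pt (hecke tvar i p) =
    (1 - Cst (snd pt)) * Var (i + 1) * spec_poly pt p + (Cst (snd pt) * Var i - Var (i + 1)) * swap_vars i (spec_poly pt p)"
    using arg_cong[OF hecke_eq[of i tvar p], of "spec_poly pt"] spec_poly_Cst[of pt 1]
    by (simp add: spec_poly_mult spec_poly_diff spec_poly_add spec_poly_Var spec_poly_Cst spec_poly_swap_vars c)
qed

context
  fixes pt :: "complex \<times> complex"
  assumes t: "snd pt \<noteq> 0"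
begin

lemma tvar_nonzero: "tvar \<noteq> 0"
  using t by (metis spec_0 spec_tvar)

lemma regular_inverse_tvar: "1 / tvar \<in> regular pt" "spec pt (1 / tvar) = 1 / snd pt"
  using t by (simp_all add: regular_divide)

lemma regular_hecke_inv: "p \<in> regular_polys pt \<Longrightarrow> hecke_inv tvar i p \<in> regular_polys pt"
  by (rule hecke_inv_closed[OF tvar_nonzero subring_regular]) (simp_all add: regular_inverse_tvar)

lemma spec_poly_hecke_inv:
  assumes p: "p \<in> regular_polys pt"
  shows "spec_poly pt (hecke_inv tvar i p) = hecke_inv (snd pt) i (spec_poly pt p)"
proof -
  have "1 - tvar \<in> regular pt" using subring_diff[OF subring_regular] by simp
  then show ?thesis unfolding hecke_inv_def
    using p regular_inverse_tvar
    by (simp add: spec_poly_scale spec_poly_add spec_poly_hecke regular_hecke spec_diff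
      polys_over_add[OF subring_regular] polys_over_scale[OF subring_regular])
qed

lemma spec_poly_cherednik:
  assumes p: "p \<in> regular_polys pt"
  shows "spec_poly pt (cherednik N qvar tvar i p) = cherednik N (fst pt) (snd pt) i (spec_poly pt p)"
proof -
  have f: "fold (hecke tvar) ks f \<in> regular_polys pt \<and>
      spec_poly pt (fold (hecke tvar) ks f) = fold (hecke (snd pt)) ks (spec_poly pt f)"
    if "f \<in> regular_polys pt" for ks f
    using that by (induction ks arbitrary: f) (simp_all add: regular_hecke spec_poly_hecke)
  have g: "fold (hecke_inv tvar) ks f \<in> regular_polys pt \<and>
      spec_poly pt (fold (hecke_inv tvar) ks f) = fold (hecke_inv (snd pt)) ks (spec_poly pt f)"
    if "f \<in> regular_polys pt" for ks f
    using that by (induction ks arbitrary: f) (simp_all add: regular_hecke_inv spec_poly_hecke_inv)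
  have h: "affine_pi N qvar f \<in> regular_polys pt" if "f \<in> regular_polys pt" for f
    unfolding affine_pi_def
    by (rule psubst_closed[OF subring_regular that])
      (auto intro!: polys_over_scale[OF subring_regular] polys_over_Var[OF subring_regular])
  show ?thesis
    unfolding cherednik_eq[OF tvar_nonzero] cherednik_eq[OF t]
    using p by (simp add: spec_poly_scale f g h regular_power spec_power spec_poly_affine_pi)
qed

end

section \<open>Level functions on the quasi-staircase\<close>

definition box_content :: "nat \<times> nat \<Rightarrow> int" where
  "box_content b = int (snd b) - int (fst b)"

locale staircase =
  fixes d K n \<nu> :: nat
  assumes d: "d \<ge> 1" and K: "K \<ge> 1" and n: "n \<ge> 2" and \<nu>: "1 \<le> \<nu>" "\<nu> \<le> n - 1"
begin

definition len :: "nat \<Rightarrow> nat" where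
  len: "len r = (if r = 1 then d * n - 1 else if r = K + 1 then \<nu> else n - 1)"

definition boxes :: "(nat \<times> nat) set" where
  boxes: "boxes = {(r, c). 1 \<le> r \<and> r \<le> K + 1 \<and> 1 \<le> c \<and> c \<le> len r}"

text \<open>The part of \<alpha>(S) at an entry in row \<open>r\<close> is
  \<open>m * level r\<close>.\<close>

definition level :: "nat \<Rightarrow> nat" where
  "level r = (if r = 1 then 0 else d + r - 2)"

definition total :: nat where
  "total = (d * n - 1) + (K - 1) * (n - 1) + \<nu>"

text \<open>For rows \<open>r \<ge> 2\<close> of the diagram this is the number of boxes below row
  \<open>r\<close> (\<open>sum_len\<close>) and also the content of \<open>(r, 1)\<close> plus
  \<open>n * level r\<close> (\<open>start_level\<close>). The agreement of the two is what the row
  lengths of the quasi-staircase provide.\<close>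

definition start :: "nat \<Rightarrow> int" where
  "start r = int n * (int d + int r - 2) + 1 - int r"

lemma dn: "d * n \<ge> n" using d by simp

lemma len_1: "int (len 1) = int d * int n - 1"
  using dn n by (simp add: len of_nat_diff)

lemma len_le: "2 \<le> r \<Longrightarrow> len r \<le> n - 1"
  using \<nu> by (simp add: len)

lemma len_1_ge: "n - 1 \<le> len 1"
  using diff_le_mono[OF dn, of 1] by (simp add: len)

lemma len_anti:
  assumes "1 \<le> r" "r \<le> K"
  shows "len (r + 1) \<le> len r"
proof (cases "r = 1")
  case True
  then show ?thesis using len_1_ge len_le[of 2] by (simp add: numeral_2_eq_2)
next
  case False
  then show ?thesis using assms \<nu> by (auto simp: len)
qed

lemma len_mid: "2 \<le> r \<Longrightarrow> r \<le> K \<Longrightarrow> len r = n - 1"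
  by (simp add: len)

lemma len_pos: "1 \<le> r \<Longrightarrow> 1 \<le> len r"
  using \<nu> n len_1_ge by (cases "r = 1") (auto simp: len)

lemma boxes_iff: "(r, c) \<in> boxes \<longleftrightarrow> 1 \<le> r \<and> r \<le> K + 1 \<and> 1 \<le> c \<and> c \<le> len r"
  by (simp add: boxes)

lemma start_Suc: "start (r + 1) = start r + int n - 1"
  by (simp add: start_def algebra_simps)

lemma start_2: "start 2 = int d * int n - 1"
  by (simp add: start_def)

lemma total: "int total = start (K + 1) + int \<nu>"
proof -
  have "int (d * n - 1) = int d * int n - 1" "int ((K - 1) * (n - 1)) = (int K - 1) * (int n - 1)"
    using dn n K by (simp_all add: of_nat_diff)
  then show ?thesis by (simp add: total_def start_def algebra_simps)
qed

lemma start_level: "2 \<le> r \<Longrightarrow> start r = 1 - int r + int n * int (level r)"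
  using d by (simp add: start_def level_def of_nat_diff)

end

text \<open>\<open>\<kappa>\<close> assigns a level to every box, and \<open>v b\<close> is the number of boxes
  that precede \<open>b\<close> when the boxes are sorted by level. The box \<open>(r\<^sub>0 + 1, c\<^sub>0)\<close> and the one below it
  are exempted from the condition on levels, because the entries in these two boxes may be in the wrong
  order.\<close>

locale level_function = staircase +
  fixes \<kappa> :: "nat \<times> nat \<Rightarrow> nat" and r\<^sub>0 c\<^sub>0 :: nat and v :: "nat \<times> nat \<Rightarrow> int"
  assumes v: "\<And>b. v b = box_content b + int n * int (\<kappa> b)"
    and v_bij: "bij_betw v boxes {0..<int total}"
    and v_mono: "\<And>b b'. b \<in> boxes \<Longrightarrow> b' \<in> boxes \<Longrightarrow> \<kappa> b < \<kappa> b' \<Longrightarrow> v b < v b'"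
    and level_ne: "\<And>r c r' c'. (r, c) \<in> boxes \<Longrightarrow> (r', c') \<in> boxes \<Longrightarrow> r' < r \<Longrightarrow> c' \<le> c \<Longrightarrow>
        box_content (r, c) < box_content (r', c') \<Longrightarrow> \<kappa> (r, c) = \<kappa> (r', c') \<Longrightarrow>
        r' = r\<^sub>0 \<and> c' = c\<^sub>0 \<and> r = r\<^sub>0 + 1 \<and> c = c\<^sub>0"
begin

lemma v_inj: "b \<in> boxes \<Longrightarrow> b' \<in> boxes \<Longrightarrow> v b = v b' \<Longrightarrow> b = b'"
  using v_bij by (auto simp: bij_betw_def inj_on_def)

text \<open>A box follows the first box \<open>b0\<close> of its level at distance at most \<open>n\<close> only along consecutive
  contents, because a jump to a higher level would lower the content by \<open>n\<close>.\<close>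

lemma level_run:
  assumes surj: "\<And>y. 0 \<le> y \<Longrightarrow> y < m \<Longrightarrow> \<exists>b\<in>R. v b = y"
    and R: "R \<subseteq> boxes" and b0: "b0 \<in> R" "box_content b0 = x"
    and least: "\<And>b. b \<in> R \<Longrightarrow> x \<le> box_content b" and uniq: "\<And>b. b \<in> R \<Longrightarrow> box_content b = x \<Longrightarrow> b = b0"
    and nonneg: "0 \<le> v b0" and k: "k \<le> n" "v b0 + int k < m"
  shows "\<exists>b\<in>R. \<kappa> b = \<kappa> b0 \<and> box_content b = x + int k"
proof -
  obtain b where b: "b \<in> R" "v b = v b0 + int k" using surj[of "v b0 + int k"] nonneg k by auto
  have "\<not> \<kappa> b < \<kappa> b0" using v_mono[of b b0] b b0 R by auto
  moreover have "\<not> \<kappa> b0 < \<kappa> b"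
  proof
    assume lt: "\<kappa> b0 < \<kappa> b"
    then have "int n * (int (\<kappa> b0) + 1) \<le> int n * int (\<kappa> b)" by (intro mult_left_mono) auto
    moreover have "box_content b + int n * int (\<kappa> b) = x + int n * int (\<kappa> b0) + int k"
      using b b0 by (simp add: v)
    ultimately have "box_content b \<le> x" using k by (simp add: algebra_simps)
    then have "b = b0" using least[OF b(1)] uniq[OF b(1)] by simp
    then show False using lt by simp
  qed
  ultimately have e: "\<kappa> b = \<kappa> b0" by simp
  then have "box_content b = x + int k" using b b0 by (simp add: v)
  with e b show ?thesis by blast
qed

text \<open>If the row falls while the content rises by 1, the new box lies below and weakly to the
  left, which \<open>level_ne\<close> forbids at equal levels. The exempted fall from
  \<open>r\<^sub>0 + 1\<close> to \<open>r\<^sub>0\<close> crosses only the threshold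
  \<open>\<rho> = r\<^sub>0 + 1\<close>.\<close>

lemma level_row_step:
  assumes "b \<in> boxes" "b' \<in> boxes" "\<kappa> b = \<kappa> b'" "box_content b' = box_content b + 1"
    and \<rho>: "\<rho> \<noteq> r\<^sub>0 + 1" "\<rho> \<le> fst b"
  shows "\<rho> \<le> fst b'"
proof (rule ccontr)
  assume "\<not> \<rho> \<le> fst b'"
  then have lt: "fst b' < fst b" and lt': "fst b' < \<rho>" using \<rho> by auto
  obtain r c r' c' where b: "b = (r, c)" "b' = (r', c')" by (metis surj_pair)
  have "c' \<le> c" using assms(4) lt by (simp add: b box_content_def)
  then have "r' = r\<^sub>0 \<and> c' = c\<^sub>0 \<and> r = r\<^sub>0 + 1 \<and> c = c\<^sub>0"
    using assms(1-4) lt by (intro level_ne) (simp_all add: b)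
  then show False using \<rho> lt' by (simp add: b)
qed

lemma level_row:
  assumes R: "R \<subseteq> boxes" and run: "\<And>k. k \<le> m \<Longrightarrow> \<exists>b\<in>R. \<kappa> b = a \<and> box_content b = x + int k"
    and \<rho>: "\<rho> \<noteq> r\<^sub>0 + 1" and first: "\<And>b. b \<in> R \<Longrightarrow> box_content b = x \<Longrightarrow> \<rho> \<le> fst b"
    and k: "k \<le> m" and b: "b \<in> R" "\<kappa> b = a" "box_content b = x + int k"
  shows "\<rho> \<le> fst b"
  using k b
proof (induction k arbitrary: b)
  case 0
  then show ?case using first by simp
next
  case (Suc k)
  obtain b' where b': "b' \<in> R" "\<kappa> b' = a" "box_content b' = x + int k" using run[of k] Suc.prems by auto
  then have "\<rho> \<le> fst b'" using Suc.IH Suc.prems by simp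
  with \<rho> Suc.prems b' R show ?case
    by (intro level_row_step[of b' b]) auto
qed

text \<open>\<open>A\<close> is taken once on each diagonal that meets row \<open>r\<close>,
  \<open>A'\<close> once on each that meets row \<open>r - 1\<close>. A stretch of row
  \<open>r\<close> without level \<open>A\<close> produces a column with equal levels just before
  its beginning and another at its end, but \<open>level_ne\<close> admits only the column
  \<open>c\<^sub>0\<close>.\<close>

lemma two_rows:
  assumes r: "r = r\<^sub>0 + 1" "2 \<le> r" "r \<le> K + 1" and ne: "A \<noteq> A'"
    and W: "\<And>k. k < len r \<Longrightarrow> \<exists>b\<in>boxes. (fst b = r \<or> fst b = r - 1) \<and> \<kappa> b = A \<and> box_content b = 1 - int r + int k"
    and W': "\<And>k. k < len (r - 1) \<Longrightarrow> \<exists>b\<in>boxes. (fst b = r \<or> fst b = r - 1) \<and> \<kappa> b = A' \<and> box_content b = 2 - int r + int k"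
    and c: "1 \<le> c" "c \<le> len r"
  shows "\<kappa> (r, c) = A"
proof -
  have le: "len r \<le> len (r - 1)" using len_anti[of "r - 1"] r by simp
  \<comment> \<open>In rows \<open>r\<close> and \<open>r - 1\<close> the content
    \<open>j - r\<close> occurs only at \<open>(r, j)\<close> and
    \<open>(r - 1, j - 1)\<close>.\<close>
  have wa: "\<kappa> (r, j) = A \<or> 2 \<le> j \<and> \<kappa> (r - 1, j - 1) = A" if j: "1 \<le> j" "j \<le> len r" for j
  proof -
    have "j - 1 < len r" using j by simp
    then obtain b where b: "b \<in> boxes" "fst b = r \<or> fst b = r - 1" "\<kappa> b = A" "box_content b = 1 - int r + int (j - 1)"
      using W by blast
    obtain x y where xy: "b = (x, y)" by (metis surj_pair)
    from b(2) consider "x = r" | "x = r - 1" by (auto simp: xy)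
    then show ?thesis
    proof cases
      case 1
      then have "y = j" using b(4) j by (simp add: xy box_content_def)
      then show ?thesis using b 1 by (simp add: xy)
    next
      case 2
      then have y: "y = j - 1" using b(4) j r by (simp add: xy box_content_def of_nat_diff)
      moreover have "1 \<le> y" using b(1) by (simp add: xy boxes_iff)
      ultimately show ?thesis using b 2 by (auto simp: xy)
    qed
  qed
  have wb: "j \<le> len r \<and> \<kappa> (r, j) = A' \<or> \<kappa> (r - 1, j - 1) = A'" if j: "2 \<le> j" "j - 1 \<le> len (r - 1)" for j
  proof -
    have "j - 2 < len (r - 1)" using j by simp
    then obtain b where b: "b \<in> boxes" "fst b = r \<or> fst b = r - 1" "\<kappa> b = A'" "box_content b = 2 - int r + int (j - 2)"
      using W' by blast
    obtain x y where xy: "b = (x, y)" by (metis surj_pair)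
    from b(2) consider "x = r" | "x = r - 1" by (auto simp: xy)
    then show ?thesis
    proof cases
      case 1
      then have "y = j" using b(4) j by (simp add: xy box_content_def of_nat_diff)
      then show ?thesis using b 1 by (simp add: xy boxes_iff)
    next
      case 2
      then have "y = j - 1" using b(4) j r by (simp add: xy box_content_def of_nat_diff)
      then show ?thesis using b 2 by (auto simp: xy)
    qed
  qed
  have box: "(r, j) \<in> boxes" "(r - 1, j) \<in> boxes" if "1 \<le> j" "j \<le> len r" for j
    using that r le by (auto simp: boxes_iff)
  have pair: "j = c\<^sub>0" if "1 \<le> j" "j \<le> len r" "\<kappa> (r, j) = \<kappa> (r - 1, j)" for j
    using level_ne[OF box(1)[of j] box(2)[of j]] that r by (simp add: box_content_def of_nat_diff)
  have one: "\<kappa> (r, 1) = A" using wa[of 1] len_pos[of r] r by simp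
  show ?thesis
  proof (rule ccontr)
    assume c': "\<kappa> (r, c) \<noteq> A"
    let ?X = "{j. 1 \<le> j \<and> j \<le> len r \<and> \<kappa> (r, j) \<noteq> A}"
    define j where "j = Max ?X"
    have X: "?X \<noteq> {}" "finite ?X" using c c' by auto
    have "j \<in> ?X" unfolding j_def by (rule Max_in[OF X(2,1)])
    have jmax: "\<And>i. i \<in> ?X \<Longrightarrow> i \<le> j" unfolding j_def by (rule Max_ge[OF X(2)])
    have j: "1 \<le> j" "j \<le> len r" "\<kappa> (r, j) \<noteq> A" using \<open>j \<in> ?X\<close> by auto
    then have j2: "2 \<le> j" "\<kappa> (r - 1, j - 1) = A" using wa[of j] by auto
    then have jA: "\<kappa> (r, j) = A'" using wb[of j] j le ne by auto
    \<comment> \<open>On the next diagonal, \<open>(r, j + 1)\<close> has level \<open>A\<close> or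
      lies outside the diagram, so \<open>A'\<close> falls to \<open>(r - 1, j)\<close>.\<close>
    have "\<kappa> (r - 1, j) = A'"
    proof (cases "j + 1 \<le> len r")
      case True
      have "\<kappa> (r, j + 1) = A"
      proof (rule ccontr)
        assume "\<kappa> (r, j + 1) \<noteq> A"
        then have "j + 1 \<in> ?X" using True by simp
        from jmax[OF this] show False by simp
      qed
      then show ?thesis using wb[of "j + 1"] j j2 ne le by auto
    next
      case False
      then show ?thesis using wb[of "j + 1"] j j2 ne le by auto
    qed
    then have jc: "j = c\<^sub>0" using pair[of j] j jA by simp
    \<comment> \<open>The last column \<open>i\<close> before \<open>j\<close> at which row
      \<open>r\<close> has level \<open>A\<close>. On the diagonal of \<open>(r, i + 1)\<close>
      level \<open>A\<close> then sits at \<open>(r - 1, i)\<close>, directly below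
      \<open>(r, i)\<close>.\<close>
    let ?Y = "{i. 1 \<le> i \<and> i < j \<and> \<kappa> (r, i) = A}"
    define i where "i = Max ?Y"
    have "1 \<in> ?Y" using one j2 by simp
    then have Y: "?Y \<noteq> {}" "finite ?Y" by auto
    have "i \<in> ?Y" unfolding i_def by (rule Max_in[OF Y(2,1)])
    have imax: "\<And>l. l \<in> ?Y \<Longrightarrow> l \<le> i" unfolding i_def by (rule Max_ge[OF Y(2)])
    from \<open>i \<in> ?Y\<close> have i: "1 \<le> i" "i < j" "\<kappa> (r, i) = A" by auto
    have "\<kappa> (r, i + 1) \<noteq> A"
    proof (cases "i + 1 = j")
      case False
      show ?thesis
      proof
        assume "\<kappa> (r, i + 1) = A"
        then have "i + 1 \<in> ?Y" using i False by simp
        from imax[OF this] show False by simp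
      qed
    qed (use j in simp)
    then have "\<kappa> (r - 1, i) = A" using wa[of "i + 1"] i j by auto
    then have "i = c\<^sub>0" using pair[of i] i j by simp
    with i jc show False by simp
  qed
qed

section \<open>The levels of one row, given those of the rows above it\<close>

context
  fixes r :: nat
  assumes r: "1 \<le> r" "r \<le> K + 1"
    and above: "\<And>\<rho> c. r < \<rho> \<Longrightarrow> (\<rho>, c) \<in> boxes \<Longrightarrow> \<kappa> (\<rho>, c) = level \<rho>"
begin

definition "R = {b\<in>boxes. fst b \<le> r}"

text \<open>The number of boxes in \<open>R\<close>. The higher rows, with their known levels,
  occupy exactly the positions from here on, which leaves the positions below to
  \<open>R\<close>.\<close>

definition "bound = (if r = K + 1 then start (K + 1) + int \<nu> else start (r + 1))"

lemma R_boxes: "R \<subseteq> boxes" by (auto simp: R_def)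

lemma R_iff: "(\<rho>, c) \<in> R \<longleftrightarrow> 1 \<le> \<rho> \<and> \<rho> \<le> r \<and> 1 \<le> c \<and> c \<le> len \<rho>"
  using r by (auto simp: R_def boxes_iff)

lemma bound: "2 \<le> r \<Longrightarrow> bound = start r + int (len r)"
  using start_Suc[of r] n r by (auto simp: bound_def len of_nat_diff)

lemma start_mono: "a \<le> b \<Longrightarrow> start a \<le> start b"
proof (induction b rule: dec_induct)
  case (step b)
  then show ?case using start_Suc[of b] n by simp
qed simp

lemma v_above: "r < \<rho> \<Longrightarrow> (\<rho>, c) \<in> boxes \<Longrightarrow> v (\<rho>, c) = start \<rho> + int c - 1"
  using start_level[of \<rho>] above[of \<rho> c] r by (simp add: v box_content_def)

lemma v_R:
  assumes "b \<in> R" shows "0 \<le> v b" "v b < bound"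
proof -
  have b: "b \<in> boxes" "fst b \<le> r" using assms by (auto simp: R_def)
  have "v b \<in> {0..<int total}"
    using b v_bij by (auto simp: bij_betw_def)
  then have v0: "0 \<le> v b" and vN: "v b < start (K + 1) + int \<nu>" unfolding total by auto
  show "0 \<le> v b" by (rule v0)
  show "v b < bound"
  proof (rule ccontr)
    assume "\<not> v b < bound"
    then have nK: "r \<noteq> K + 1" and ge: "start (r + 1) \<le> v b" using vN by (auto simp: bound_def split: if_splits)
    text \<open>The rows above \<open>r\<close> fill the positions from \<open>start (r + 1)\<close> on.\<close>
    let ?P = "\<lambda>\<rho>. \<rho> \<le> K + 1 \<and> start \<rho> \<le> v b"
    define \<rho> where "\<rho> = (GREATEST \<rho>. ?P \<rho>)"
    have P: "?P (r + 1)" using ge r nK by simp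
    have \<rho>: "?P \<rho>" "r + 1 \<le> \<rho>"
      unfolding \<rho>_def using GreatestI_nat[of ?P "r + 1" "K + 1"] Greatest_le_nat[of ?P "r + 1" "K + 1"] P by auto
    have hi: "v b < start \<rho> + int (len \<rho>)"
    proof (cases "\<rho> = K + 1")
      case True
      then show ?thesis using vN K by (simp add: len)
    next
      case False
      then have "\<not> ?P (\<rho> + 1)" using Greatest_le_nat[of ?P "\<rho> + 1" "K + 1"] unfolding \<rho>_def[symmetric] by auto
      then show ?thesis using False \<rho> start_Suc[of \<rho>] r n by (simp add: len of_nat_diff)
    qed
    define c where "c = nat (v b - start \<rho> + 1)"
    have c: "1 \<le> c" "c \<le> len \<rho>" "int c = v b - start \<rho> + 1" using \<rho> hi by (auto simp: c_def)
    have box: "(\<rho>, c) \<in> boxes" using c \<rho> by (auto simp: boxes_iff)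
    then have "v (\<rho>, c) = v b" using v_above[of \<rho> c] \<rho> c by simp
    then have "(\<rho>, c) = b" using v_inj box b by blast
    then show False using b \<rho> by auto
  qed
qed

lemma R_surj:
  assumes "0 \<le> y" "y < bound"
  shows "\<exists>b\<in>R. v b = y"
proof -
  have le: "bound \<le> start (K + 1) + int \<nu>"
    using start_mono[of "r + 1" "K + 1"] r by (auto simp: bound_def)
  then have "y \<in> v ` boxes" using assms v_bij unfolding total by (auto simp: bij_betw_def)
  then obtain b where b: "b \<in> boxes" "v b = y" by auto
  have "fst b \<le> r"
  proof (rule ccontr)
    assume "\<not> fst b \<le> r"
    then obtain \<rho> c where bc: "b = (\<rho>, c)" "r < \<rho>" by (cases b) auto
    then have "start \<rho> \<le> y" using v_above[of \<rho> c] b by (simp add: boxes_iff)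
    moreover have "start (r + 1) \<le> start \<rho>" using start_mono bc by simp
    moreover have "r \<noteq> K + 1" using b bc by (simp add: boxes_iff)
    ultimately show False using assms by (simp add: bound_def)
  qed
  with b show ?thesis unfolding R_def by blast
qed

text \<open>The last box of row 1 has content \<open>bound - 1\<close>, so it has level 0 and the
  last position. A higher level elsewhere in the row would need a later position.\<close>

lemma row_1_level:
  assumes "r = 1" "(1, c) \<in> boxes"
  shows "\<kappa> (1, c) = level 1"
proof -
  let ?e = "(1, len 1)"
  have bd: "bound = int (len 1)" unfolding bound_def using assms(1) K len_1 start_2 by (simp add: numeral_2_eq_2)
  have eR: "?e \<in> R" using len_pos[of 1] assms(1) unfolding R_iff by simp
  then have "v ?e < int (len 1)" using v_R[of ?e] bd by simp
  then have "int n * int (\<kappa> ?e) < 1" by (simp add: v box_content_def)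
  have k0: "\<kappa> ?e = 0"
  proof (rule ccontr)
    assume "\<kappa> ?e \<noteq> 0"
    then have "int n * 1 \<le> int n * int (\<kappa> ?e)" by (intro mult_left_mono) auto
    then show False using \<open>int n * int (\<kappa> ?e) < 1\<close> n by linarith
  qed
  have cR: "(1, c) \<in> R" using assms unfolding R_def by simp
  have "\<not> \<kappa> ?e < \<kappa> (1, c)"
  proof
    assume "\<kappa> ?e < \<kappa> (1, c)"
    then have "v ?e < v (1, c)" using v_mono[of ?e "(1, c)"] eR cR R_boxes by auto
    then show False using v_R(2)[OF cR] bd k0 by (simp add: v box_content_def)
  qed
  then show ?thesis using k0 by (simp add: level_def)
qed

context
  assumes r2: "2 \<le> r"
begin

lemma first_R: "(r, 1) \<in> R" "box_content (r, 1) = 1 - int r"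
  using r2 r len_pos[of r] by (simp_all add: R_iff box_content_def)

lemma least_R: "b \<in> R \<Longrightarrow> 1 - int r \<le> box_content b"
  by (cases b) (auto simp: R_iff box_content_def)

lemma uniq_R: "b \<in> R \<Longrightarrow> box_content b = 1 - int r \<Longrightarrow> b = (r, 1)"
  by (cases b) (auto simp: R_iff box_content_def)

lemma fst_first_R: "b \<in> R \<Longrightarrow> box_content b = 1 - int r \<Longrightarrow> fst b = r"
  using uniq_R[of b] by simp

lemma run_R: "k \<le> n \<Longrightarrow> v (r, 1) + int k < bound \<Longrightarrow> \<exists>b\<in>R. \<kappa> b = \<kappa> (r, 1) \<and> box_content b = 1 - int r + int k"
  using level_run[OF R_surj R_boxes first_R least_R uniq_R] v_R[OF first_R(1)] by blast

lemma len_bounds: "1 \<le> len r" "len r < n"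
  using len_pos[of r] len_le[OF r2] r n by auto

text \<open>A higher level would put \<open>(r, 1)\<close> at position \<open>start r + n\<close> or
  later, but \<open>bound\<close> is \<open>start r + len r\<close> and
  \<open>len r < n\<close>.\<close>

lemma first_le: "\<kappa> (r, 1) \<le> level r"
proof (rule ccontr)
  assume "\<not> \<kappa> (r, 1) \<le> level r"
  then have "int n * (int (level r) + 1) \<le> int n * int (\<kappa> (r, 1))" by (intro mult_left_mono) auto
  moreover have "v (r, 1) < bound" using v_R first_R by blast
  ultimately show False using bound[OF r2] start_level[OF r2] len_bounds
    by (simp add: v box_content_def algebra_simps)
qed

lemma long_run:
  assumes "\<kappa> (r, 1) < level r" "k \<le> n"
  shows "\<exists>b\<in>R. \<kappa> b = \<kappa> (r, 1) \<and> box_content b = 1 - int r + int k"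
proof -
  have "int n * (int (\<kappa> (r, 1)) + 1) \<le> int n * int (level r)" using assms by (intro mult_left_mono) auto
  then have "v (r, 1) + int k < bound"
    using bound[OF r2] start_level[OF r2] len_bounds assms(2) by (simp add: v box_content_def algebra_simps)
  then show ?thesis using run_R assms(2) by blast
qed

lemma short_run:
  assumes "\<kappa> (r, 1) = level r" "k < len r"
  shows "\<exists>b\<in>R. \<kappa> b = level r \<and> box_content b = 1 - int r + int k"
  using run_R[of k] assms bound[OF r2] start_level[OF r2] len_bounds by (simp add: v box_content_def)

text \<open>A run from \<open>(r, 1)\<close> cannot leave row \<open>r\<close>. At too low a level
  it would have \<open>n + 1\<close> boxes, more than the row; at \<open>level r\<close> it fills
  the row.\<close>

lemma row_level_unswapped:
  assumes "r \<noteq> r\<^sub>0 + 1" "(r, c) \<in> boxes"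
  shows "\<kappa> (r, c) = level r"
proof -
  have "\<kappa> (r, 1) = level r"
  proof (rule ccontr)
    assume "\<kappa> (r, 1) \<noteq> level r"
    then have lt: "\<kappa> (r, 1) < level r" using first_le by simp
    obtain b where b: "b \<in> R" "\<kappa> b = \<kappa> (r, 1)" "box_content b = 1 - int r + int n" using long_run[OF lt, of n] by auto
    have "r \<le> fst b"
      by (rule level_row[OF R_boxes long_run[OF lt] assms(1) _ order_refl b]) (use fst_first_R in auto)
    then have "b = (r, n + 1)" using b by (cases b) (auto simp: R_iff box_content_def)
    then show False using b(1) len_bounds by (simp add: R_iff)
  qed
  note run = short_run[OF this]
  have c: "1 \<le> c" "c \<le> len r" using assms(2) by (auto simp: boxes_iff)
  have "c - 1 < len r" using c by simp
  then obtain b where b: "b \<in> R" "\<kappa> b = level r" "box_content b = 1 - int r + int (c - 1)" using run by blast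
  have "r \<le> fst b"
    by (rule level_row[where m = "len r - 1", OF R_boxes run assms(1) _ _ b]) (use fst_first_R c len_bounds in auto)
  then have "b = (r, c)" using b c by (cases b) (auto simp: R_iff box_content_def)
  then show ?thesis using b by simp
qed

text \<open>The run may fall into row 1, which can be long enough to hold it. Level 0 is therefore
  located from the last box of row 1, and \<open>two_rows\<close> separates the two levels.\<close>

lemma row_level_swapped_2:
  assumes r': "r = r\<^sub>0 + 1" "r = 2" and c: "(r, c) \<in> boxes"
  shows "\<kappa> (r, c) = level r"
proof -
  let ?e = "(1, len 1)"
  have "start r = start 2" "len r = len 2" using r' by simp_all
  then have bd: "bound = int (len 1) + int (len 2)" using bound[OF r2] start_2 len_1 by simp
  have eR: "?e \<in> R" using len_pos[of 1] r' unfolding R_iff by simp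
  then have "v ?e < bound" using v_R[of ?e] by simp
  then have "int n * int (\<kappa> ?e) < 1 + int (len 2)" using bd by (simp add: v box_content_def)
  also have "\<dots> \<le> int n" using len_bounds \<open>len r = len 2\<close> by linarith
  finally have lt: "int n * int (\<kappa> ?e) < int n" .
  have k0: "\<kappa> ?e = 0"
  proof (rule ccontr)
    assume "\<kappa> ?e \<noteq> 0"
    then have "int n * 1 \<le> int n * int (\<kappa> ?e)" by (intro mult_left_mono) auto
    then show False using lt by linarith
  qed
  have ve: "v ?e = int (len 1) - 1" using k0 by (simp add: v box_content_def)
  \<comment> \<open>The box \<open>?e\<close> has position \<open>len 1 - 1\<close>, and by
    \<open>v_mono\<close> every box of positive level comes after it. Hence level 0 has all contents
    from 0 to \<open>len 1 - 1\<close>.\<close>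
  have low: "\<kappa> b = 0" if b: "b \<in> R" "v b < int (len 1)" for b
  proof (rule ccontr)
    assume "\<kappa> b \<noteq> 0"
    then have "v ?e < v b" using v_mono[of ?e b] eR b R_boxes k0 by auto
    then show False using ve b by simp
  qed
  have W': "\<exists>b\<in>R. \<kappa> b = 0 \<and> box_content b = int k" if k: "k < len 1" for k
  proof -
    obtain b where "b \<in> R" "v b = int k" using R_surj[of "int k"] bd k by auto
    then show ?thesis using low[of b] k by (auto simp: v)
  qed
  have "\<kappa> (r, 1) = level r"
  proof (rule ccontr)
    assume "\<kappa> (r, 1) \<noteq> level r"
    then have "\<kappa> (r, 1) < level r" using first_le by simp
    then have "int n * (int (\<kappa> (r, 1)) + 1) \<le> int n * int (level r)" by (intro mult_left_mono) auto
    moreover have "v (r, 1) = 1 - int r + int n * int (\<kappa> (r, 1))" by (simp add: v box_content_def)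
    ultimately have lt: "v (r, 1) < int (len 1)"
      using start_level[OF r2] start_2 len_1 n \<open>start r = start 2\<close> unfolding distrib_left by linarith
    then have "\<kappa> (r, 1) = 0" using low[OF first_R(1)] lt by simp
    \<comment> \<open>Content -1 at level 0 would be position -1.\<close>
    then show False using v_R(1)[OF first_R(1)] r' by (simp add: v box_content_def)
  qed
  note run = short_run[OF this]
  have rows: "b \<in> boxes" "fst b = r \<or> fst b = r - 1" if "b \<in> R" for b
    using that r' unfolding R_def by (auto simp: boxes)
  show ?thesis
  proof (rule two_rows[OF r'(1) r2 r(2), of _ 0])
    show "level r \<noteq> 0" using d r' by (simp add: level_def)
    show "\<exists>b\<in>boxes. (fst b = r \<or> fst b = r - 1) \<and> \<kappa> b = level r \<and> box_content b = 1 - int r + int k" if "k < len r" for k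
      using run[OF that] rows by blast
    show "\<exists>b\<in>boxes. (fst b = r \<or> fst b = r - 1) \<and> \<kappa> b = 0 \<and> box_content b = 2 - int r + int k" if "k < len (r - 1)" for k
    proof -
      have "k < len 1" using that r' by simp
      then obtain b where b: "b \<in> R" "\<kappa> b = 0" "box_content b = int k" using W' by blast
      then have "box_content b = 2 - int r + int k" using r'(2) by simp
      then show ?thesis using rows[OF b(1)] b(2) by blast
    qed
  qed (use c in \<open>auto simp: boxes_iff\<close>)
qed

text \<open>Runs may fall into row \<open>r - 1\<close> but no further, and these two rows have no
  content above \<open>n - r\<close>, which rules out the long run. Once the level of
  \<open>(r, 1)\<close> is known, the same argument on the lower levels yields the run belonging to
  row \<open>r - 1\<close>.\<close>

lemma row_level_swapped:
  assumes r': "r = r\<^sub>0 + 1" "3 \<le> r" and c: "(r, c) \<in> boxes"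
  shows "\<kappa> (r, c) = level r"
proof -
  let ?s = "r - 1"
  have \<rho>: "?s \<noteq> r\<^sub>0 + 1" using r' by simp
  have lens: "len ?s = n - 1" using r r' by (intro len_mid) auto
  have lev: "level r = level ?s + 1" using r' d by (simp add: level_def)
  have rows: "fst b = r \<or> fst b = ?s" "box_content b \<le> int n - int r" if "b \<in> R" "?s \<le> fst b" for b
  proof -
    obtain x y where b: "b = (x, y)" by (metis surj_pair)
    from that have x: "x = r \<or> x = ?s" by (auto simp: b R_iff)
    then show "fst b = r \<or> fst b = ?s" by (simp add: b)
    have "y \<le> len x" using that by (simp add: b R_iff)
    then show "box_content b \<le> int n - int r" using x lens len_bounds r' n
      by (auto simp: b box_content_def of_nat_diff)
  qed
  have eq: "\<kappa> (r, 1) = level r"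
  proof (rule ccontr)
    assume "\<kappa> (r, 1) \<noteq> level r"
    then have lt: "\<kappa> (r, 1) < level r" using first_le by simp
    obtain b where b: "b \<in> R" "\<kappa> b = \<kappa> (r, 1)" "box_content b = 1 - int r + int n" using long_run[OF lt, of n] by auto
    have "?s \<le> fst b"
      by (rule level_row[OF R_boxes long_run[OF lt] \<rho> _ order_refl b]) (use fst_first_R in auto)
    then show False using rows(2)[OF b(1)] b(3) by simp
  qed
  note run = short_run[OF this]
  have Wrow: "?s \<le> fst b" if "b \<in> R" "\<kappa> b = level r" "box_content b = 1 - int r + int k" "k < len r" for b k
    by (rule level_row[where m = "len r - 1", OF R_boxes run \<rho> _ _ that(1-3)]) (use fst_first_R that len_bounds in auto)
  have v0: "v (r, 1) = start r" using eq start_level[OF r2] by (simp add: v box_content_def)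
  \<comment> \<open>The boxes of lower level occupy exactly the positions below
    \<open>start r\<close>; their least content is \<open>2 - r\<close>, at
    \<open>(r - 1, 1)\<close> or \<open>(r, 2)\<close>.\<close>
  define R' where "R' = {b\<in>R. \<kappa> b < level r}"
  have R'R: "R' \<subseteq> R" by (auto simp: R'_def)
  then have R'b: "R' \<subseteq> boxes" using R_boxes by blast
  have surj': "\<exists>b\<in>R'. v b = y" if y: "0 \<le> y" "y < start r" for y
  proof -
    obtain b where b: "b \<in> R" "v b = y" using R_surj[of y] y bound[OF r2] by auto
    have "\<kappa> b < level r"
    proof (rule ccontr)
      assume "\<not> \<kappa> b < level r"
      then have "int n * int (level r) \<le> int n * int (\<kappa> b)" by (intro mult_left_mono) auto
      then show False using least_R[OF b(1)] b(2) y start_level[OF r2] by (simp add: v)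
    qed
    with b show ?thesis unfolding R'_def by blast
  qed
  have v': "v b < start r" if "b \<in> R'" for b
    using v_mono[of b "(r, 1)"] that R'b first_R R_boxes v0 eq by (auto simp: R'_def)
  have least': "2 - int r \<le> box_content b" if "b \<in> R'" for b
  proof -
    have "box_content b \<noteq> 1 - int r" using uniq_R[of b] that eq by (auto simp: R'_def)
    then show ?thesis using least_R[of b] that R'R by fastforce
  qed
  have two: "b = (?s, 1) \<or> b = (r, 2) \<and> 2 \<le> len r" if "b \<in> R" "box_content b = 2 - int r" for b
  proof -
    obtain x y where b: "b = (x, y)" by (metis surj_pair)
    have xy: "1 \<le> x" "x \<le> r" "1 \<le> y" "y \<le> len x" using that(1) unfolding b R_iff by auto
    have e: "int y + int r = int x + 2" using that(2) by (simp add: b box_content_def)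
    then have "x = r \<or> x = ?s" using xy r' by linarith
    then show ?thesis
    proof
      assume "x = r"
      then show ?thesis using e xy by (simp add: b)
    next
      assume "x = ?s"
      then show ?thesis using e xy r' by (simp add: b of_nat_diff)
    qed
  qed
  have s1: "(?s, 1) \<in> R" using r' len_pos[of ?s] unfolding R_iff by simp
  have cs: "box_content (?s, 1) = 2 - int r" "box_content (r, 2) = 2 - int r" using r' by (auto simp: box_content_def of_nat_diff)
  have inj2: "\<kappa> b \<noteq> \<kappa> b'" if "b \<in> R" "b' \<in> R" "box_content b = box_content b'" "b \<noteq> b'" for b b'
    using v_inj[of b b'] that R_boxes by (auto simp: v)
  \<comment> \<open>If \<open>(r - 1, 1)\<close> is not of lower level, \<open>bound\<close> forces
    its level to be \<open>level r\<close>. Then \<open>(r, 2)\<close> is a box, and it has another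
    level, since two boxes of equal content and level would share a position.\<close>
  have "\<exists>b0\<in>R'. box_content b0 = 2 - int r"
  proof (cases "\<kappa> (?s, 1) < level r")
    case True
    then show ?thesis using s1 cs by (intro bexI[of _ "(?s, 1)"]) (auto simp: R'_def)
  next
    case False
    have "bound \<le> start r + int n" using bound[OF r2] len_bounds by simp
    moreover have "v (?s, 1) < bound" using v_R s1 by blast
    ultimately have "int n * int (\<kappa> (?s, 1)) < int n * (int (level r) + 1)"
      using start_level[OF r2] cs r' by (simp add: v algebra_simps)
    then have "int (\<kappa> (?s, 1)) < int (level r) + 1" using n by (subst (asm) mult_less_cancel_left_pos) auto
    then have ks: "\<kappa> (?s, 1) = level r" using False by linarith
    then have "v (?s, 1) = start r + 1" using start_level[OF r2] cs by (simp add: v)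
    then have "2 \<le> len r" using v_R(2)[OF s1] bound[OF r2] by simp
    then have "(r, 2) \<in> R" using r2 by (simp add: R_iff)
    moreover have "v (r, 2) < bound" using v_R calculation by blast
    then have "int n * int (\<kappa> (r, 2)) < int n * (int (level r) + 1)"
      using start_level[OF r2] cs \<open>bound \<le> start r + int n\<close> by (simp add: v algebra_simps)
    then have "int (\<kappa> (r, 2)) < int (level r) + 1" using n by (subst (asm) mult_less_cancel_left_pos) auto
    then have "\<kappa> (r, 2) \<le> level r" by linarith
    moreover have "\<kappa> (r, 2) \<noteq> level r" using inj2[OF calculation(1) s1] cs ks by auto
    ultimately show ?thesis using cs by (intro bexI[of _ "(r, 2)"]) (auto simp: R'_def)
  qed
  then obtain b0 where b0: "b0 \<in> R'" "box_content b0 = 2 - int r" by blast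
  \<comment> \<open>If both boxes of content \<open>2 - r\<close> were of lower level, neither could
    be the box that the run of level \<open>level r\<close> has at this content.\<close>
  have uniq': "b = b0" if "b \<in> R'" "box_content b = 2 - int r" for b
  proof (rule ccontr)
    assume ne: "b \<noteq> b0"
    have bR: "b \<in> R" "b0 \<in> R" using that b0 R'R by auto
    have l2: "2 \<le> len r" using two[OF bR(1) that(2)] two[OF bR(2) b0(2)] ne by blast
    obtain b1 where b1: "b1 \<in> R" "\<kappa> b1 = level r" "box_content b1 = 2 - int r" using run[of 1] l2 by auto
    then have "b1 = b \<or> b1 = b0"
      using two[OF bR(1) that(2)] two[OF bR(2) b0(2)] two[of b1] ne by blast
    then show False using b1 that b0 by (auto simp: R'_def)
  qed
  have run': "\<exists>b\<in>R'. \<kappa> b = \<kappa> b0 \<and> box_content b = 2 - int r + int k" if "k \<le> n" "v b0 + int k < start r" for k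
    using level_run[OF surj' R'b b0 least' uniq'] v_R(1) b0 R'R that by blast
  have row': "?s \<le> fst b" if "b \<in> R'" "box_content b = 2 - int r" for b
    using two[OF subsetD[OF R'R that(1)] that(2)] by auto
  have st: "start r = start ?s + int n - 1" using start_Suc[of ?s] r' by simp
  have ss: "start ?s = 2 - int r + int n * int (level ?s)" using start_level[of ?s] r' by (simp add: of_nat_diff)
  \<comment> \<open>A lower level would start a run up to content \<open>2 - r + n\<close>, beyond
    the largest content \<open>n - r\<close> of the two rows.\<close>
  have k0: "\<kappa> b0 = level ?s"
  proof (rule ccontr)
    assume "\<kappa> b0 \<noteq> level ?s"
    moreover have "\<kappa> b0 \<le> level ?s" using b0 lev by (auto simp: R'_def)
    ultimately have "int n * (int (\<kappa> b0) + 1) \<le> int n * int (level ?s)" by (intro mult_left_mono) auto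
    then have "v b0 + int n < start r" using st ss b0 n by (simp add: v algebra_simps)
    then have rn: "\<exists>b\<in>R'. \<kappa> b = \<kappa> b0 \<and> box_content b = 2 - int r + int k" if "k \<le> n" for k
      using run'[OF that] that by simp
    obtain b where b: "b \<in> R'" "\<kappa> b = \<kappa> b0" "box_content b = 2 - int r + int n" using rn[of n] by auto
    have "?s \<le> fst b" by (rule level_row[OF R'b rn \<rho> row' order_refl b])
    then show False using rows(2)[OF subsetD[OF R'R b(1)]] b(3) by simp
  qed
  have run'': "\<exists>b\<in>R'. \<kappa> b = level ?s \<and> box_content b = 2 - int r + int k" if "k < n - 1" for k
    using run'[of k] that k0 st ss b0 by (simp add: v)
  show ?thesis
  proof (rule two_rows[OF r'(1) r2 r(2), of _ "level ?s"])
    show "level r \<noteq> level ?s" using lev by simp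
    show "\<exists>b\<in>boxes. (fst b = r \<or> fst b = r - 1) \<and> \<kappa> b = level r \<and> box_content b = 1 - int r + int k" if k: "k < len r" for k
    proof -
      obtain b where b: "b \<in> R" "\<kappa> b = level r" "box_content b = 1 - int r + int k" using run[OF k] by auto
      then show ?thesis using rows(1)[OF b(1) Wrow[OF b k]] R_boxes by blast
    qed
    show "\<exists>b\<in>boxes. (fst b = r \<or> fst b = r - 1) \<and> \<kappa> b = level ?s \<and> box_content b = 2 - int r + int k" if "k < len (r - 1)" for k
    proof -
      have k: "k < n - 1" using that lens by simp
      then obtain b where b: "b \<in> R'" "\<kappa> b = level ?s" "box_content b = 2 - int r + int k" using run'' by blast
      have "?s \<le> fst b"
        by (rule level_row[where m = "n - 2", OF R'b run'' \<rho> row' _ b]) (use k in auto)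
      then show ?thesis using rows(1)[OF subsetD[OF R'R b(1)]] b R'b by blast
    qed
  qed (use c in \<open>auto simp: boxes_iff\<close>)
qed

end

lemma row_level: "(r, c) \<in> boxes \<Longrightarrow> \<kappa> (r, c) = level r"
proof -
  assume c: "(r, c) \<in> boxes"
  consider "r = 1" | "2 \<le> r" "r \<noteq> r\<^sub>0 + 1" | "r = r\<^sub>0 + 1" "r = 2" | "r = r\<^sub>0 + 1" "3 \<le> r" using r by linarith
  then show ?thesis
  proof cases
    case 1
    then show ?thesis using row_1_level c by simp
  next
    case 2
    then show ?thesis using row_level_unswapped c by blast
  next
    case 3
    then have "2 \<le> r" by simp
    then show ?thesis using row_level_swapped_2 3 c by blast
  next
    case 4
    then have "2 \<le> r" by simp
    then show ?thesis using row_level_swapped 4 c by blast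
  qed
qed

end

theorem level_eq:
  assumes "(r, c) \<in> boxes"
  shows "\<kappa> (r, c) = level r"
proof -
  have "\<forall>\<rho> c. K + 1 - j < \<rho> \<longrightarrow> (\<rho>, c) \<in> boxes \<longrightarrow> \<kappa> (\<rho>, c) = level \<rho>" for j
  proof (induction j)
    case 0
    then show ?case by (simp add: boxes_iff)
  next
    case (Suc j)
    show ?case
    proof (intro allI impI)
      fix \<rho> c assume h: "K + 1 - Suc j < \<rho>" "(\<rho>, c) \<in> boxes"
      show "\<kappa> (\<rho>, c) = level \<rho>"
      proof (cases "K + 1 - j < \<rho>")
        case False
        then have "\<rho> = K + 1 - j" using h by simp
        then show ?thesis using row_level[of \<rho> c] Suc.IH h by (simp add: boxes_iff)
      qed (use Suc.IH h in blast)
    qed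
  qed
  from this[of "K + 1"] show ?thesis using assms by (simp add: boxes_iff)
qed

end

section \<open>Orders on compositions\<close>

definition psum :: "nat list \<Rightarrow> nat" where
  "psum a = (\<Sum>j\<le>length a. sum_list (take j a))"

lemma take_sums_inj:
  assumes "length a = length b" "\<And>j. j \<le> length a \<Longrightarrow> sum_list (take j a) = sum_list (take j (b :: nat list))"
  shows "a = b"
proof (rule nth_equalityI[OF assms(1)])
  fix j assume j: "j < length a"
  then have "sum_list (take (Suc j) a) = sum_list (take (Suc j) b)" "sum_list (take j a) = sum_list (take j b)"
    using assms(2)[of "Suc j"] assms(2)[of j] by simp_all
  then show "a ! j = b ! j" using j assms(1) by (simp add: take_Suc_conv_app_nth)
qed

lemma dominates_psum:
  assumes "dominates a b" "length a = length b"
  shows "psum b < psum a"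
proof -
  have le: "sum_list (take j b) \<le> sum_list (take j a)" if "j \<le> length a" for j
    using assms that by (simp add: dominates_def)
  obtain j where "j \<le> length a" "sum_list (take j a) \<noteq> sum_list (take j b)"
    using take_sums_inj[OF assms(2)] assms(1) by (auto simp: dominates_def)
  then have "j \<in> {..length a}" "sum_list (take j b) < sum_list (take j a)" using le[of j] by auto
  then have "(\<Sum>j\<le>length a. sum_list (take j b)) < (\<Sum>j\<le>length a. sum_list (take j a))"
    using le by (intro sum_strict_mono_ex1) auto
  then show ?thesis using assms(2) by (simp add: psum_def)
qed

text \<open>Dominance strictly raises \<open>psum\<close>, so the pair of sums embeds
  \<open>above\<close> in a lexicographic order of numbers, where well-foundedness and transitivity
  are immediate.\<close>

definition lower :: "nat \<Rightarrow> ((nat \<Rightarrow>\<^sub>0 nat) \<times> (nat \<Rightarrow>\<^sub>0 nat)) set" where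
  "lower N = inv_image (less_than <*lex*> less_than) (\<lambda>\<alpha>. (psum (sorted_parts N \<alpha>), psum (parts N \<alpha>)))"

lemma wf_lower: "wf (lower N)" and trans_lower: "trans (lower N)"
  unfolding lower_def by (auto intro!: wf_inv_image trans_inv_image)

lemma length_parts [simp]: "length (parts N \<alpha>) = N"
  and length_sorted_parts [simp]: "length (sorted_parts N \<alpha>) = N"
  by (simp_all add: parts_def sorted_parts_def del: upt_Suc)

lemma above_lower: "above N \<alpha> \<beta> \<Longrightarrow> (\<beta>, \<alpha>) \<in> lower N"
  by (auto simp: above_def lower_def dominates_psum)

lemma tvar_neq_0: "tvar \<noteq> 0" and qvar_neq_0: "qvar \<noteq> 0"
  using spec_tvar[of "(1, 1)"] spec_qvar[of "(1, 1)"] by (metis fst_conv snd_conv spec_0 zero_neq_one)+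

text \<open>The exponent of \<open>t\<close> in the weight. For \<open>i\<close> in
  \<open>{1..N}\<close> it is the number of indices before \<open>i\<close> when these are sorted by
  increasing part and, among equal parts, by decreasing index (\<open>pos_eq_card\<close>).\<close>

definition pos :: "nat \<Rightarrow> (nat \<Rightarrow>\<^sub>0 nat) \<Rightarrow> nat \<Rightarrow> nat" where
  "pos N \<alpha> i = N - comp_rank N \<alpha> i"

lemma zeta_eq: "zeta N \<alpha> i = qvar ^ lookup \<alpha> i * tvar ^ pos N \<alpha> i"
  by (simp add: zeta_def pos_def)

lemma comp_rank_eq:
  "comp_rank N \<alpha> i = card {k\<in>{1..N}. lookup \<alpha> i < lookup \<alpha> k \<or> lookup \<alpha> k = lookup \<alpha> i \<and> k \<le> i}"
proof -
  have "{k\<in>{1..N}. lookup \<alpha> i < lookup \<alpha> k \<or> lookup \<alpha> k = lookup \<alpha> i \<and> k \<le> i}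
    = {k\<in>{1..N}. lookup \<alpha> k > lookup \<alpha> i} \<union> {k\<in>{1..N}. k \<le> i \<and> lookup \<alpha> k = lookup \<alpha> i}" by auto
  then show ?thesis unfolding comp_rank_def by (subst card_Un_disjoint[symmetric]) auto
qed

lemma comp_rank_bounds: "i \<in> {1..N} \<Longrightarrow> 1 \<le> comp_rank N \<alpha> i \<and> comp_rank N \<alpha> i \<le> N"
proof -
  assume i: "i \<in> {1..N}"
  let ?X = "{k\<in>{1..N}. lookup \<alpha> i < lookup \<alpha> k \<or> lookup \<alpha> k = lookup \<alpha> i \<and> k \<le> i}"
  have "i \<in> ?X" using i by simp
  then have "0 < card ?X" by (subst card_gt_0_iff) auto
  moreover have "card ?X \<le> card {1..N}" by (rule card_mono) auto
  ultimately show ?thesis by (simp add: comp_rank_eq)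
qed

lemma pos_less:
  assumes "i \<in> {1..N}" "j \<in> {1..N}" "lookup \<alpha> i < lookup \<alpha> j \<or> lookup \<alpha> i = lookup \<alpha> j \<and> j < i"
  shows "pos N \<alpha> i < pos N \<alpha> j"
proof -
  have "{k\<in>{1..N}. lookup \<alpha> j < lookup \<alpha> k \<or> lookup \<alpha> k = lookup \<alpha> j \<and> k \<le> j}
     \<subset> {k\<in>{1..N}. lookup \<alpha> i < lookup \<alpha> k \<or> lookup \<alpha> k = lookup \<alpha> i \<and> k \<le> i}"
    using assms by auto
  then have "comp_rank N \<alpha> j < comp_rank N \<alpha> i"
    unfolding comp_rank_eq by (intro psubset_card_mono) auto
  then show ?thesis using comp_rank_bounds[OF assms(1), of \<alpha>] comp_rank_bounds[OF assms(2), of \<alpha>]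
    by (simp add: pos_def)
qed

lemma pos_bij: "bij_betw (pos N \<alpha>) {1..N} {0..<N}"
proof -
  have inj: "inj_on (pos N \<alpha>) {1..N}"
  proof (rule inj_onI)
    fix i j assume h: "i \<in> {1..N}" "j \<in> {1..N}" "pos N \<alpha> i = pos N \<alpha> j"
    then show "i = j" using pos_less[of i N j \<alpha>] pos_less[of j N i \<alpha>] by (metis linorder_neqE_nat less_irrefl)
  qed
  moreover have "pos N \<alpha> ` {1..N} \<subseteq> {0..<N}"
    using comp_rank_bounds[of _ N \<alpha>] by (force simp: pos_def)
  ultimately show ?thesis
    by (simp add: bij_betw_def card_image card_subset_eq)
qed

lemma pos_Suc:
  assumes "1 \<le> i" "i < N" "lookup \<alpha> i = lookup \<alpha> (i + 1)"
  shows "pos N \<alpha> i = pos N \<alpha> (i + 1) + 1"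
proof -
  let ?X = "{k\<in>{1..N}. lookup \<alpha> i < lookup \<alpha> k \<or> lookup \<alpha> k = lookup \<alpha> i \<and> k \<le> i}"
  have e: "{k\<in>{1..N}. lookup \<alpha> (i + 1) < lookup \<alpha> k \<or> lookup \<alpha> k = lookup \<alpha> (i + 1) \<and> k \<le> i + 1} = insert (i + 1) ?X"
    using assms by auto
  have "i + 1 \<notin> ?X" using assms by auto
  then have "comp_rank N \<alpha> (i + 1) = Suc (comp_rank N \<alpha> i)"
    unfolding comp_rank_eq e by (intro card_insert_disjoint) auto
  then show ?thesis using comp_rank_bounds[of "i + 1" N \<alpha>] assms by (simp add: pos_def)
qed

lemma qt_power_inj:
  assumes "qvar ^ a * tvar ^ b = qvar ^ a' * tvar ^ b'"
  shows "a = a'" "b = b'"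
proof -
  have s: "spec (x, y) (qvar ^ a * tvar ^ b) = x ^ a * y ^ b" for x y a b
    by (simp add: spec_mult spec_power regular_power)
  have inj: "k = l" if "(2::complex) ^ k = 2 ^ l" for k l
  proof -
    have "(2::real) ^ k = 2 ^ l" using arg_cong[OF that, of norm] by (simp add: norm_power)
    then show ?thesis by simp
  qed
  show "a = a'" using s[of 2 1 a b] s[of 2 1 a' b'] assms inj by simp
  show "b = b'" using s[of 1 2 a b] s[of 1 2 a' b'] assms inj by simp
qed

lemma regular_zeta: "zeta N \<alpha> i \<in> regular pt"
  and spec_zeta: "spec pt (zeta N \<alpha> i) = fst pt ^ lookup \<alpha> i * snd pt ^ pos N \<alpha> i"
  by (simp_all add: zeta_eq regular_mult regular_power spec_mult spec_power)

lemma
  assumes "fst pt \<noteq> 0" "snd pt \<noteq> 0"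
  shows regular_unit: "qvar powi a * tvar powi b \<in> regular pt"
    and spec_unit: "spec pt (qvar powi a * tvar powi b) = fst pt powi a * snd pt powi b"
  using assms by (simp_all add: regular_powi regular_mult spec_mult)

section \<open>Joint eigenvectors of the Cherednik operators\<close>

definition eigen :: "nat \<Rightarrow> 'a::field \<Rightarrow> 'a \<Rightarrow> (nat \<Rightarrow> 'a) \<Rightarrow> 'a mpoly \<Rightarrow> bool" where
  "eigen N q t w p \<longleftrightarrow> (\<forall>i\<in>{1..N}. cherednik N q t i p = scale (w i) p)"

definition proj :: "nat \<Rightarrow> 'a::field \<Rightarrow> 'a \<Rightarrow> (nat \<times> 'a) list \<Rightarrow> 'a mpoly \<Rightarrow> 'a mpoly" where
  "proj N q t = fold (\<lambda>(j, z) p. cherednik N q t j p - scale z p)"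

context
  fixes N :: nat and q t :: "'a::field"
  assumes t: "t \<noteq> 0"
begin

lemma proj_add: "proj N q t ws (p + p') = proj N q t ws p + proj N q t ws p'"
  unfolding proj_def
proof (induction ws arbitrary: p p')
  case (Cons x ws)
  obtain j z where x: "x = (j, z)" by (metis surj_pair)
  have e: "cherednik N q t j (p + p') - scale z (p + p') = (cherednik N q t j p - scale z p) + (cherednik N q t j p' - scale z p')"
    by (simp add: cherednik_add[OF t] mpoly.scale_right_distrib)
  show ?case by (simp add: x e Cons.IH)
qed simp

lemma proj_scale: "proj N q t ws (scale c p) = scale c (proj N q t ws p)"
  unfolding proj_def
proof (induction ws arbitrary: p)
  case (Cons x ws)
  obtain j z where x: "x = (j, z)" by (metis surj_pair)
  have e: "cherednik N q t j (scale c p) - scale z (scale c p) = scale c (cherednik N q t j p - scale z p)"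
    by (simp add: cherednik_scale[OF t] mpoly.scale_right_diff_distrib mult.commute)
  show ?case by (simp only: x fold_Cons o_apply prod.case e Cons.IH)
qed simp

lemma proj_eigen:
  assumes "eigen N q t w p" "fst ` set ws \<subseteq> {1..N}"
  shows "proj N q t ws p = scale (\<Prod>(j, z)\<leftarrow>ws. w j - z) p"
  using assms(2)
proof (induction ws)
  case (Cons x ws)
  obtain j z where x: "x = (j, z)" by (metis surj_pair)
  then have "cherednik N q t j p - scale z p = scale (w j - z) p"
    using assms(1) Cons.prems by (simp add: eigen_def mpoly.scale_left_diff_distrib)
  then have "proj N q t (x # ws) p = scale (w j - z) (proj N q t ws p)"
    using proj_scale[of ws "w j - z" p] by (simp add: proj_def x)
  then show ?case using Cons by (simp add: x)
qed (simp add: proj_def)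

lemma subspace_kernel_proj: "mpoly.subspace {p. proj N q t ws p = 0}"
proof (rule mpoly.subspaceI)
  show "0 \<in> {p. proj N q t ws p = 0}" using proj_scale[of ws 0 0] by simp
qed (auto simp: proj_add proj_scale)

lemma proj_kills:
  assumes f: "f \<in> mpoly.span E" and E: "\<And>p. p \<in> E \<Longrightarrow> \<exists>w. eigen N q t w p \<and> (\<exists>j. (j, w j) \<in> set ws)"
    and ws: "fst ` set ws \<subseteq> {1..N}"
  shows "proj N q t ws f = 0"
proof -
  have "E \<subseteq> {p. proj N q t ws p = 0}"
  proof
    fix p assume "p \<in> E"
    then obtain w j where w: "eigen N q t w p" "(j, w j) \<in> set ws" using E by blast
    then have "0 \<in> (\<lambda>(j, z). w j - z) ` set ws" by force
    then have "(\<Prod>(j, z)\<leftarrow>ws. w j - z) = 0" by (simp add: prod_list_zero_iff)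
    then show "p \<in> {p. proj N q t ws p = 0}" using proj_eigen[OF w(1) ws] by simp
  qed
  then have "mpoly.span E \<subseteq> {p. proj N q t ws p = 0}"
    using subspace_kernel_proj by (intro mpoly.span_minimal)
  with f show ?thesis by blast
qed

lemma proj_closed:
  assumes A: "subring A" and p: "p \<in> polys_over A {1..N}" and qt: "t \<in> A" "1 / t \<in> A" "q \<in> A"
    and ws: "fst ` set ws \<subseteq> {1..N}" "snd ` set ws \<subseteq> A"
  shows "proj N q t ws p \<in> polys_over A {1..N}"
  using p ws
proof (induction ws arbitrary: p)
  case (Cons x ws)
  obtain j z where x: "x = (j, z)" by (metis surj_pair)
  have "cherednik N q t j p - scale z p \<in> polys_over A {1..N}"
    using Cons.prems x qt
    by (intro polys_over_diff[OF A] polys_over_scale[OF A] cherednik_closed[OF t A]) auto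
  then show ?case using Cons.IH Cons.prems by (simp add: proj_def x)
qed (simp add: proj_def)

text \<open>Only finitely many members of \<open>E\<close> enter \<open>f\<close>. For each of them
  choose a \<open>j\<close> at which the weights differ; the product of the factors \<xi>_j - w'(j)
  kills them all, but multiplies \<open>f\<close> by a product of nonzero differences.\<close>

lemma eigen_span_zero:
  assumes f: "eigen N q t w f" "f \<in> mpoly.span E"
    and E: "\<And>p. p \<in> E \<Longrightarrow> \<exists>w'. eigen N q t w' p \<and> (\<exists>j\<in>{1..N}. w' j \<noteq> w j)"
  shows "f = 0"
proof -
  obtain T c where T: "finite T" "T \<subseteq> E" "f = (\<Sum>p\<in>T. scale (c p) p)"
    using f(2) unfolding mpoly.span_explicit by blast
  have fT: "f \<in> mpoly.span T" unfolding T(3) by (intro mpoly.span_sum mpoly.span_scale mpoly.span_base)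
  have "\<forall>p\<in>T. \<exists>wj. eigen N q t (fst wj) p \<and> snd wj \<in> {1..N} \<and> fst wj (snd wj) \<noteq> w (snd wj)"
  proof
    fix p assume "p \<in> T"
    then obtain w' j where "eigen N q t w' p" "j \<in> {1..N}" "w' j \<noteq> w j" using E T(2) by blast
    then show "\<exists>wj. eigen N q t (fst wj) p \<and> snd wj \<in> {1..N} \<and> fst wj (snd wj) \<noteq> w (snd wj)"
      by (intro exI[of _ "(w', j)"]) simp
  qed
  then obtain g where g: "\<And>p. p \<in> T \<Longrightarrow> eigen N q t (fst (g p)) p \<and> snd (g p) \<in> {1..N} \<and> fst (g p) (snd (g p)) \<noteq> w (snd (g p))"
    using bchoice[of T "\<lambda>p wj. eigen N q t (fst wj) p \<and> snd wj \<in> {1..N} \<and> fst wj (snd wj) \<noteq> w (snd wj)"] by blast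
  obtain ps where ps: "set ps = T" using T(1) finite_list by blast
  define ws where "ws = map (\<lambda>p. (snd (g p), fst (g p) (snd (g p)))) ps"
  have ws: "fst ` set ws \<subseteq> {1..N}" using g ps by (auto simp: ws_def)
  have "proj N q t ws f = 0"
  proof (rule proj_kills[OF fT _ ws])
    fix p assume p: "p \<in> T"
    then have "(snd (g p), fst (g p) (snd (g p))) \<in> set ws" by (auto simp: ws_def ps)
    then show "\<exists>w. eigen N q t w p \<and> (\<exists>j. (j, w j) \<in> set ws)" using g[OF p] by blast
  qed
  moreover have "(\<Prod>(j, z)\<leftarrow>ws. w j - z) \<noteq> 0"
  proof
    assume "(\<Prod>(j, z)\<leftarrow>ws. w j - z) = 0"
    then obtain p where "p \<in> T" "w (snd (g p)) - fst (g p) (snd (g p)) = 0"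
      by (auto simp: prod_list_zero_iff ws_def ps)
    then show False using g[of p] by simp
  qed
  ultimately show ?thesis using proj_eigen[OF f(1) ws] by (simp add: mpoly.scale_eq_0_iff)
qed

end

section \<open>Macdonald polynomials\<close>

context
  fixes N :: nat and M :: "(nat \<Rightarrow>\<^sub>0 nat) \<Rightarrow> ratfun mpoly"
  assumes fam: "macdonald_family N M"
begin

lemma M_eigen: "\<alpha> \<in> comps N \<Longrightarrow> eigen N qvar tvar (zeta N \<alpha>) (M \<alpha>)"
  using fam by (simp add: macdonald_family_def eigen_def)

lemma M_form:
  assumes "\<alpha> \<in> comps N"
  obtains a b :: int and A where "M \<alpha> = Poly_Mapping.single \<alpha> (qvar powi a * tvar powi b)
    + (\<Sum>\<beta>\<in>{\<beta>\<in>comps N. above N \<alpha> \<beta>}. Poly_Mapping.single \<beta> (A \<beta>))"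
  using fam assms unfolding macdonald_family_def by blast

lemma M_swap:
  assumes "\<alpha> \<in> comps N" "1 \<le> i" "i < N" "lookup \<alpha> i < lookup \<alpha> (i + 1)"
  shows "M (swap_comp i \<alpha>) = hecke tvar i (M \<alpha>) + scale ((1 - tvar) / (1 - zeta N \<alpha> (i + 1) / zeta N \<alpha> i)) (M \<alpha>)"
  using fam assms unfolding macdonald_family_def by auto

lemma M_homogeneous:
  assumes "\<alpha> \<in> comps N"
  shows "M \<alpha> \<in> homogeneous_polys N (size_comp N \<alpha>)"
proof -
  obtain a b :: int and A where M: "M \<alpha> = Poly_Mapping.single \<alpha> (qvar powi a * tvar powi b)
    + (\<Sum>\<beta>\<in>{\<beta>\<in>comps N. above N \<alpha> \<beta>}. Poly_Mapping.single \<beta> (A \<beta>))" using M_form[OF assms] .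
  have "keys (M \<alpha>) \<subseteq> insert \<alpha> {\<beta>\<in>comps N. above N \<alpha> \<beta>}"
  proof
    fix \<gamma> assume g: "\<gamma> \<in> keys (M \<alpha>)"
    show "\<gamma> \<in> insert \<alpha> {\<beta>\<in>comps N. above N \<alpha> \<beta>}"
    proof (rule ccontr)
      assume n: "\<gamma> \<notin> insert \<alpha> {\<beta>\<in>comps N. above N \<alpha> \<beta>}"
      then have "(\<Sum>\<beta>\<in>{\<beta>\<in>comps N. above N \<alpha> \<beta>}. lookup (Poly_Mapping.single \<beta> (A \<beta>)) \<gamma>) = 0"
        by (intro sum.neutral) (auto simp: lookup_single when_def)
      then have "lookup (M \<alpha>) \<gamma> = 0" unfolding M lookup_add lookup_sum using n by (auto simp: lookup_single_not_eq)
      then show False using g by (simp add: in_keys_iff)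
    qed
  qed
  then show ?thesis using assms by (auto simp: homogeneous_polys_def above_def)
qed

lemma M_polys_over: "\<alpha> \<in> comps N \<Longrightarrow> M \<alpha> \<in> polys_over UNIV {1..N}"
  using M_homogeneous[of \<alpha>] by (auto simp: polys_over_def homogeneous_polys_def comps_def)

lemma M_lead:
  assumes "\<alpha> \<in> comps N"
  obtains a b :: int where "lookup (M \<alpha>) \<alpha> = qvar powi a * tvar powi b"
proof -
  obtain a b :: int and A where M: "M \<alpha> = Poly_Mapping.single \<alpha> (qvar powi a * tvar powi b)
    + (\<Sum>\<beta>\<in>{\<beta>\<in>comps N. above N \<alpha> \<beta>}. Poly_Mapping.single \<beta> (A \<beta>))" using M_form[OF assms] .
  have "(\<Sum>\<beta>\<in>{\<beta>\<in>comps N. above N \<alpha> \<beta>}. lookup (Poly_Mapping.single \<beta> (A \<beta>)) \<alpha>) = 0"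
    by (intro sum.neutral) (auto simp: lookup_single when_def above_def)
  then have "lookup (M \<alpha>) \<alpha> = qvar powi a * tvar powi b"
    by (simp add: M lookup_add lookup_sum)
  then show ?thesis by (rule that)
qed

text \<open>The triangular expansion is inverted by induction along \<open>lower\<close>: each lower
  monomial is a multiple of its own \<open>M\<close> plus members of the family that are lower
  still.\<close>

lemma monomial_diff_span:
  assumes "\<alpha> \<in> comps N"
  obtains a b :: int where
    "Poly_Mapping.single \<alpha> (qvar powi a * tvar powi b) - M \<alpha> \<in> mpoly.span (M ` {\<gamma>\<in>comps N. (\<gamma>, \<alpha>) \<in> lower N})"
proof -
  have "\<exists>(a::int) (b::int). Poly_Mapping.single \<alpha> (qvar powi a * tvar powi b) - M \<alpha> \<in> mpoly.span (M ` {\<gamma>\<in>comps N. (\<gamma>, \<alpha>) \<in> lower N})"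
    using wf_lower[of N] assms
  proof (induction \<alpha> rule: wf_induct_rule)
    case (less \<alpha>)
    obtain a b :: int and A where M: "M \<alpha> = Poly_Mapping.single \<alpha> (qvar powi a * tvar powi b)
      + (\<Sum>\<beta>\<in>{\<beta>\<in>comps N. above N \<alpha> \<beta>}. Poly_Mapping.single \<beta> (A \<beta>))" using M_form[OF less.prems] .
    let ?S = "mpoly.span (M ` {\<gamma>\<in>comps N. (\<gamma>, \<alpha>) \<in> lower N})"
    have "Poly_Mapping.single \<beta> (A \<beta>) \<in> ?S" if b: "\<beta> \<in> comps N" "above N \<alpha> \<beta>" for \<beta>
    proof -
      have l: "(\<beta>, \<alpha>) \<in> lower N" using above_lower b by blast
      obtain a b :: int where ab: "Poly_Mapping.single \<beta> (qvar powi a * tvar powi b) - M \<beta> \<in> mpoly.span (M ` {\<gamma>\<in>comps N. (\<gamma>, \<beta>) \<in> lower N})"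
        using less.IH[OF l] b by blast
      define c where "c = qvar powi a * tvar powi b"
      have c: "c \<noteq> 0" by (simp add: c_def qvar_neq_0 tvar_neq_0)
      note ab = ab[folded c_def]
      have "M ` {\<gamma>\<in>comps N. (\<gamma>, \<beta>) \<in> lower N} \<subseteq> M ` {\<gamma>\<in>comps N. (\<gamma>, \<alpha>) \<in> lower N}"
        using transD[OF trans_lower _ l] by blast
      then have "Poly_Mapping.single \<beta> c - M \<beta> \<in> ?S" using ab mpoly.span_mono by blast
      moreover have "M \<beta> \<in> ?S" using b l by (intro mpoly.span_base) auto
      ultimately have "Poly_Mapping.single \<beta> c \<in> ?S" using mpoly.span_add by fastforce
      then have "scale (A \<beta> / c) (Poly_Mapping.single \<beta> c) \<in> ?S" by (rule mpoly.span_scale)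
      then show ?thesis using c by (simp add: scale_def Cst_def mult_single)
    qed
    then have "(\<Sum>\<beta>\<in>{\<beta>\<in>comps N. above N \<alpha> \<beta>}. Poly_Mapping.single \<beta> (A \<beta>)) \<in> ?S"
      by (intro mpoly.span_sum) auto
    then have "- (\<Sum>\<beta>\<in>{\<beta>\<in>comps N. above N \<alpha> \<beta>}. Poly_Mapping.single \<beta> (A \<beta>)) \<in> ?S"
      by (rule mpoly.span_neg)
    then have "Poly_Mapping.single \<alpha> (qvar powi a * tvar powi b) - M \<alpha> \<in> ?S" unfolding M by simp
    then show ?case by blast
  qed
  then show ?thesis using that by blast
qed

lemma span_M:
  assumes "p \<in> polys_over UNIV {1..N}"
  shows "p \<in> mpoly.span (M ` comps N)"
proof -
  have "Poly_Mapping.single \<alpha> c \<in> mpoly.span (M ` comps N)" if a: "\<alpha> \<in> comps N" for \<alpha> c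
  proof -
    obtain a b :: int where ab: "Poly_Mapping.single \<alpha> (qvar powi a * tvar powi b) - M \<alpha> \<in> mpoly.span (M ` {\<gamma>\<in>comps N. (\<gamma>, \<alpha>) \<in> lower N})"
      using monomial_diff_span[OF a] .
    define k where "k = qvar powi a * tvar powi b"
    have k: "k \<noteq> 0" by (simp add: k_def qvar_neq_0 tvar_neq_0)
    have "Poly_Mapping.single \<alpha> k - M \<alpha> \<in> mpoly.span (M ` comps N)"
      using ab[folded k_def] mpoly.span_mono[of "M ` {\<gamma>\<in>comps N. (\<gamma>, \<alpha>) \<in> lower N}" "M ` comps N"] by blast
    moreover have "M \<alpha> \<in> mpoly.span (M ` comps N)" using a by (intro mpoly.span_base) auto
    ultimately have "Poly_Mapping.single \<alpha> k \<in> mpoly.span (M ` comps N)"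
      using mpoly.span_add by fastforce
    then have "scale (c / k) (Poly_Mapping.single \<alpha> k) \<in> mpoly.span (M ` comps N)"
      by (rule mpoly.span_scale)
    then show ?thesis using k by (simp add: scale_def Cst_def mult_single)
  qed
  then have "(\<Sum>\<alpha>\<in>keys p. Poly_Mapping.single \<alpha> (lookup p \<alpha>)) \<in> mpoly.span (M ` comps N)"
    using assms by (intro mpoly.span_sum) (auto simp: polys_over_def comps_def)
  then show ?thesis by (simp add: poly_mapping_sum_single)
qed

lemma M_hecke_equal:
  assumes \<alpha>: "\<alpha> \<in> comps N" and i: "1 \<le> i" "i < N" and eq: "lookup \<alpha> i = lookup \<alpha> (i + 1)"
  shows "hecke tvar i (M \<alpha>) = scale tvar (M \<alpha>)"
proof -
  define f where "f = hecke tvar i (M \<alpha>) - scale tvar (M \<alpha>)"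
  define w where "w j = zeta N \<alpha> (Transposition.transpose i (i + 1) j)" for j
  have z: "zeta N \<alpha> (i + 1) = zeta N \<alpha> i / tvar"
    using pos_Suc[OF i eq] eq by (simp add: zeta_eq tvar_neq_0)
  have e: "cherednik N qvar tvar j (M \<alpha>) = scale (zeta N \<alpha> j) (M \<alpha>)" if "j \<in> {1..N}" for j
    using M_eigen[OF \<alpha>] that by (simp add: eigen_def)
  have ei: "cherednik N qvar tvar i (M \<alpha>) = scale (zeta N \<alpha> i) (M \<alpha>)"
    "cherednik N qvar tvar (i + 1) (M \<alpha>) = scale (zeta N \<alpha> i / tvar) (M \<alpha>)"
    using e[of i] e[of "i + 1"] i z by simp_all
  have f: "eigen N qvar tvar w f"
    unfolding eigen_def
  proof
    fix j assume j: "j \<in> {1..N}"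
    consider "j = i" | "j = i + 1" | "j \<noteq> i" "j \<noteq> i + 1" by blast
    then show "cherednik N qvar tvar j f = scale (w j) f"
    proof cases
      case 1
      then have "w j = zeta N \<alpha> i / tvar" by (simp only: w_def z transpose_apply_first)
      then show ?thesis unfolding f_def 1 using hecke_minus_eigen(1)[OF tvar_neq_0 i ei] by (simp only:)
    next
      case 2
      then have "w j = zeta N \<alpha> i" by (simp only: w_def transpose_apply_second)
      then show ?thesis unfolding f_def 2 using hecke_minus_eigen(2)[OF tvar_neq_0 i ei] by (simp only:)
    next
      case 3
      then have "w j = zeta N \<alpha> j" by (simp add: w_def)
      then show ?thesis using 3 j e[OF j] hecke_cherednik_commute[OF tvar_neq_0 i, of j qvar "M \<alpha>"]
        by (simp add: f_def cherednik_diff[OF tvar_neq_0] cherednik_scale[OF tvar_neq_0] hecke_scale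
            mpoly.scale_right_diff_distrib mult.commute)
    qed
  qed
  have fs: "f \<in> mpoly.span (M ` comps N)"
  proof (rule span_M)
    show "f \<in> polys_over UNIV {1..N}"
      unfolding f_def using i M_polys_over[OF \<alpha>]
      by (intro polys_over_diff polys_over_scale hecke_closed subring_UNIV) auto
  qed
  have "f = 0"
  proof (rule eigen_span_zero[OF tvar_neq_0 f fs])
    fix p assume "p \<in> M ` comps N"
    then obtain \<gamma> where \<gamma>: "\<gamma> \<in> comps N" "p = M \<gamma>" by blast
    have "\<exists>j\<in>{1..N}. zeta N \<gamma> j \<noteq> w j"
    proof (rule ccontr)
      assume "\<not> (\<exists>j\<in>{1..N}. zeta N \<gamma> j \<noteq> w j)"
      then have zw: "zeta N \<gamma> j = w j" if "j \<in> {1..N}" for j using that by blast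
      have "lookup \<gamma> j = lookup \<alpha> j" for j
      proof (cases "j \<in> {1..N}")
        case True
        have "lookup \<gamma> j = lookup \<alpha> (Transposition.transpose i (i + 1) j)"
          by (rule qt_power_inj(1)[OF zw[OF True, unfolded w_def zeta_eq]])
        then show ?thesis using eq by (auto simp: Transposition.transpose_def)
      next
        case False
        then have "j \<notin> keys \<gamma>" "j \<notin> keys \<alpha>" using \<gamma> \<alpha> by (auto simp: comps_def)
        then show ?thesis by (simp add: in_keys_iff)
      qed
      then have "\<gamma> = \<alpha>" by (rule poly_mapping_eqI)
      then have "zeta N \<alpha> i = zeta N \<alpha> (i + 1)" using zw[of i] i by (simp add: w_def)
      then have "pos N \<alpha> i = pos N \<alpha> (i + 1)" unfolding zeta_eq by (rule qt_power_inj(2))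
      then show False using pos_Suc[OF i eq] by simp
    qed
    then show "\<exists>w'. eigen N qvar tvar w' p \<and> (\<exists>j\<in>{1..N}. w' j \<noteq> w j)"
      using M_eigen[OF \<gamma>(1)] \<gamma>(2) by blast
  qed
  then show ?thesis by (simp add: f_def)
qed

context
  fixes pt :: "complex \<times> complex"
  assumes pt: "fst pt \<noteq> 0" "snd pt \<noteq> 0"
begin

text \<open>\<open>M\<^sub>\<alpha>\<close> is the image of a monomial under a product of factors
  \<open>\<xi>\<^sub>j - \<zeta>\<^sub>\<gamma>(j)\<close>, up to a scalar that is nonzero at \<open>pt\<close>.\<close>

lemma regular_M:
  assumes \<alpha>: "\<alpha> \<in> comps N"
    and sep: "\<And>\<gamma>. \<gamma> \<in> comps N \<Longrightarrow> \<gamma> \<noteq> \<alpha> \<Longrightarrow> \<exists>j\<in>{1..N}. spec pt (zeta N \<gamma> j) \<noteq> spec pt (zeta N \<alpha> j)"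
  shows "M \<alpha> \<in> polys_over (regular pt) {1..N}"
proof -
  obtain a b :: int where ab: "Poly_Mapping.single \<alpha> (qvar powi a * tvar powi b) - M \<alpha> \<in> mpoly.span (M ` {\<gamma>\<in>comps N. (\<gamma>, \<alpha>) \<in> lower N})"
    using monomial_diff_span[OF \<alpha>] .
  let ?x = "Poly_Mapping.single \<alpha> (qvar powi a * tvar powi b)"
  obtain T c where T: "finite T" "T \<subseteq> M ` {\<gamma>\<in>comps N. (\<gamma>, \<alpha>) \<in> lower N}" "?x - M \<alpha> = (\<Sum>p\<in>T. scale (c p) p)"
    using ab unfolding mpoly.span_explicit by blast
  \<comment> \<open>The linear combination uses finitely many \<gamma>, so a finite product of
    factors removes it.\<close>
  then obtain G where G: "finite G" "G \<subseteq> {\<gamma>\<in>comps N. (\<gamma>, \<alpha>) \<in> lower N}" "T = M ` G"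
    using finite_subset_image[OF T(1,2)] by blast
  have dG: "?x - M \<alpha> \<in> mpoly.span (M ` G)"
    unfolding T(3) G(3) by (intro mpoly.span_sum mpoly.span_scale mpoly.span_base)
  have "\<gamma> \<in> comps N \<and> \<gamma> \<noteq> \<alpha>" if "\<gamma> \<in> G" for \<gamma>
    using G(2) that wf_not_refl[OF wf_lower] by blast
  then have "\<forall>\<gamma>\<in>G. \<exists>j. j \<in> {1..N} \<and> spec pt (zeta N \<gamma> j) \<noteq> spec pt (zeta N \<alpha> j)"
    using sep by blast
  then obtain h where h: "\<And>\<gamma>. \<gamma> \<in> G \<Longrightarrow> h \<gamma> \<in> {1..N} \<and> spec pt (zeta N \<gamma> (h \<gamma>)) \<noteq> spec pt (zeta N \<alpha> (h \<gamma>))"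
    using bchoice[of G "\<lambda>\<gamma> j. j \<in> {1..N} \<and> spec pt (zeta N \<gamma> j) \<noteq> spec pt (zeta N \<alpha> j)"] by blast
  obtain gs where gs: "set gs = G" using G(1) finite_list by blast
  define ws where "ws = map (\<lambda>\<gamma>. (h \<gamma>, zeta N \<gamma> (h \<gamma>))) gs"
  have ws: "fst ` set ws \<subseteq> {1..N}" "snd ` set ws \<subseteq> regular pt"
    using h gs by (auto simp: ws_def regular_zeta)
  have "proj N qvar tvar ws (?x - M \<alpha>) = 0"
  proof (rule proj_kills[OF tvar_neq_0 dG _ ws(1)])
    fix p assume "p \<in> M ` G"
    then obtain \<gamma> where \<gamma>: "\<gamma> \<in> G" "p = M \<gamma>" by blast
    then have "(h \<gamma>, zeta N \<gamma> (h \<gamma>)) \<in> set ws" by (auto simp: ws_def gs)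
    then show "\<exists>w. eigen N qvar tvar w p \<and> (\<exists>j. (j, w j) \<in> set ws)"
      using M_eigen[of \<gamma>] G(2) \<gamma> by blast
  qed
  moreover have "proj N qvar tvar ws ?x = proj N qvar tvar ws (?x - M \<alpha>) + proj N qvar tvar ws (M \<alpha>)"
    using proj_add[OF tvar_neq_0, of N qvar ws "?x - M \<alpha>" "M \<alpha>"] by simp
  ultimately have px: "proj N qvar tvar ws ?x = scale (\<Prod>(j, z)\<leftarrow>ws. zeta N \<alpha> j - z) (M \<alpha>)"
    using proj_eigen[OF tvar_neq_0 M_eigen[OF \<alpha>] ws(1)] by simp
  let ?k = "\<Prod>(j, z)\<leftarrow>ws. zeta N \<alpha> j - z"
  have k: "(\<Prod>(j, z)\<leftarrow>map (\<lambda>\<gamma>. (h \<gamma>, zeta N \<gamma> (h \<gamma>))) gs. zeta N \<alpha> j - z) \<in> regular pt \<and>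
     spec pt (\<Prod>(j, z)\<leftarrow>map (\<lambda>\<gamma>. (h \<gamma>, zeta N \<gamma> (h \<gamma>))) gs. zeta N \<alpha> j - z) \<noteq> 0" if "set gs \<subseteq> G" for gs
    using that
  proof (induction gs)
    case (Cons \<gamma> gs)
    have "zeta N \<alpha> (h \<gamma>) - zeta N \<gamma> (h \<gamma>) \<in> regular pt"
      by (intro subring_diff[OF subring_regular] regular_zeta)
    moreover have "spec pt (zeta N \<alpha> (h \<gamma>) - zeta N \<gamma> (h \<gamma>)) \<noteq> 0"
      using h[of \<gamma>] Cons.prems by (auto simp: spec_diff regular_zeta)
    ultimately show ?case using Cons by (simp add: regular_mult spec_mult)
  qed simp
  then have k: "?k \<in> regular pt" "spec pt ?k \<noteq> 0" using gs by (auto simp: ws_def)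
  then have k0: "?k \<noteq> 0" by auto
  have "?x \<in> polys_over (regular pt) {1..N}"
    using \<alpha> by (intro polys_over_single[OF subring_regular] regular_unit pt) (simp add: comps_def)
  then have "proj N qvar tvar ws ?x \<in> polys_over (regular pt) {1..N}"
    using ws pt by (intro proj_closed[OF tvar_neq_0 subring_regular]) (auto simp: regular_inverse_tvar)
  then have "scale (inverse ?k) (proj N qvar tvar ws ?x) \<in> polys_over (regular pt) {1..N}"
    using k by (intro polys_over_scale[OF subring_regular] regular_inverse)
  then show ?thesis unfolding px using k0 by simp
qed

end

end

section \<open>Weights at the singular point\<close>

locale singular_point = staircase +
  fixes m g :: nat and k :: int and u \<omega> :: complex and pt :: "complex \<times> complex"
  assumes m: "m \<ge> 1" and g: "g = gcd m n" and k: "gcd k (int g) = 1"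
    and \<omega>: "\<omega> = exp (2 * of_real pi * \<i> * of_int k / of_nat m)"
    and u: "u \<noteq> 0" "\<forall>j::nat. j \<ge> 1 \<longrightarrow> u ^ j \<noteq> 1"
    and pt: "pt = (\<omega> * u powi (- int (n div g)), u ^ (m div g))"
begin

abbreviation q :: complex where "q \<equiv> fst pt"
abbreviation t :: complex where "t \<equiv> snd pt"

lemma u_powi: "u powi a = 1 \<Longrightarrow> a = 0"
proof (rule ccontr)
  assume a: "u powi a = 1" "a \<noteq> 0"
  then have "u ^ nat \<bar>a\<bar> = 1"
    by (cases "a \<ge> 0") (auto simp: power_int_def power_inverse)
  then show False using u(2)[rule_format, of "nat \<bar>a\<bar>"] a(2) by simp
qed

lemma mg: "m = m div g * g" and ng: "n = n div g * g"
  using g by simp_all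

lemma m_div_g: "m div g > 0"
  using m mg by (metis gr0I less_one mult_0 not_le)

lemma coprime_mn: "coprime (int (m div g)) (int (n div g))"
  unfolding g using m by (simp add: div_gcd_coprime)

lemma \<omega>_cis: "\<omega> = cis (2 * pi * of_int k / of_nat m)"
  unfolding \<omega> cis_conv_exp by (rule arg_cong[where f = exp]) simp

lemma \<omega>_powi: "\<omega> powi a = cis (of_int a * (2 * pi * of_int k / of_nat m))"
  unfolding \<omega>_cis by (rule cis_power_int)

lemma \<omega>_m: "\<omega> powi (r * int m) = 1"
proof -
  have "of_int (r * int m) * (2 * pi * of_int k / of_nat m) = 2 * pi * of_int (r * k)"
    using m by simp
  then show ?thesis unfolding \<omega>_powi by (simp only: cis_multiple_2pi Ints_of_int)
qed

lemma \<omega>_nonzero: "\<omega> \<noteq> 0" by (simp add: \<omega>)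

lemma q_nonzero: "q \<noteq> 0" and t_nonzero: "t \<noteq> 0"
  using u \<omega>_nonzero by (simp_all add: pt)

lemma qt_powi: "q powi a * t powi b = \<omega> powi a * u powi (int (m div g) * b - int (n div g) * a)"
proof -
  have "t = u powi int (m div g)" by (simp add: pt)
  then have "t powi b = u powi (int (m div g) * b)" by (simp add: power_int_mult)
  moreover have "q powi a = \<omega> powi a * u powi (- (int (n div g) * a))"
    by (simp add: pt power_int_mult_distrib flip: power_int_mult)
  moreover have "u powi (int (m div g) * b - int (n div g) * a) = u powi (- (int (n div g) * a)) * u powi (int (m div g) * b)"
    using u by (simp flip: power_int_add)
  ultimately show ?thesis by (simp add: mult.assoc)
qed

text \<open>The \<open>m\<close>-th power removes \<omega>, so the exponent of \<open>u\<close>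
  vanishes and \<open>(a, b)\<close> is \<open>s\<close> times \<open>(m div g, n div g)\<close>.
  Since \<omega> to the power \<open>m div g\<close> is a primitive \<open>g\<close>-th root of
  unity, \<open>g\<close> divides \<open>s\<close>.\<close>

lemma qt_one:
  assumes "q powi a * t powi b = 1"
  obtains r where "a = r * int m" "b = r * int n"
proof -
  define e where "e = int (m div g) * b - int (n div g) * a"
  have one: "\<omega> powi a * u powi e = 1" using assms by (simp add: qt_powi e_def)
  then have "(\<omega> powi a * u powi e) ^ m = 1" by simp
  then have "\<omega> powi (a * int m) * u powi (e * int m) = 1"
    by (simp add: power_mult_distrib power_int_mult)
  then have "u powi (e * int m) = 1" unfolding \<omega>_m by simp
  then have "e * int m = 0" by (rule u_powi)
  then have e: "e = 0" using m by simp
  then have ab: "int (n div g) * a = int (m div g) * b" by (simp add: e_def)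
  then have "int (m div g) dvd int (n div g) * a" by simp
  then have "int (m div g) dvd a" using coprime_mn by (simp add: coprime_dvd_mult_right_iff)
  then obtain s where s: "a = int (m div g) * s" by blast
  then have "int (m div g) * (int (n div g) * s) = int (m div g) * b" using ab by (simp add: mult_ac)
  then have b: "b = int (n div g) * s" using m_div_g by simp
  have "\<omega> powi a = 1" using one e by simp
  then have "Re (cis (of_int a * (2 * pi * of_int k / of_nat m))) = 1"
    unfolding \<omega>_powi by (simp only: one_complex.simps)
  then have "cos (of_int a * (2 * pi * of_int k / of_nat m)) = 1"
    by (simp only: cis.simps)
  then obtain z :: int where "of_int a * (2 * pi * of_int k / of_nat m) = of_int z * 2 * pi"
    using cos_one_2pi_int by blast
  then have "of_int a * of_int k = of_int z * (of_nat m :: real)"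
    using m by (simp add: field_simps)
  then have "a * k = z * int m" by (metis of_int_eq_iff of_int_mult of_int_of_nat_eq)
  moreover have "int m = int (m div g) * int g" using mg by (metis of_nat_mult)
  ultimately have "int (m div g) * (s * k) = int (m div g) * (z * int g)" using s by (simp add: mult_ac)
  then have "s * k = z * int g" using m_div_g by simp
  then have "int g dvd s * k" by simp
  moreover have "coprime (int g) k" using k by (simp add: coprime_iff_gcd_eq_1 gcd.commute)
  ultimately have "int g dvd s" by (simp add: coprime_dvd_mult_left_iff)
  then obtain r where "s = int g * r" by blast
  then have "a = r * (int (m div g) * int g)" "b = r * (int (n div g) * int g)" using s b by (simp_all add: mult_ac)
  then show ?thesis using that[of r] mg ng by (metis of_nat_mult)
qed

lemma qt_period: "q ^ m * t ^ n = 1"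
proof -
  have "q powi int m * t powi int n = \<omega> powi (1 * int m) * u powi (int (m div g) * int n - int (n div g) * int m)"
    by (simp only: qt_powi mult_1)
  also have "int (m div g) * int n - int (n div g) * int m = 0"
  proof -
    have "m div g * n = m div g * (n div g * g)" by (rule arg_cong[OF ng])
    also have "\<dots> = n div g * (m div g * g)" by (simp only: mult_ac)
    also have "\<dots> = n div g * m" by (rule arg_cong[OF mg[symmetric]])
    finally have "m div g * n = n div g * m" .
    then have "int (m div g * n) = int (n div g * m)" by (rule arg_cong)
    then show ?thesis by simp
  qed
  finally show ?thesis unfolding \<omega>_m by simp
qed

lemma t_powi_eq_iff [simp]: "t powi a = t powi b \<longleftrightarrow> a = b"
proof
  assume "t powi a = t powi b"
  then have "q powi 0 * t powi (a - b) = 1" using t_nonzero by (simp add: power_int_diff)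
  then obtain r where "0 = r * int m" "a - b = r * int n" by (rule qt_one)
  then show "a = b" using m by simp
qed simp

lemma t_powi_eq_1 [simp]: "t powi a = 1 \<longleftrightarrow> a = 0"
  using t_powi_eq_iff[of a 0] by (simp del: t_powi_eq_iff)

lemma qt_content: "q ^ (m * l) * t ^ p = t powi c" if "int p = c + int n * int l"
proof -
  have "q ^ (m * l) * t ^ p = (q ^ m) ^ l * t powi (c + int n * int l)"
    unfolding that[symmetric] by (simp add: power_mult)
  also have "t powi (c + int n * int l) = t powi c * (t ^ n) ^ l"
    using t_nonzero by (simp add: power_int_add power_int_mult)
  also have "(q ^ m) ^ l * (t powi c * (t ^ n) ^ l) = (q ^ m * t ^ n) ^ l * t powi c"
    by (simp add: power_mult_distrib)
  finally show ?thesis by (simp add: qt_period)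
qed

lemma level_less: "1 \<le> r \<Longrightarrow> r < r' \<Longrightarrow> level r < level r'"
  using d by (auto simp: level_def)

lemma level_eq_iff: "1 \<le> r \<Longrightarrow> 1 \<le> r' \<Longrightarrow> level r = level r' \<longleftrightarrow> r = r'"
  using level_less[of r r'] level_less[of r' r] by (cases r r' rule: linorder_cases) auto

lemma level_less_iff: "1 \<le> r \<Longrightarrow> 1 \<le> r' \<Longrightarrow> level r < level r' \<longleftrightarrow> r < r'"
  using level_less[of r r'] level_less[of r' r] by (cases r r' rule: linorder_cases) auto

text \<open>The entries decrease along rows and columns, except that the two boxes \<open>(r\<^sub>0, c\<^sub>0)\<close> and
  \<open>(r\<^sub>0 + 1, c\<^sub>0)\<close> may be in the wrong order. As \<open>(0, 0)\<close> is not a box, \<open>r\<^sub>0 = c\<^sub>0 = 0\<close> allows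
  no exception.\<close>

definition filling :: "(nat \<times> nat \<Rightarrow> nat) \<Rightarrow> nat \<Rightarrow> nat \<Rightarrow> bool" where
  "filling F r\<^sub>0 c\<^sub>0 \<longleftrightarrow> bij_betw F boxes {1..total} \<and>
     (\<forall>b\<in>boxes. \<forall>b'\<in>boxes. fst b' \<le> fst b \<longrightarrow> snd b' \<le> snd b \<longrightarrow> b' \<noteq> b \<longrightarrow>
        \<not> (b' = (r\<^sub>0, c\<^sub>0) \<and> b = (r\<^sub>0 + 1, c\<^sub>0)) \<longrightarrow> F b < F b')"

text \<open>For a tableau \<open>S\<close> this characterizes \<alpha>(S); for \<open>S\<close> with
  \<open>i\<close> and \<open>i + 1\<close> exchanged it characterizes \<alpha>(S) s_i.\<close>

definition compatible :: "(nat \<times> nat \<Rightarrow> nat) \<Rightarrow> (nat \<Rightarrow>\<^sub>0 nat) \<Rightarrow> bool" where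
  "compatible F \<alpha> \<longleftrightarrow> \<alpha> \<in> comps total \<and> (\<forall>b\<in>boxes. lookup \<alpha> (F b) = m * level (fst b))"

lemma filling_bij: "filling F r\<^sub>0 c\<^sub>0 \<Longrightarrow> bij_betw F boxes {1..total}"
  by (simp add: filling_def)

lemma filling_less:
  assumes "filling F r\<^sub>0 c\<^sub>0" "(r, c) \<in> boxes" "(r', c') \<in> boxes" "r' \<le> r" "c' \<le> c" "(r', c') \<noteq> (r, c)"
    "\<not> (r' = r\<^sub>0 \<and> c' = c\<^sub>0 \<and> r = r\<^sub>0 + 1 \<and> c = c\<^sub>0)"
  shows "F (r, c) < F (r', c')"
  by (rule assms(1)[unfolded filling_def, THEN conjunct2, rule_format, OF assms(2,3)])
    (use assms(4-) in auto)

lemma sum_len: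
  assumes "2 \<le> r" "r \<le> K + 1"
  shows "int (\<Sum>j\<in>{1..<r}. len j) = start r"
  using assms
proof (induction r rule: dec_induct)
  case base
  have "{1..<2::nat} = {1}" by auto
  then show ?case using len_1 start_2 by simp
next
  case (step r)
  then have "len r = n - 1" by (intro len_mid) auto
  moreover have "{1..<Suc r} = insert r {1..<r}" using step by auto
  ultimately show ?case using step start_Suc[of r] n by (simp add: of_nat_diff)
qed

lemma pos_eq_card:
  assumes "i \<in> {1..N}"
  shows "pos N \<alpha> i = card {j\<in>{1..N}. lookup \<alpha> j < lookup \<alpha> i \<or> lookup \<alpha> j = lookup \<alpha> i \<and> i < j}"
proof -
  have e: "{j\<in>{1..N}. lookup \<alpha> j < lookup \<alpha> i \<or> lookup \<alpha> j = lookup \<alpha> i \<and> i < j}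
     = {1..N} - {j\<in>{1..N}. lookup \<alpha> i < lookup \<alpha> j \<or> lookup \<alpha> j = lookup \<alpha> i \<and> j \<le> i}"
    by auto
  show ?thesis unfolding pos_def comp_rank_eq e by (subst card_Diff_subset) auto
qed

text \<open>Parts increase from row to row, and within a row the entries decrease. The sorting
  behind \<open>pos\<close> therefore lists the boxes row by row from the bottom, each row from left
  to right.\<close>

lemma pos_filling:
  assumes F: "filling F r\<^sub>0 c\<^sub>0" and \<alpha>: "compatible F \<alpha>" and b: "b \<in> boxes"
  shows "int (pos total \<alpha> (F b)) = box_content b + int n * int (level (fst b))"
proof -
  obtain r c where rc: "b = (r, c)" by (metis surj_pair)
  have r: "1 \<le> r" "r \<le> K + 1" "1 \<le> c" "c \<le> len r" using b by (simp_all add: rc boxes_iff)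
  have bij: "bij_betw F boxes {1..total}" using F by (rule filling_bij)
  let ?X = "{b'\<in>boxes. fst b' < r \<or> fst b' = r \<and> snd b' < c}"
  have iff: "lookup \<alpha> (F b') < lookup \<alpha> (F b) \<or> lookup \<alpha> (F b') = lookup \<alpha> (F b) \<and> F b < F b'
     \<longleftrightarrow> fst b' < r \<or> fst b' = r \<and> snd b' < c" if b': "b' \<in> boxes" for b'
  proof -
    obtain r' c' where rc': "b' = (r', c')" by (metis surj_pair)
    have r': "1 \<le> r'" using b' by (simp add: rc' boxes_iff)
    have l: "lookup \<alpha> (F b') < lookup \<alpha> (F b) \<longleftrightarrow> r' < r" "lookup \<alpha> (F b') = lookup \<alpha> (F b) \<longleftrightarrow> r' = r"
      using \<alpha> b b' m r r' level_less_iff[of r' r] level_eq_iff[of r' r] by (auto simp: compatible_def rc rc')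
    have "F b < F b' \<longleftrightarrow> c' < c" if "r' = r"
      using filling_less[OF F, of r c r c'] filling_less[OF F, of r c' r c] b b' that
      by (cases c c' rule: linorder_cases) (auto simp: rc rc')
    then show ?thesis using l by (auto simp: rc')
  qed
  have Fb: "F b \<in> {1..total}" using bij b by (auto simp: bij_betw_def)
  have "{j\<in>{1..total}. lookup \<alpha> j < lookup \<alpha> (F b) \<or> lookup \<alpha> j = lookup \<alpha> (F b) \<and> F b < j}
     = F ` {b'\<in>boxes. lookup \<alpha> (F b') < lookup \<alpha> (F b) \<or> lookup \<alpha> (F b') = lookup \<alpha> (F b) \<and> F b < F b'}"
    using bij by (auto simp: bij_betw_def)
  also have "\<dots> = F ` ?X" using iff by (intro arg_cong[where f = "image F"]) auto
  finally have "pos total \<alpha> (F b) = card (F ` ?X)" using pos_eq_card[OF Fb, of \<alpha>] by simp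
  also have "\<dots> = card ?X" using bij by (intro card_image) (auto simp: bij_betw_def intro: inj_on_subset)
  also have "?X = (SIGMA j:{1..<r}. {1..len j}) \<union> {r} \<times> {1..<c}"
    using r by (auto simp: boxes)
  also have "card \<dots> = (\<Sum>j\<in>{1..<r}. len j) + (c - 1)"
    by (subst card_Un_disjoint) auto
  finally have p: "pos total \<alpha> (F b) = (\<Sum>j\<in>{1..<r}. len j) + (c - 1)" .
  show ?thesis
  proof (cases "r = 1")
    case True
    then show ?thesis using p r by (simp add: rc box_content_def level_def of_nat_diff)
  next
    case False
    then have "2 \<le> r" using r by simp
    then show ?thesis using p r sum_len[of r] start_level[of r] by (simp add: rc box_content_def of_nat_diff)
  qed
qed

lemma weight_filling:
  assumes F: "filling F r\<^sub>0 c\<^sub>0" and \<alpha>: "compatible F \<alpha>" and b: "b \<in> boxes"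
  shows "spec pt (zeta total \<alpha> (F b)) = t powi box_content b"
  using qt_content[OF pos_filling[OF assms]] \<alpha> b
  by (simp add: spec_zeta compatible_def)

text \<open>By \<open>qt_one\<close> a coincidence of weights is a pair of integer equations with
  one multiplier, which is the level of the box. The sorting of \<gamma> supplies
  \<open>v_mono\<close> and \<open>level_ne\<close>, and \<open>level_eq\<close> identifies the
  levels.\<close>

lemma compatible_unique:
  assumes F: "filling F r\<^sub>0 c\<^sub>0" and \<gamma>: "\<gamma> \<in> comps total"
    and w: "\<And>b. b \<in> boxes \<Longrightarrow> spec pt (zeta total \<gamma> (F b)) = t powi box_content b"
  shows "compatible F \<gamma>"
proof -
  have bij: "bij_betw F boxes {1..total}" using F by (rule filling_bij)
  have ran: "F b \<in> {1..total}" if "b \<in> boxes" for b using bij that by (auto simp: bij_betw_def)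
  define \<kappa> where "\<kappa> b = lookup \<gamma> (F b) div m" for b
  define v where "v b = box_content b + int n * int (\<kappa> b)" for b
  have *: "lookup \<gamma> (F b) = m * \<kappa> b \<and> int (pos total \<gamma> (F b)) = v b" if b: "b \<in> boxes" for b
  proof -
    let ?a = "lookup \<gamma> (F b)" and ?p = "pos total \<gamma> (F b)"
    have "q ^ ?a * t ^ ?p = t powi box_content b"
      using w[OF b] by (simp add: spec_zeta)
    then have "q powi int ?a * t powi (int ?p - box_content b) = 1"
      using t_nonzero by (simp add: power_int_diff)
    then obtain r where r: "int ?a = r * int m" "int ?p - box_content b = r * int n" by (rule qt_one)
    then have "0 \<le> r * int m" by (metis of_nat_0_le_iff)
    then have "0 \<le> r" using m by (simp add: zero_le_mult_iff)
    then obtain r' where r': "r = int r'" by (metis nonneg_int_cases)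
    then have "?a = r' * m" using r(1) by (metis of_nat_eq_iff of_nat_mult)
    then show ?thesis using r(2) r' m by (simp add: \<kappa>_def v_def mult.commute)
  qed
  have "level_function d K n \<nu> \<kappa> r\<^sub>0 c\<^sub>0 v"
  proof
    show "v b = box_content b + int n * int (\<kappa> b)" for b by (fact v_def)
    have "bij_betw (int \<circ> (pos total \<gamma> \<circ> F)) boxes {0..<int total}"
    proof (rule bij_betw_trans)
      show "bij_betw (pos total \<gamma> \<circ> F) boxes {0..<total}"
        by (rule bij_betw_trans[OF bij pos_bij])
      show "bij_betw int {0..<total} {0..<int total}"
        by (auto simp: bij_betw_def image_int_atLeastLessThan)
    qed
    then show "bij_betw v boxes {0..<int total}"
      by (rule bij_betw_cong[THEN iffD1, rotated]) (use * in simp)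
  next
    fix b b' assume b: "b \<in> boxes" "b' \<in> boxes" "\<kappa> b < \<kappa> b'"
    then have "lookup \<gamma> (F b) < lookup \<gamma> (F b')" using * m by simp
    then have "pos total \<gamma> (F b) < pos total \<gamma> (F b')" using ran b by (intro pos_less) auto
    then show "v b < v b'" using * b by (metis of_nat_less_iff)
  next
    fix r c r' c'
    assume b: "(r, c) \<in> boxes" "(r', c') \<in> boxes" and le: "r' < r" "c' \<le> c"
      and lt: "box_content (r, c) < box_content (r', c')" and eq: "\<kappa> (r, c) = \<kappa> (r', c')"
    show "r' = r\<^sub>0 \<and> c' = c\<^sub>0 \<and> r = r\<^sub>0 + 1 \<and> c = c\<^sub>0"
    proof (rule ccontr)
      assume "\<not> ?thesis"
      \<comment> \<open>Among equal parts the smaller entry has the larger position, while at equal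
        levels positions are ordered like contents.\<close>
      then have "F (r, c) < F (r', c')" using filling_less[OF F b] le by auto
      moreover have "lookup \<gamma> (F (r', c')) = lookup \<gamma> (F (r, c))" using * b eq by simp
      ultimately have "pos total \<gamma> (F (r', c')) < pos total \<gamma> (F (r, c))"
        using ran b by (intro pos_less) auto
      then have "v (r', c') < v (r, c)" using * b by (metis of_nat_less_iff)
      then show False using lt eq by (simp add: v_def)
    qed
  qed
  then interpret level_function d K n \<nu> \<kappa> r\<^sub>0 c\<^sub>0 v .
  show ?thesis unfolding compatible_def using \<gamma> * level_eq by auto
qed

lemma compatible_eq:
  assumes "filling F r\<^sub>0 c\<^sub>0" "compatible F \<alpha>" "compatible F \<gamma>"
  shows "\<alpha> = \<gamma>"
proof (rule poly_mapping_eqI)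
  fix j
  show "lookup \<alpha> j = lookup \<gamma> j"
  proof (cases "j \<in> {1..total}")
    case True
    then obtain b where "b \<in> boxes" "j = F b"
      using bij_betw_imp_surj_on[OF filling_bij[OF assms(1)]] by blast
    then show ?thesis using assms by (simp add: compatible_def)
  next
    case False
    then have "j \<notin> keys \<alpha>" "j \<notin> keys \<gamma>" using assms by (auto simp: compatible_def comps_def)
    then show ?thesis by (simp add: in_keys_iff)
  qed
qed

lemma regular_M_filling:
  assumes fam: "macdonald_family total M" and F: "filling F r\<^sub>0 c\<^sub>0" and \<alpha>: "compatible F \<alpha>"
  shows "M \<alpha> \<in> polys_over (regular pt) {1..total}"
proof (rule regular_M[OF fam q_nonzero t_nonzero])
  show "\<alpha> \<in> comps total" using \<alpha> by (simp add: compatible_def)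
  fix \<gamma> assume \<gamma>: "\<gamma> \<in> comps total" "\<gamma> \<noteq> \<alpha>"
  show "\<exists>j\<in>{1..total}. spec pt (zeta total \<gamma> j) \<noteq> spec pt (zeta total \<alpha> j)"
  proof (rule ccontr)
    assume n: "\<not> ?thesis"
    have "spec pt (zeta total \<gamma> (F b)) = t powi box_content b" if b: "b \<in> boxes" for b
    proof -
      have "F b \<in> {1..total}" using filling_bij[OF F] b by (auto simp: bij_betw_def)
      then show ?thesis using n weight_filling[OF F \<alpha> b] by auto
    qed
    then have "compatible F \<gamma>" using compatible_unique[OF F \<gamma>(1)] by blast
    then show False using compatible_eq[OF F \<alpha>] \<gamma>(2) by blast
  qed
qed

end

section \<open>Tableaux\<close>

lemma dunkl_zero:
  assumes t: "t \<noteq> 0" and V: "\<And>i f. i \<in> {1..<N} \<Longrightarrow> f \<in> V \<Longrightarrow> hecke t i f \<in> V"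
    and fix_N: "\<And>f. f \<in> V \<Longrightarrow> cherednik N q t N f = f" and i: "i \<in> {1..N}" and f: "f \<in> V"
  shows "dunkl N q t i f = 0"
  using i f
proof (induction "N - i" arbitrary: i f)
  case 0
  have "Var N \<noteq> (0 :: 'a mpoly)"
    by (metis Var_def keys_single keys_zero insert_not_empty zero_neq_one)
  then have "exact_quot 0 (Var N) = (0 :: 'a mpoly)" by (rule exact_quot_eqI) simp
  then show ?case using 0 fix_N[of f] by (subst dunkl.simps) simp
next
  case (Suc k)
  then have "i \<in> {1..<N}" by auto
  then have "hecke t i f \<in> V" using V Suc.prems by blast
  then have "dunkl N q t (i + 1) (hecke t i f) = 0" using Suc by (intro Suc.hyps(1)) auto
  then show ?case using \<open>i \<in> {1..<N}\<close> by (simp add: dunkl.simps[of N q t i f])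
qed

lemma lookup_swap_comp: "lookup (swap_comp i \<alpha>) j = lookup \<alpha> (Transposition.transpose i (i + 1) j)"
  by (simp add: swap_comp_def map_key.rep_eq)

lemma swap_comp_swap_comp: "swap_comp i (swap_comp i \<alpha>) = \<alpha>"
  by (rule poly_mapping_eqI) (simp add: lookup_swap_comp)

lemma swap_comp_comps:
  assumes "\<alpha> \<in> comps N" "1 \<le> i" "i < N"
  shows "swap_comp i \<alpha> \<in> comps N"
  unfolding comps_def
proof safe
  fix j assume j: "j \<in> keys (swap_comp i \<alpha>)"
  then have "Transposition.transpose i (i + 1) j \<in> keys \<alpha>" by (simp add: in_keys_iff lookup_swap_comp)
  then have "Transposition.transpose i (i + 1) j \<in> {1..N}" using assms(1) by (auto simp: comps_def)
  then show "j \<in> {1..N}" using assms by (auto simp: Transposition.transpose_def split: if_splits)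
qed

lemma transpose_less:
  "a < b \<Longrightarrow> \<not> (a = i \<and> b = i + 1) \<Longrightarrow> Transposition.transpose i (i + 1) a < Transposition.transpose i (i + 1) (b :: nat)"
  by (auto simp: Transposition.transpose_def)

section \<open>The shape, its tableaux and their exchanges\<close>

context singular_point
begin

definition shape :: "nat list" where
  "shape = (d * n - 1) # replicate (K - 1) (n - 1) @ [\<nu>]"

lemma length_shape: "length shape = K + 1"
  using K by (simp add: shape_def)

lemma shape_nth:
  assumes "1 \<le> r" "r \<le> K + 1"
  shows "shape ! (r - 1) = len r"
proof -
  consider "r = 1" | "r = K + 1" | "2 \<le> r" "r \<le> K" using assms by linarith
  then show ?thesis
  proof cases
    case 1
    then show ?thesis by (simp add: shape_def len)
  next
    case 2
    then show ?thesis using K by (simp add: shape_def len nth_Cons' nth_append)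
  next
    case 3
    then show ?thesis by (simp add: shape_def len nth_Cons' nth_append)
  qed
qed

lemma diagram_shape: "diagram shape = boxes"
  using shape_nth by (auto simp: diagram_def boxes length_shape)

lemma sum_shape: "sum_list shape = total"
  by (simp add: shape_def total_def sum_list_replicate)

definition box :: "(nat \<times> nat \<Rightarrow> nat) \<Rightarrow> nat \<Rightarrow> nat \<times> nat" where
  "box S i = inv_into boxes S i"

lemma row_eq: "row shape S i = fst (box S i)" and col_eq: "col shape S i = snd (box S i)"
  by (simp_all add: row_def col_def box_def diagram_shape)

lemma content_diff_eq: "content_diff shape S i = box_content (box S i) - box_content (box S (i + 1))"
  by (simp add: content_diff_def ctab_def row_eq col_eq box_content_def)

lemma box_S: "bij_betw S boxes {1..total} \<Longrightarrow> b \<in> boxes \<Longrightarrow> box S (S b) = b"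
  by (simp add: box_def bij_betw_inv_into_left)

lemma S_box: "bij_betw S boxes {1..total} \<Longrightarrow> i \<in> {1..total} \<Longrightarrow> S (box S i) = i"
  by (simp add: box_def bij_betw_inv_into_right)

lemma box_in: "bij_betw S boxes {1..total} \<Longrightarrow> i \<in> {1..total} \<Longrightarrow> box S i \<in> boxes"
  unfolding box_def by (metis bij_betw_imp_surj_on inv_into_into)

lemma lookup_tableau_comp:
  assumes "bij_betw S boxes {1..total}"
  shows "lookup (tableau_comp d m shape S) i = (if i \<in> {1..total} then m * level (fst (box S i)) else 0)"
proof -
  have "lookup (tableau_comp d m shape S) i
      = (\<Sum>j\<in>{1..total}. if j = i then (if fst (box S j) > 1 then (d + fst (box S j) - 2) * m else 0) else 0)"
    unfolding tableau_comp_def lookup_sum sum_shape row_eq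
    by (intro sum.cong refl) (simp add: lookup_single when_def)
  also have "\<dots> = (if i \<in> {1..total} then (if fst (box S i) > 1 then (d + fst (box S i) - 2) * m else 0) else 0)"
    by (subst sum.delta) auto
  also have "\<dots> = (if i \<in> {1..total} then m * level (fst (box S i)) else 0)"
  proof (cases "i \<in> {1..total}")
    case True
    then have "1 \<le> fst (box S i)" using box_in[OF assms True] by (cases "box S i") (simp add: boxes_iff)
    then show ?thesis by (auto simp: level_def)
  next
    case False
    then show ?thesis by (simp only: if_False)
  qed
  finally show ?thesis .
qed

lemma tableau_comp_compatible:
  assumes "bij_betw S boxes {1..total}"
  shows "compatible S (tableau_comp d m shape S)"
  unfolding compatible_def
proof
  show "tableau_comp d m shape S \<in> comps total"
    by (auto simp: comps_def in_keys_iff lookup_tableau_comp[OF assms] split: if_splits)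
  show "\<forall>b\<in>boxes. lookup (tableau_comp d m shape S) (S b) = m * level (fst b)"
  proof
    fix b assume b: "b \<in> boxes"
    then have "S b \<in> {1..total}" by (rule bij_betw_apply[OF assms])
    then show "lookup (tableau_comp d m shape S) (S b) = m * level (fst b)"
      by (simp only: lookup_tableau_comp[OF assms] box_S[OF assms b] if_True)
  qed
qed

lemma Tab_iff:
  "S \<in> Tab shape \<longleftrightarrow> S \<in> extensional boxes \<and> bij_betw S boxes {1..total} \<and>
     (\<forall>r c. (r, c) \<in> boxes \<longrightarrow> (r, c + 1) \<in> boxes \<longrightarrow> S (r, c + 1) < S (r, c)) \<and>
     (\<forall>r c. (r, c) \<in> boxes \<longrightarrow> (r + 1, c) \<in> boxes \<longrightarrow> S (r + 1, c) < S (r, c))"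
  by (auto simp: Tab_def diagram_shape sum_shape)

lemma Tab_bij: "S \<in> Tab shape \<Longrightarrow> bij_betw S boxes {1..total}"
  by (simp add: Tab_iff)

lemma boxes_down:
  assumes "(r, c) \<in> boxes" "1 \<le> r'" "r' \<le> r" "1 \<le> c'" "c' \<le> c"
  shows "(r', c') \<in> boxes"
proof -
  have "len s \<le> len r'" if "r' \<le> s" "s \<le> K + 1" for s
    using that
  proof (induction s rule: dec_induct)
    case (step s)
    then show ?case using len_anti[of s] assms by simp
  qed simp
  from this[of r] have "len r \<le> len r'" using assms by (simp add: boxes_iff)
  then show ?thesis using assms by (simp add: boxes_iff)
qed

text \<open>Go left along row \<open>r\<close> to \<open>(r, c')\<close>, then down column
  \<open>c'\<close>; the entry grows by at least 1 at each step.\<close>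

lemma Tab_less:
  assumes S: "S \<in> Tab shape" and b: "(r, c) \<in> boxes" "(r', c') \<in> boxes" "r' \<le> r" "c' \<le> c" "(r', c') \<noteq> (r, c)"
  shows "S (r, c) < S (r', c')"
proof -
  have r: "S (r, c) + (c - y) \<le> S (r, y)" if "1 \<le> y" "y \<le> c" for y
    using that(2,1)
  proof (induction y rule: inc_induct)
    case (step y)
    have "(r, y) \<in> boxes" "(r, y + 1) \<in> boxes" using boxes_down[OF b(1)] b(1) step by (auto simp: boxes_iff)
    then have "S (r, y + 1) < S (r, y)" using S by (simp add: Tab_iff)
    then show ?case using step by simp
  qed simp
  have c: "S (r, c') + (r - x) \<le> S (x, c')" if "1 \<le> x" "x \<le> r" for x
    using that(2,1)
  proof (induction x rule: inc_induct)
    case (step x)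
    have "(x, c') \<in> boxes" "(x + 1, c') \<in> boxes" using boxes_down[OF b(1)] b step by (auto simp: boxes_iff)
    then have "S (x + 1, c') < S (x, c')" using S by (simp add: Tab_iff)
    then show ?case using step by simp
  qed simp
  have "1 \<le> r'" "1 \<le> c'" using b by (auto simp: boxes_iff)
  then have "S (r, c) + (c - c') + (r - r') \<le> S (r', c')" using r[of c'] c[of r'] b by simp
  moreover have "r' < r \<or> c' < c" using b by auto
  ultimately show ?thesis using b by linarith
qed

lemma Tab_filling:
  assumes "S \<in> Tab shape"
  shows "filling S 0 0"
  unfolding filling_def
proof (intro conjI ballI impI)
  show "bij_betw S boxes {1..total}" by (rule Tab_bij[OF assms])
  fix b b' assume "b \<in> boxes" "b' \<in> boxes" "fst b' \<le> fst b" "snd b' \<le> snd b" "b' \<noteq> b"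
  then show "S b < S b'" using Tab_less[OF assms, of "fst b" "snd b" "fst b'" "snd b'"] by simp
qed

text \<open>When the box of \<open>i\<close> lies weakly above and to the right of that of
  \<open>i + 1\<close>, any third box of the rectangle they span would hold an entry strictly
  between \<open>i\<close> and \<open>i + 1\<close>.\<close>

lemma adjacent_cases:
  assumes S: "S \<in> Tab shape" and i: "i \<in> {1..<total}"
    and b: "box S i = (r, c)" "box S (i + 1) = (r', c')"
  shows "r = r' \<and> c = c' + 1 \<or> c = c' \<and> r = r' + 1 \<or> r < r' \<and> c' < c \<or> r' < r \<and> c < c'"
proof -
  have bij: "bij_betw S boxes {1..total}" using S by (rule Tab_bij)
  have box: "(r, c) \<in> boxes" "(r', c') \<in> boxes" "S (r, c) = i" "S (r', c') = i + 1"
    using box_in[OF bij, of i] box_in[OF bij, of "i + 1"] S_box[OF bij, of i] S_box[OF bij, of "i + 1"] i b by auto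
  have ne: "(r, c) \<noteq> (r', c')" using box by auto
  have no: False if "(x, y) \<in> boxes" "r' \<le> x" "x \<le> r" "c' \<le> y" "y \<le> c" "(x, y) \<noteq> (r, c)" "(x, y) \<noteq> (r', c')" for x y
    using Tab_less[OF S box(1), of x y] Tab_less[OF S that(1) box(2)] that box by auto
  have pos: "1 \<le> r'" "1 \<le> c'" using box by (auto simp: boxes_iff)
  have "\<not> (r \<le> r' \<and> c \<le> c')" using Tab_less[OF S box(2,1)] ne box(3,4) by auto
  then consider "r' < r" "c < c'" | "r < r'" "c' < c" | "r' \<le> r" "c' \<le> c" by linarith
  then show ?thesis
  proof cases
    case 3
    have d: "(x, y) \<in> boxes" if "r' \<le> x" "x \<le> r" "c' \<le> y" "y \<le> c" for x y
      using boxes_down[OF box(1), of x y] that pos by simp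
    have "\<not> (r' < r \<and> c' < c)" using no[of r' c] d[of r' c] 3 by auto
    moreover have "\<not> (r = r' \<and> c' + 1 < c)" using no[of r "c' + 1"] d[of r "c' + 1"] 3 by auto
    moreover have "\<not> (c = c' \<and> r' + 1 < r)" using no[of "r' + 1" c] d[of "r' + 1" c] 3 by auto
    ultimately show ?thesis using 3 ne by auto
  qed auto
qed

lemma swap_entries_eq: "b \<in> boxes \<Longrightarrow> swap_entries shape i S b = Transposition.transpose i (i + 1) (S b)"
  by (simp add: swap_entries_def diagram_shape)

lemma swap_entries_bij:
  assumes "bij_betw S boxes {1..total}" "i \<in> {1..<total}"
  shows "bij_betw (swap_entries shape i S) boxes {1..total}"
proof -
  have "bij_betw (Transposition.transpose i (i + 1)) {1..total} {1..total}"
    by (rule bij_betwI[where g = "Transposition.transpose i (i + 1)"])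
      (use assms(2) in \<open>auto simp: Transposition.transpose_def\<close>)
  then have "bij_betw (Transposition.transpose i (i + 1) \<circ> S) boxes {1..total}"
    by (rule bij_betw_trans[OF assms(1)])
  then show ?thesis
    by (rule bij_betw_cong[THEN iffD1, rotated]) (simp add: swap_entries_eq)
qed

lemma box_swap_entries:
  assumes S: "bij_betw S boxes {1..total}" and i: "i \<in> {1..<total}" and j: "j \<in> {1..total}"
  shows "box (swap_entries shape i S) j = box S (Transposition.transpose i (i + 1) j)"
proof -
  let ?j = "Transposition.transpose i (i + 1) j"
  have j': "?j \<in> {1..total}" using i j by (auto simp: Transposition.transpose_def)
  have "swap_entries shape i S (box S ?j) = j"
    using swap_entries_eq[OF box_in[OF S j']] S_box[OF S j'] by simp
  then show ?thesis using box_S[OF swap_entries_bij[OF S i] box_in[OF S j']] by simp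
qed

lemma swap_entries_swap_entries:
  assumes "S \<in> Tab shape"
  shows "swap_entries shape i (swap_entries shape i S) = S"
proof (rule extensionalityI[of _ boxes])
  show "swap_entries shape i (swap_entries shape i S) \<in> extensional boxes"
    unfolding swap_entries_def diagram_shape by simp
  show "S \<in> extensional boxes" using assms by (simp add: Tab_iff)
  show "swap_entries shape i (swap_entries shape i S) b = S b" if "b \<in> boxes" for b
    using that by (simp add: swap_entries_eq)
qed

lemma swap_entries_less:
  assumes S: "S \<in> Tab shape" and b: "(r, c) \<in> boxes" "(r', c') \<in> boxes" "r' \<le> r" "c' \<le> c" "(r', c') \<noteq> (r, c)"
    and ne: "\<not> ((r, c) = box S i \<and> (r', c') = box S (i + 1))"
  shows "swap_entries shape i S (r, c) < swap_entries shape i S (r', c')"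
proof -
  have "\<not> (S (r, c) = i \<and> S (r', c') = i + 1)" using box_S[OF Tab_bij[OF S] b(1)] box_S[OF Tab_bij[OF S] b(2)] ne by auto
  then show ?thesis
    using transpose_less[OF Tab_less[OF S b]] swap_entries_eq b by simp
qed

lemma swap_entries_Tab:
  assumes S: "S \<in> Tab shape" and i: "i \<in> {1..<total}"
    and ne: "fst (box S i) \<noteq> fst (box S (i + 1))" "snd (box S i) \<noteq> snd (box S (i + 1))"
  shows "swap_entries shape i S \<in> Tab shape"
  unfolding Tab_iff
proof (intro conjI allI impI)
  show "swap_entries shape i S \<in> extensional boxes" unfolding swap_entries_def diagram_shape by simp
  show "bij_betw (swap_entries shape i S) boxes {1..total}" by (rule swap_entries_bij[OF Tab_bij[OF S] i])
  show "swap_entries shape i S (r, c + 1) < swap_entries shape i S (r, c)" if "(r, c) \<in> boxes" "(r, c + 1) \<in> boxes" for r c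
  proof (rule swap_entries_less[OF S that(2,1)])
    show "\<not> ((r, c + 1) = box S i \<and> (r, c) = box S (i + 1))" using ne(1) by (metis fst_conv)
  qed auto
  show "swap_entries shape i S (r + 1, c) < swap_entries shape i S (r, c)" if "(r, c) \<in> boxes" "(r + 1, c) \<in> boxes" for r c
  proof (rule swap_entries_less[OF S that(2,1)])
    show "\<not> ((r + 1, c) = box S i \<and> (r, c) = box S (i + 1))" using ne(2) by (metis snd_conv)
  qed auto
qed

lemma swap_entries_filling:
  assumes S: "S \<in> Tab shape" and i: "i \<in> {1..<total}"
    and b: "box S i = (r + 1, c)" "box S (i + 1) = (r, c)"
  shows "filling (swap_entries shape i S) r c"
  unfolding filling_def
proof (intro conjI ballI impI)
  show "bij_betw (swap_entries shape i S) boxes {1..total}" by (rule swap_entries_bij[OF Tab_bij[OF S] i])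
  fix x y assume "x \<in> boxes" "y \<in> boxes" "fst y \<le> fst x" "snd y \<le> snd x" "y \<noteq> x" "\<not> (y = (r, c) \<and> x = (r + 1, c))"
  then show "swap_entries shape i S x < swap_entries shape i S y"
    using swap_entries_less[OF S, of "fst x" "snd x" "fst y" "snd y" i] b by auto
qed

lemma compatible_swap:
  assumes S: "bij_betw S boxes {1..total}" and i: "i \<in> {1..<total}" and \<alpha>: "compatible S \<alpha>"
  shows "compatible (swap_entries shape i S) (swap_comp i \<alpha>)"
  using \<alpha> i swap_comp_comps[of \<alpha> total i]
  by (simp add: compatible_def swap_entries_eq lookup_swap_comp)

lemma tableau_comp_swap:
  assumes "swap_entries shape i S \<in> Tab shape" "S \<in> Tab shape" "i \<in> {1..<total}"
  shows "tableau_comp d m shape (swap_entries shape i S) = swap_comp i (tableau_comp d m shape S)"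
  using compatible_eq[OF Tab_filling[OF assms(1)] tableau_comp_compatible[OF Tab_bij[OF assms(1)]]
      compatible_swap[OF Tab_bij[OF assms(2)] assms(3) tableau_comp_compatible[OF Tab_bij[OF assms(2)]]]] .

section \<open>Specialized Macdonald polynomials of tableaux\<close>

context
  fixes M :: "(nat \<Rightarrow>\<^sub>0 nat) \<Rightarrow> ratfun mpoly"
  assumes fam: "macdonald_family total M"
begin

lemma spec_M_eigen:
  assumes F: "filling F r\<^sub>0 c\<^sub>0" and \<alpha>: "compatible F \<alpha>"
  shows "eigen total q t (\<lambda>i. t powi box_content (box F i)) (spec_poly pt (M \<alpha>))"
  unfolding eigen_def
proof
  fix i assume i: "i \<in> {1..total}"
  have bij: "bij_betw F boxes {1..total}" by (rule filling_bij[OF F])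
  have R: "M \<alpha> \<in> regular_polys pt" using regular_M_filling[OF fam F \<alpha>] by (rule polys_over_mono')
  have "cherednik total qvar tvar i (M \<alpha>) = scale (zeta total \<alpha> i) (M \<alpha>)"
    using M_eigen[OF fam, of \<alpha>] \<alpha> i by (simp add: compatible_def eigen_def)
  then have "cherednik total q t i (spec_poly pt (M \<alpha>)) = scale (spec pt (zeta total \<alpha> i)) (spec_poly pt (M \<alpha>))"
    using spec_poly_cherednik[OF t_nonzero R, of total i] by (simp add: spec_poly_scale regular_zeta R)
  moreover have "spec pt (zeta total \<alpha> i) = t powi box_content (box F i)"
    using weight_filling[OF F \<alpha> box_in[OF bij i]] S_box[OF bij i] by simp
  ultimately show "cherednik total q t i (spec_poly pt (M \<alpha>)) = scale (t powi box_content (box F i)) (spec_poly pt (M \<alpha>))"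
    by simp
qed

text \<open>The normalization survives at \<open>pt\<close>: there \<rho> becomes \<open>t\<close>
  to a nonzero difference of contents, hence is not 1, and the coefficient has no pole.\<close>

lemma spec_M_swap:
  assumes F: "filling F r\<^sub>0 c\<^sub>0" and \<alpha>: "compatible F \<alpha>" and i: "i \<in> {1..<total}"
    and less: "fst (box F i) < fst (box F (i + 1))"
    and ne: "box_content (box F i) \<noteq> box_content (box F (i + 1))"
  shows "spec_poly pt (M (swap_comp i \<alpha>)) = hecke t i (spec_poly pt (M \<alpha>))
    + scale ((1 - t) / (1 - t powi (box_content (box F (i + 1)) - box_content (box F i)))) (spec_poly pt (M \<alpha>))"
proof -
  have bij: "bij_betw F boxes {1..total}" by (rule filling_bij[OF F])
  have i': "i \<in> {1..total}" "i + 1 \<in> {1..total}" using i by auto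
  have R: "M \<alpha> \<in> regular_polys pt" using regular_M_filling[OF fam F \<alpha>] by (rule polys_over_mono')
  have z: "spec pt (zeta total \<alpha> j) = t powi box_content (box F j)" if "j \<in> {1..total}" for j
    using weight_filling[OF F \<alpha> box_in[OF bij that]] S_box[OF bij that] by simp
  have l: "lookup \<alpha> j = m * level (fst (box F j))" if "j \<in> {1..total}" for j
    using \<alpha> box_in[OF bij that] S_box[OF bij that] unfolding compatible_def by metis
  have "1 \<le> fst (box F i)" using box_in[OF bij i'(1)] by (cases "box F i") (simp add: boxes_iff)
  then have "lookup \<alpha> i < lookup \<alpha> (i + 1)" unfolding l[OF i'(1)] l[OF i'(2)] using level_less less m by simp
  then have e: "M (swap_comp i \<alpha>) = hecke tvar i (M \<alpha>) + scale ((1 - tvar) / (1 - zeta total \<alpha> (i + 1) / zeta total \<alpha> i)) (M \<alpha>)"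
    using M_swap[OF fam, of \<alpha> i] \<alpha> i by (simp add: compatible_def)
  define \<rho> where "\<rho> = zeta total \<alpha> (i + 1) / zeta total \<alpha> i"
  have \<rho>: "\<rho> \<in> regular pt" "spec pt \<rho> = t powi (box_content (box F (i + 1)) - box_content (box F i))"
    unfolding \<rho>_def using z[OF i'(1)] z[OF i'(2)] t_nonzero
    by (simp_all add: regular_divide regular_zeta power_int_diff)
  have r: "1 - \<rho> \<in> regular pt" "1 - tvar \<in> regular pt" using \<rho> by (simp_all add: subring_diff[OF subring_regular])
  have s: "spec pt (1 - \<rho>) = 1 - t powi (box_content (box F (i + 1)) - box_content (box F i))" "spec pt (1 - tvar) = 1 - t"
    using \<rho> by (simp_all add: spec_diff)
  have nz: "spec pt (1 - \<rho>) \<noteq> 0" unfolding s using ne by simp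
  have c: "(1 - tvar) / (1 - \<rho>) \<in> regular pt"
    "spec pt ((1 - tvar) / (1 - \<rho>)) = (1 - t) / (1 - t powi (box_content (box F (i + 1)) - box_content (box F i)))"
    using regular_divide[OF r(2,1) nz] s by simp_all
  show ?thesis unfolding e \<rho>_def[symmetric]
    using R c by (simp add: spec_poly_add spec_poly_scale spec_poly_hecke regular_hecke polys_over_scale[OF subring_regular])
qed

definition P :: "(nat \<times> nat \<Rightarrow> nat) \<Rightarrow> complex mpoly" where
  "P S = spec_poly pt (M (tableau_comp d m shape S))"

lemma P_regular: "S \<in> Tab shape \<Longrightarrow> M (tableau_comp d m shape S) \<in> polys_over (regular pt) {1..total}"
  using regular_M_filling[OF fam Tab_filling tableau_comp_compatible[OF Tab_bij]] .

lemma P_eigen: "S \<in> Tab shape \<Longrightarrow> eigen total q t (\<lambda>i. t powi box_content (box S i)) (P S)"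
  unfolding P_def using spec_M_eigen[OF Tab_filling tableau_comp_compatible[OF Tab_bij]] .

lemma P_row:
  assumes S: "S \<in> Tab shape" and i: "i \<in> {1..<total}" and eq: "fst (box S i) = fst (box S (i + 1))"
  shows "hecke t i (P S) = scale t (P S)"
proof -
  let ?\<alpha> = "tableau_comp d m shape S"
  have bij: "bij_betw S boxes {1..total}" by (rule Tab_bij[OF S])
  have R: "M ?\<alpha> \<in> regular_polys pt" using P_regular[OF S] by (rule polys_over_mono')
  have "lookup ?\<alpha> i = lookup ?\<alpha> (i + 1)" using i eq by (simp add: lookup_tableau_comp[OF bij])
  then have "hecke tvar i (M ?\<alpha>) = scale tvar (M ?\<alpha>)"
    using M_hecke_equal[OF fam, of ?\<alpha> i] tableau_comp_compatible[OF bij] i by (simp add: compatible_def)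
  then have "spec_poly pt (hecke tvar i (M ?\<alpha>)) = spec_poly pt (scale tvar (M ?\<alpha>))" by simp
  then show ?thesis using R by (simp add: P_def spec_poly_hecke spec_poly_scale)
qed

text \<open>The polynomial labelled by the filling with \<open>i\<close> and \<open>i + 1\<close> exchanged has no pole at \<open>pt\<close> either,
  so that \<open>P S\<close> lies in the image of \<open>T\<^sub>i - t\<close>.\<close>

lemma P_col:
  assumes S: "S \<in> Tab shape" and i: "i \<in> {1..<total}" and eq: "snd (box S i) = snd (box S (i + 1))"
  shows "hecke t i (P S) = - P S"
proof -
  let ?\<alpha> = "tableau_comp d m shape S" and ?F = "swap_entries shape i S"
  have bij: "bij_betw S boxes {1..total}" by (rule Tab_bij[OF S])
  obtain r c r' c' where b: "box S i = (r', c')" "box S (i + 1) = (r, c)" by (metis surj_pair)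
  then have b: "box S i = (r + 1, c)" "box S (i + 1) = (r, c)"
    using adjacent_cases[OF S i b] eq by auto
  define Q where "Q = spec_poly pt (M (swap_comp i ?\<alpha>))"
  have F: "filling ?F r c" by (rule swap_entries_filling[OF S i b])
  have cF: "compatible ?F (swap_comp i ?\<alpha>)" by (rule compatible_swap[OF bij i tableau_comp_compatible[OF bij]])
  have bF: "box ?F i = (r, c)" "box ?F (i + 1) = (r + 1, c)"
    using box_swap_entries[OF bij i, of i] box_swap_entries[OF bij i, of "i + 1"] i b by auto
  \<comment> \<open>In \<open>?F\<close> the entry \<open>i + 1\<close> lies directly above
    \<open>i\<close>, so its content is smaller by 1 and \<rho> specializes to 1/t.\<close>
  have "spec_poly pt (M (swap_comp i (swap_comp i ?\<alpha>))) = hecke t i Q + scale ((1 - t) / (1 - t powi (- 1))) Q"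
    using spec_M_swap[OF F cF i] bF by (simp add: Q_def box_content_def)
  moreover have "(1 - t) / (1 - t powi (- 1)) = - t"
  proof -
    have "t \<noteq> 1" using t_powi_eq_1[of 1] by simp
    then show ?thesis using t_nonzero by (simp add: power_int_minus field_simps)
  qed
  ultimately have "P S = hecke t i Q - scale t Q" by (simp add: P_def swap_comp_swap_comp)
  then show ?thesis
    by (simp add: hecke_diff hecke_scale hecke_quadratic mpoly.scale_left_diff_distrib)
qed

lemma P_up:
  assumes S: "S \<in> Tab shape" and i: "i \<in> {1..<total}"
    and lt: "fst (box S i) < fst (box S (i + 1))" "snd (box S (i + 1)) < snd (box S i)"
  shows "swap_entries shape i S \<in> Tab shape"
    and "hecke t i (P S) = P (swap_entries shape i S) + scale ((t - 1) / (1 - t powi (- content_diff shape S i))) (P S)"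
proof -
  show S': "swap_entries shape i S \<in> Tab shape" using lt by (intro swap_entries_Tab[OF S i]) auto
  let ?x = "1 - t powi (- content_diff shape S i)"
  have "P (swap_entries shape i S) = hecke t i (P S) + scale ((1 - t) / ?x) (P S)"
    using spec_M_swap[OF Tab_filling[OF S] tableau_comp_compatible[OF Tab_bij[OF S]] i lt(1)] lt
    by (simp add: P_def tableau_comp_swap[OF S' S i] content_diff_eq box_content_def)
  moreover have "(t - 1) / ?x = - ((1 - t) / ?x)" by (metis minus_diff_eq minus_divide_left)
  ultimately show "hecke t i (P S) = P (swap_entries shape i S) + scale ((t - 1) / ?x) (P S)"
    by simp
qed

text \<open>The exchanged tableau \<open>S'\<close> falls under \<open>P_up\<close> with the
  opposite content difference. Applying T_i once more to that relation and using the quadratic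
  relation gives the image of \<open>P S\<close>.\<close>

lemma P_down:
  assumes S: "S \<in> Tab shape" and i: "i \<in> {1..<total}"
    and lt: "fst (box S (i + 1)) < fst (box S i)" "snd (box S i) < snd (box S (i + 1))"
  shows "swap_entries shape i S \<in> Tab shape"
    and "hecke t i (P S) =
      scale (t * (t powi (content_diff shape S i + 1) - 1) * (t powi (content_diff shape S i - 1) - 1)
          / (t powi content_diff shape S i - 1)\<^sup>2) (P (swap_entries shape i S))
      + scale (t powi content_diff shape S i * (t - 1) / (t powi content_diff shape S i - 1)) (P S)"
    (is ?T)
proof -
  let ?S' = "swap_entries shape i S"
  show S': "?S' \<in> Tab shape" using lt by (intro swap_entries_Tab[OF S i]) auto
  have bij: "bij_betw S boxes {1..total}" by (rule Tab_bij[OF S])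
  have b: "box ?S' i = box S (i + 1)" "box ?S' (i + 1) = box S i"
    using box_swap_entries[OF bij i, of i] box_swap_entries[OF bij i, of "i + 1"] i by auto
  define \<delta> where "\<delta> = content_diff shape S i"
  have \<delta>': "content_diff shape ?S' i = - \<delta>" unfolding \<delta>_def content_diff_eq b by simp
  have "\<delta> < 0" using lt by (simp add: \<delta>_def content_diff_eq box_content_def)
  define X where "X = t powi \<delta>"
  have X: "X \<noteq> 1" using \<open>\<delta> < 0\<close> by (simp add: X_def)
  have X': "t powi (\<delta> + 1) = X * t" "t powi (\<delta> - 1) = X / t"
    using t_nonzero by (simp_all add: X_def power_int_add power_int_diff)
  define e where "e = (t - 1) / (1 - X)"
  have T: "hecke t i (P ?S') = P S + scale e (P ?S')"
    using P_up(2)[OF S' i, unfolded b \<delta>' swap_entries_swap_entries[OF S], OF lt] by (simp add: e_def X_def)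
  have "hecke t i (hecke t i (P ?S')) = hecke t i (P S) + scale e (hecke t i (P ?S'))"
    by (subst T) (simp only: hecke_add hecke_scale)
  then have "hecke t i (P S) = scale (t - 1) (hecke t i (P ?S')) + scale t (P ?S') - scale e (hecke t i (P ?S'))"
    by (simp add: hecke_quadratic)
  also have "\<dots> = scale (t - 1 - e) (P S) + scale ((t - 1 - e) * e + t) (P ?S')"
    unfolding T by (simp add: mpoly.scale_right_distrib mpoly.scale_left_diff_distrib mpoly.scale_left_distrib left_diff_distrib)
  also have "t - 1 - e = X * (t - 1) / (X - 1)"
    using X unfolding e_def by (simp add: field_simps)
  also have "X * (t - 1) / (X - 1) * e + t = t * (X * t - 1) * (X / t - 1) / (X - 1)\<^sup>2"
  proof -
    have e2: "e = - ((t - 1) / (X - 1))" using X by (simp add: e_def field_simps)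
    show ?thesis unfolding e2 using X t_nonzero by (simp add: divide_simps power2_eq_square) (simp add: algebra_simps)
  qed
  finally show ?T
    unfolding \<delta>_def[symmetric] X' by (simp add: X_def add.commute)
qed

text \<open>The leading coefficient is a product of integer powers of \<open>q\<close> and
  \<open>t\<close>, neither of which vanishes at \<open>pt\<close>.\<close>

lemma P_nonzero:
  assumes S: "S \<in> Tab shape"
  shows "P S \<noteq> 0"
proof
  let ?\<alpha> = "tableau_comp d m shape S"
  assume "P S = 0"
  then have "spec pt (lookup (M ?\<alpha>) ?\<alpha>) = 0" by (metis P_def lookup_spec_poly lookup_zero)
  moreover obtain a b :: int where "lookup (M ?\<alpha>) ?\<alpha> = qvar powi a * tvar powi b"
    using M_lead[OF fam, of ?\<alpha>] tableau_comp_compatible[OF Tab_bij[OF S]] by (auto simp: compatible_def)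
  ultimately show False using spec_unit[OF q_nonzero t_nonzero, of a b] q_nonzero t_nonzero by simp
qed

text \<open>With equal contents, \<alpha>(S') has the weight prescribed by \<open>S\<close>, so
  \<open>compatible_unique\<close> applies to it. Every entry is then in the same row of both
  tableaux, and row and content fix the box.\<close>

lemma Tab_eqI:
  assumes S: "S \<in> Tab shape" and S': "S' \<in> Tab shape"
    and eq: "\<And>i. i \<in> {1..total} \<Longrightarrow> box_content (box S i) = box_content (box S' i)"
  shows "S = S'"
proof -
  note bij = Tab_bij[OF S] and bij' = Tab_bij[OF S']
  let ?\<alpha> = "tableau_comp d m shape S'"
  have "compatible S ?\<alpha>"
  proof (rule compatible_unique[OF Tab_filling[OF S]])
    show "?\<alpha> \<in> comps total" using tableau_comp_compatible[OF bij'] by (simp add: compatible_def)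
    fix b assume b: "b \<in> boxes"
    have i: "S b \<in> {1..total}" using bij b by (rule bij_betw_apply)
    have "spec pt (zeta total ?\<alpha> (S b)) = t powi box_content (box S' (S b))"
      using weight_filling[OF Tab_filling[OF S'] tableau_comp_compatible[OF bij'] box_in[OF bij' i]] S_box[OF bij' i] by simp
    then show "spec pt (zeta total ?\<alpha> (S b)) = t powi box_content b"
      using eq[OF i] box_S[OF bij b] by simp
  qed
  have rows: "m * level (fst b) = m * level (fst (box S' (S b)))" if b: "b \<in> boxes" for b
  proof -
    have "lookup ?\<alpha> (S b) = m * level (fst b)" using \<open>compatible S ?\<alpha>\<close> b by (simp add: compatible_def)
    then show ?thesis using bij_betw_apply[OF bij b] by (simp only: lookup_tableau_comp[OF bij'] if_True)
  qed
  show ?thesis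
  proof (rule extensionalityI[of _ boxes])
    fix b assume b: "b \<in> boxes"
    let ?b = "box S' (S b)"
    have i: "S b \<in> {1..total}" using bij b by (rule bij_betw_apply)
    have b': "?b \<in> boxes" by (rule box_in[OF bij' i])
    have "1 \<le> fst b" "1 \<le> fst ?b" using b b' by (auto simp: boxes)
    then have "fst b = fst ?b" using rows[OF b] m level_eq_iff by simp
    moreover have "box_content b = box_content ?b" using eq[OF i] box_S[OF bij b] by simp
    ultimately have "b = ?b" by (simp add: box_content_def prod_eq_iff)
    then show "S b = S' b" using S_box[OF bij' i] by simp
  qed (use S S' in \<open>simp_all add: Tab_iff\<close>)
qed

lemma P_span_zero:
  assumes S: "S \<in> Tab shape" and X: "X \<subseteq> Tab shape - {S}"
  shows "P S \<notin> mpoly.span (P ` X)"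
proof
  assume f: "P S \<in> mpoly.span (P ` X)"
  have "P S = 0"
  proof (rule eigen_span_zero[OF t_nonzero P_eigen[OF S] f])
    fix p assume "p \<in> P ` X"
    then obtain S' where S': "S' \<in> Tab shape" "S' \<noteq> S" "p = P S'" using X by blast
    then obtain j where "j \<in> {1..total}" "box_content (box S' j) \<noteq> box_content (box S j)"
      using Tab_eqI[OF S'(1) S] by blast
    then show "\<exists>w'. eigen total q t w' p \<and> (\<exists>j\<in>{1..total}. w' j \<noteq> t powi box_content (box S j))"
      using P_eigen[OF S'(1)] S'(3) by (intro exI[of _ "\<lambda>i. t powi box_content (box S' i)"]) auto
  qed
  then show False using P_nonzero[OF S] by contradiction
qed

lemma P_inj: "inj_on P (Tab shape)"
proof (rule inj_onI, rule ccontr)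
  fix S S' assume h: "S \<in> Tab shape" "S' \<in> Tab shape" "P S = P S'" "S \<noteq> S'"
  then have "P S \<in> mpoly.span (P ` {S'})" by (intro mpoly.span_base) simp
  then show False using P_span_zero[of S "{S'}"] h by auto
qed

lemma P_independent: "mpoly.independent (P ` Tab shape)"
  unfolding mpoly.dependent_def
proof
  assume "\<exists>a\<in>P ` Tab shape. a \<in> mpoly.span (P ` Tab shape - {a})"
  then obtain S where S: "S \<in> Tab shape" "P S \<in> mpoly.span (P ` Tab shape - {P S})" by blast
  have "P ` Tab shape - {P S} \<subseteq> P ` (Tab shape - {S})" by blast
  then have "P S \<in> mpoly.span (P ` (Tab shape - {S}))" using S(2) mpoly.span_mono by blast
  then show False using P_span_zero[OF S(1)] by blast
qed

lemma P_hecke_span: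
  assumes i: "i \<in> {1..<total}" and f: "f \<in> mpoly.span (P ` Tab shape)"
  shows "hecke t i f \<in> mpoly.span (P ` Tab shape)"
proof -
  let ?V = "mpoly.span (P ` Tab shape)"
  have base: "P S \<in> ?V" if "S \<in> Tab shape" for S using that by (intro mpoly.span_base) blast
  have "hecke t i (P S) \<in> ?V" if S: "S \<in> Tab shape" for S
  proof -
    obtain r c r' c' where b: "box S i = (r, c)" "box S (i + 1) = (r', c')" by (metis surj_pair)
    consider "r = r'" | "c = c'" | "r < r'" "c' < c" | "r' < r" "c < c'"
      using adjacent_cases[OF S i b] by blast
    then show ?thesis
    proof cases
      case 1
      then have "hecke t i (P S) = scale t (P S)" using P_row[OF S i] b by simp
      then show ?thesis using base[OF S] by (simp add: mpoly.span_scale)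
    next
      case 2
      then have "hecke t i (P S) = - P S" using P_col[OF S i] b by simp
      then show ?thesis using base[OF S] by (simp add: mpoly.span_neg)
    next
      case 3
      then have lt: "fst (box S i) < fst (box S (i + 1))" "snd (box S (i + 1)) < snd (box S i)" using b by simp_all
      show ?thesis unfolding P_up(2)[OF S i lt]
        by (intro mpoly.span_add mpoly.span_scale base S P_up(1)[OF S i lt])
    next
      case 4
      then have lt: "fst (box S (i + 1)) < fst (box S i)" "snd (box S i) < snd (box S (i + 1))" using b by simp_all
      show ?thesis unfolding P_down(2)[OF S i lt]
        by (intro mpoly.span_add mpoly.span_scale base S P_down(1)[OF S i lt])
    qed
  qed
  moreover have "mpoly.subspace {f. hecke t i f \<in> ?V}"
    by (rule mpoly.subspaceI) (auto simp: hecke_add hecke_scale mpoly.span_zero mpoly.span_add mpoly.span_scale)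
  ultimately have "?V \<subseteq> {f. hecke t i f \<in> ?V}" by (intro mpoly.span_minimal) auto
  with f show ?thesis by blast
qed

text \<open>The entry \<open>N\<close> lies in the box \<open>(1, 1)\<close> of content \<open>0\<close>.\<close>

lemma P_fix:
  assumes "f \<in> mpoly.span (P ` Tab shape)"
  shows "cherednik total q t total f = f"
proof -
  have tot: "total \<in> {1..total}" using \<nu> by (simp add: total_def)
  have "cherednik total q t total (P S) = P S" if S: "S \<in> Tab shape" for S
  proof -
    note bij = Tab_bij[OF S]
    have one: "(1, 1) \<in> boxes" using len_pos[of 1] by (simp add: boxes_iff)
    obtain r c where b: "box S total = (r, c)" by (metis surj_pair)
    have rc: "(r, c) \<in> boxes" "S (r, c) = total" using box_in[OF bij tot] S_box[OF bij tot] b by simp_all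
    have "S (1, 1) \<le> total" using bij_betw_apply[OF bij one] by simp
    then have "(r, c) = (1, 1)" using Tab_less[OF S rc(1) one] rc by (auto simp: boxes_iff)
    then have "box_content (box S total) = 0" by (simp add: b box_content_def)
    then show ?thesis using P_eigen[OF S] tot by (simp add: eigen_def)
  qed
  moreover have "mpoly.subspace {f. cherednik total q t total f = f}"
  proof (rule mpoly.subspaceI)
    show "0 \<in> {f. cherednik total q t total f = f}" using cherednik_scale[OF t_nonzero, of total q total 0 0] by simp
  qed (auto simp: cherednik_add[OF t_nonzero] cherednik_scale[OF t_nonzero])
  ultimately have "mpoly.span (P ` Tab shape) \<subseteq> {f. cherednik total q t total f = f}"
    by (intro mpoly.span_minimal) auto
  with assms show ?thesis by blast
qed

text \<open>Summing the parts over boxes instead of entries gives a degree that depends on the shape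
  alone.\<close>

lemma P_homogeneous:
  assumes S: "S \<in> Tab shape"
  shows "P S \<in> homogeneous_polys total (\<Sum>b\<in>boxes. m * level (fst b))"
proof -
  let ?\<alpha> = "tableau_comp d m shape S"
  have c: "compatible S ?\<alpha>" by (rule tableau_comp_compatible[OF Tab_bij[OF S]])
  have "size_comp total ?\<alpha> = (\<Sum>b\<in>boxes. lookup ?\<alpha> (S b))"
    unfolding size_comp_def by (rule sum.reindex_bij_betw[OF Tab_bij[OF S], symmetric])
  also have "\<dots> = (\<Sum>b\<in>boxes. m * level (fst b))" using c by (simp add: compatible_def)
  finally have "M ?\<alpha> \<in> homogeneous_polys total (\<Sum>b\<in>boxes. m * level (fst b))"
    using M_homogeneous[OF fam, of ?\<alpha>] c by (simp add: compatible_def)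
  moreover have "keys (P S) \<subseteq> keys (M ?\<alpha>)"
    by (auto simp: P_def in_keys_iff lookup_spec_poly)
  ultimately show ?thesis by (auto simp: homogeneous_polys_def)
qed

lemma subspace_homogeneous_polys: "mpoly.subspace (homogeneous_polys N D :: 'a::field mpoly set)"
proof (rule mpoly.subspaceI)
  show "0 \<in> (homogeneous_polys N D :: 'a mpoly set)" by (simp add: homogeneous_polys_def)
  show "p + p' \<in> homogeneous_polys N D" if "p \<in> homogeneous_polys N D" "p' \<in> homogeneous_polys N D" for p p' :: "'a mpoly"
    using that keys_add[of p p'] unfolding homogeneous_polys_def by blast
  show "scale c p \<in> homogeneous_polys N D" if "p \<in> homogeneous_polys N D" for c and p :: "'a mpoly"
  proof -
    have "scale c p = Poly_Mapping.map ((*) c) p" by (simp add: scale_def Cst_def mult_map_scale_conv_mult)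
    then have "keys (scale c p) \<subseteq> keys p" by (auto simp: in_keys_iff Poly_Mapping.map.rep_eq when_def)
    then show ?thesis using that unfolding homogeneous_polys_def by blast
  qed
qed

theorem P_isotype_basis: "isotype_basis shape t P"
  unfolding isotype_basis_def sum_shape
proof (intro conjI ballI)
  let ?V = "mpoly.span (P ` Tab shape)"
  show "\<exists>V D. mpoly.subspace V \<and> V \<subseteq> homogeneous_polys total D \<and>
        (\<forall>i\<in>{1..<total}. \<forall>f\<in>V. hecke t i f \<in> V) \<and>
        inj_on P (Tab shape) \<and> mpoly.independent (P ` Tab shape) \<and> mpoly.span (P ` Tab shape) = V"
  proof (intro exI conjI)
    show "?V \<subseteq> homogeneous_polys total (\<Sum>b\<in>boxes. m * level (fst b))"
      using P_homogeneous by (intro mpoly.span_minimal subspace_homogeneous_polys) auto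
    show "\<forall>i\<in>{1..<total}. \<forall>f\<in>?V. hecke t i f \<in> ?V" using P_hecke_span by blast
  qed (use P_inj P_independent in \<open>simp_all add: mpoly.subspace_span\<close>)
  fix S i assume S: "S \<in> Tab shape" and i: "i \<in> {1..<total}"
  have c: "content_diff shape S i = int (snd (box S i)) - int (fst (box S i)) - (int (snd (box S (i + 1))) - int (fst (box S (i + 1))))"
    by (simp add: content_diff_eq box_content_def)
  \<comment> \<open>The four relative positions of \<open>i\<close> and \<open>i + 1\<close> have
    content differences 1, -1, at least 2 and at most -2.\<close>
  have down: "fst (box S (i + 1)) < fst (box S i) \<and> snd (box S i) < snd (box S (i + 1))"
    if d2: "content_diff shape S i \<le> - 2"
  proof -
    obtain r c' r' c'' where b: "box S i = (r, c')" "box S (i + 1) = (r', c'')" by (metis surj_pair)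
    show ?thesis using adjacent_cases[OF S i b] d2 unfolding c b by auto
  qed
  show "let d = content_diff shape S i; S' = swap_entries shape i S in
          (row shape S i = row shape S (i + 1) \<longrightarrow> hecke t i (P S) = scale t (P S)) \<and>
          (col shape S i = col shape S (i + 1) \<longrightarrow> hecke t i (P S) = - P S) \<and>
          (row shape S i < row shape S (i + 1) \<and> col shape S i > col shape S (i + 1) \<longrightarrow>
             hecke t i (P S) = P S' + scale ((t - 1) / (1 - t powi (- d))) (P S)) \<and>
          (d \<le> -2 \<longrightarrow>
             hecke t i (P S) =
               scale (t * (t powi (d + 1) - 1) * (t powi (d - 1) - 1) / (t powi d - 1)\<^sup>2) (P S')
               + scale (t powi d * (t - 1) / (t powi d - 1)) (P S))"
    unfolding Let_def row_eq col_eq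
    using P_row[OF S i] P_col[OF S i] P_up(2)[OF S i] P_down(2)[OF S i] down by blast
qed

theorem P_singular:
  assumes S: "S \<in> Tab shape"
  shows "singular_at total pt (M (tableau_comp d m shape S))"
  unfolding singular_at_def
proof (intro conjI allI ballI)
  show "no_pole_at pt (lookup (M (tableau_comp d m shape S)) \<beta>)" for \<beta>
    using polys_over_lookup[OF subring_regular P_regular[OF S], of \<beta>] by (simp add: regular_def)
  fix i assume i: "i \<in> {1..total}"
  have "P S \<in> mpoly.span (P ` Tab shape)" using S by (intro mpoly.span_base) blast
  then have "dunkl total q t i (P S) = 0"
    using dunkl_zero[of t total "mpoly.span (P ` Tab shape)" q i] t_nonzero P_hecke_span P_fix i by blast
  then show "dunkl total q t i (spec_poly pt (M (tableau_comp d m shape S))) = 0" by (simp add: P_def)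
qed

end

end

theorem theorem1p1:
  fixes d K m n \<nu> N g :: nat and k :: int and \<tau> :: "nat list"
    and u \<omega> :: complex and pt :: "complex \<times> complex"
    and M :: "(nat \<Rightarrow>\<^sub>0 nat) \<Rightarrow> ratfun mpoly"
  assumes "d \<ge> 1" and "K \<ge> 1" and "m \<ge> 1" and "n \<ge> 2" and "1 \<le> \<nu>" and "\<nu> \<le> n - 1"
    and "N = (d * n - 1) + (K - 1) * (n - 1) + \<nu>"
    and "\<tau> = (d * n - 1) # replicate (K - 1) (n - 1) @ [\<nu>]"
    and "g = gcd m n"
    and "gcd k (int g) = 1"
    and "\<omega> = exp (2 * of_real pi * \<i> * of_int k / of_nat m)"
    and "u \<noteq> 0" and "\<forall>j::nat. j \<ge> 1 \<longrightarrow> u ^ j \<noteq> 1"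
    and "pt = (\<omega> * u powi (- int (n div g)), u ^ (m div g))"
    and "macdonald_family N M"
  shows "isotype_basis \<tau> (snd pt) (\<lambda>S. spec_poly pt (M (tableau_comp d m \<tau> S)))
       \<and> (\<forall>S\<in>Tab \<tau>. singular_at N pt (M (tableau_comp d m \<tau> S)))"
proof -
  interpret singular_point d K n \<nu> m g k u \<omega> pt
    using assms by unfold_locales auto
  have N: "N = total" and \<tau>: "\<tau> = shape" using assms by (simp_all add: total_def shape_def)
  have fam: "macdonald_family total M" using assms N by simp
  have "P M = (\<lambda>S. spec_poly pt (M (tableau_comp d m \<tau> S)))"
    by (simp add: fun_eq_iff P_def[OF fam] \<tau>)
  then show ?thesis
    using P_isotype_basis[OF fam] P_singular[OF fam] by (simp add: N \<tau>)
qed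

end
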